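(* Let $k$ be a commutative ring and let $A$ be one of the cdg algebras $A=k[c]$ or $A=k[c]/c^n$ with $n>1$, where $c$ has degree $2$, the predifferential is zero and the curvature is $c$. Then the only "derived" category $D_?(A)$ satisfying (A1), (A2) and (A3) is $D_?(A)=0$. If $k$ is a field, the same conclusion holds for every "derived" category satisfying (A1) and (A2) (i.e. $D_?(A)=0$).
   Context: A cdg $k$-algebra is a $\mathbb{Z}$-graded (associative, unital) $k$-algebra $A$ with a degree $1$ graded derivation $d$ (the predifferential) and an element $c\in A^2$ (the curvature) with $d(c)=0$ and $d^2(a)=ca-ac$ for all $a$. A (left) cdg $A$-module is a graded left $A$-module $M$ with a degree $1$ map $d_M$ such that $d_M(am)=d(a)m+(-1)^{|a|}a\,d_M(m)$ and $d_M^2(m)=cm$. These form an abelian category $\mathsf{Mod}(A)$, with morphisms the degree $0$ $A$-linear maps commuting with the predifferentials. The homotopy category $\underline{\mathsf{Mod}}(A)$ has the same objects, with morphisms taken modulo those of the form $d h+h d$ with $h$ a graded $A$-linear map of degree $-1$ (i.e. $h(am)=(-1)^{|a|}a\,h(m)$); it is a triangulated category with the usual shift and mapping cones. Shift: $M[1]^i=M^{i+1}$, $d_{M[1]}=-d_M$, with $a$ acting on $M[1]$ as $(-1)^{|a|}a$. (Modules over $k[c]$ are precomplexes of $k$-modules, i.e. graded $k$-modules with an arbitrary degree $1$ endomorphism $d$, with $c$ acting as $d^2$; modules over $k[c]/c^n$ are precomplexes with $d^{2n}=0$.) A "derived" category $D_?(A)$ of $A$ is a triangle quotient $\underline{\mathsf{Mod}}(A)/\mathcal{A}_?$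 by a thick subcategory $\mathcal{A}_?$ (a full triangulated subcategory closed under direct summands), whose objects are called acyclic. Conditions on $D_?(A)$: (A1) $\mathcal{A}_?$ contains all totalizations of short exact sequences $0\to M'\xrightarrow{f} M\xrightarrow{g} M''\to 0$ in $\mathsf{Mod}(A)$ (the totalization is the cone of the map $\mathrm{cone}(f)\to M''$ induced by $g$). (A2) $\mathcal{A}_?$ is closed under coproducts. (A3) $\mathcal{A}_?$ is closed under products. *)

theory Defs
  imports "HOL-Algebra.UnivPoly" "HOL-Algebra.QuotRing" "HOL-Algebra.Product_Groups"
    "HOL-Algebra.Exact_Sequence"
begin

section \<open>Curved differential graded algebras\<close>

text \<open>
  The grading is internal: \<open>homog A i\<close> is the set of homogeneous elements of degree \<open>i\<close>.
\<close>

record ('k, 'a) cdg_algebra = "('k, 'a) module" +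
  homog :: "int \<Rightarrow> 'a set"
  pred :: "'a \<Rightarrow> 'a"
  curv :: "'a"

text \<open>\<open>ksgn j\<close> is the Koszul sign \<open>(-1)^j\<close>, used as an exponent in (multiplicatively written)
  abelian groups and as \<open>add_pow\<close> coefficient in rings.\<close>

definition ksgn :: "int \<Rightarrow> int" where
  "ksgn j = (if even j then 1 else - 1)"

definition is_cdg_algebra :: "('k, 'e) ring_scheme \<Rightarrow> ('k, 'a, 'z) cdg_algebra_scheme \<Rightarrow> bool" where
  "is_cdg_algebra k A \<longleftrightarrow>
     module k A \<and> ring A \<and>
     (\<forall>r\<in>carrier k. \<forall>x\<in>carrier A. \<forall>y\<in>carrier A.
        (r \<odot>\<^bsub>A\<^esub> x) \<otimes>\<^bsub>A\<^esub> y = r \<odot>\<^bsub>A\<^esub> (x \<otimes>\<^bsub>A\<^esub> y) \<and>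
        x \<otimes>\<^bsub>A\<^esub> (r \<odot>\<^bsub>A\<^esub> y) = r \<odot>\<^bsub>A\<^esub> (x \<otimes>\<^bsub>A\<^esub> y)) \<and>
     (\<forall>i. submodule (homog A i) k A) \<and>
     (\<forall>x\<in>carrier A. \<exists>!f. (\<forall>i. f i \<in> homog A i) \<and> finite {i. f i \<noteq> \<zero>\<^bsub>A\<^esub>} \<and>
        x = (\<Oplus>\<^bsub>A\<^esub>i\<in>{i. f i \<noteq> \<zero>\<^bsub>A\<^esub>}. f i)) \<and>
     \<one>\<^bsub>A\<^esub> \<in> homog A 0 \<and>
     (\<forall>i j. \<forall>a\<in>homog A i. \<forall>b\<in>homog A j. a \<otimes>\<^bsub>A\<^esub> b \<in> homog A (i + j)) \<and>
     (\<forall>a\<in>carrier A. \<forall>b\<in>carrier A. pred A (a \<oplus>\<^bsub>A\<^esub> b) = pred A a \<oplus>\<^bsub>A\<^esub> pred A b) \<and>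
     (\<forall>r\<in>carrier k. \<forall>a\<in>carrier A. pred A (r \<odot>\<^bsub>A\<^esub> a) = r \<odot>\<^bsub>A\<^esub> pred A a) \<and>
     (\<forall>i. \<forall>a\<in>homog A i. pred A a \<in> homog A (i + 1)) \<and>
     (\<forall>i. \<forall>a\<in>homog A i. \<forall>b\<in>carrier A.
        pred A (a \<otimes>\<^bsub>A\<^esub> b) = pred A a \<otimes>\<^bsub>A\<^esub> b \<oplus>\<^bsub>A\<^esub> [ksgn i] \<cdot>\<^bsub>A\<^esub> (a \<otimes>\<^bsub>A\<^esub> pred A b)) \<and>
     curv A \<in> homog A 2 \<and>
     pred A (curv A) = \<zero>\<^bsub>A\<^esub> \<and>
     (\<forall>a\<in>carrier A. pred A (pred A a) = curv A \<otimes>\<^bsub>A\<^esub> a \<ominus>\<^bsub>A\<^esub> a \<otimes>\<^bsub>A\<^esub> curv A)"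

text \<open>\<open>k[c]\<close>: the variable \<open>c\<close> of \<open>UP k\<close> has degree 2, so the degree \<open>i\<close> component consists of
  the multiples of \<open>c^m\<close> with \<open>2 * m = i\<close>.\<close>

abbreviation cvar :: "('k, 'e) ring_scheme \<Rightarrow> nat \<Rightarrow> 'k" where
  "cvar k \<equiv> monom (UP k) \<one>\<^bsub>k\<^esub> 1"

definition poly_comp :: "('k, 'e) ring_scheme \<Rightarrow> int \<Rightarrow> (nat \<Rightarrow> 'k) set" where
  "poly_comp k i = {p \<in> carrier (UP k). \<forall>m. coeff (UP k) p m \<noteq> \<zero>\<^bsub>k\<^esub> \<longrightarrow> 2 * int m = i}"

definition poly_cdg :: "('k, 'e) ring_scheme \<Rightarrow> ('k, nat \<Rightarrow> 'k) cdg_algebra" where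
  "poly_cdg k =
     \<lparr>carrier = carrier (UP k), monoid.mult = monoid.mult (UP k), monoid.one = \<one>\<^bsub>UP k\<^esub>,
      ring.zero = \<zero>\<^bsub>UP k\<^esub>, ring.add = ring.add (UP k), smult = smult (UP k),
      homog = poly_comp k, pred = (\<lambda>_. \<zero>\<^bsub>UP k\<^esub>), curv = cvar k\<rparr>"

text \<open>\<open>k[c]/c^n\<close>, with the grading induced from \<open>k[c]\<close>.\<close>

definition trunc_ideal :: "('k, 'e) ring_scheme \<Rightarrow> nat \<Rightarrow> (nat \<Rightarrow> 'k) set" where
  "trunc_ideal k n = PIdl\<^bsub>UP k\<^esub> (cvar k [^]\<^bsub>UP k\<^esub> n)"

definition trunc_cdg :: "('k, 'e) ring_scheme \<Rightarrow> nat \<Rightarrow> ('k, (nat \<Rightarrow> 'k) set) cdg_algebra" where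
  "trunc_cdg k n =
     (let I = trunc_ideal k n; Q = UP k Quot I in
      \<lparr>carrier = carrier Q, monoid.mult = monoid.mult Q, monoid.one = \<one>\<^bsub>Q\<^esub>,
       ring.zero = \<zero>\<^bsub>Q\<^esub>, ring.add = ring.add Q,
       smult = (\<lambda>r X. (I +>\<^bsub>UP k\<^esub> monom (UP k) r 0) \<otimes>\<^bsub>Q\<^esub> X),
       homog = (\<lambda>i. (\<lambda>p. I +>\<^bsub>UP k\<^esub> p) ` poly_comp k i),
       pred = (\<lambda>_. \<zero>\<^bsub>Q\<^esub>), curv = I +>\<^bsub>UP k\<^esub> cvar k\<rparr>)"


subsection \<open>\<open>k[c]\<close> and \<open>k[c]/c^n\<close> are cdg algebras\<close>

lemma is_cdg_algebraI:
  fixes A :: "('k, 'a) cdg_algebra"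
  assumes alg: "algebra k A"
    and sub: "\<And>i. submodule (homog A i) k A"
    and dec: "\<And>x. x \<in> carrier A \<Longrightarrow> \<exists>!f. (\<forall>i. f i \<in> homog A i) \<and> finite {i. f i \<noteq> \<zero>\<^bsub>A\<^esub>} \<and>
        x = (\<Oplus>\<^bsub>A\<^esub>i\<in>{i. f i \<noteq> \<zero>\<^bsub>A\<^esub>}. f i)"
    and one: "\<one>\<^bsub>A\<^esub> \<in> homog A 0"
    and mul: "\<And>i j a b. a \<in> homog A i \<Longrightarrow> b \<in> homog A j \<Longrightarrow> a \<otimes>\<^bsub>A\<^esub> b \<in> homog A (i + j)"
    and pr: "pred A = (\<lambda>_. \<zero>\<^bsub>A\<^esub>)" and cu: "curv A \<in> homog A 2"
  shows "is_cdg_algebra k A"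
proof -
  interpret algebra k A by fact
  have cA: "cring A" by unfold_locales
  note m_comm = comm_monoid.m_comm[OF cring.axioms(2)[OF cA]]
  note rA = cring.axioms(1)[OF cA]
  have G: "group (add_monoid A)" using abelian_group.a_group[OF ring.is_abelian_group[OF rA]] .
  have sc: "a \<in> homog A i \<Longrightarrow> a \<in> carrier A" for a i
    using subgroup.subset[OF submodule.axioms(1)[OF sub[of i]]] by auto
  have z: "\<zero>\<^bsub>A\<^esub> \<in> homog A i" for i
    using subgroup.one_closed[OF submodule.axioms(1)[OF sub[of i]]] by simp
  have s2: "x \<otimes>\<^bsub>A\<^esub> (r \<odot>\<^bsub>A\<^esub> y) = r \<odot>\<^bsub>A\<^esub> (x \<otimes>\<^bsub>A\<^esub> y)"
    if "r \<in> carrier k" "x \<in> carrier A" "y \<in> carrier A" for r x y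
    using that smult_assoc2[of r y x] m_comm[of x "r \<odot>\<^bsub>A\<^esub> y"] m_comm[of x y] by simp
  have np: "[(m::int)] \<cdot>\<^bsub>A\<^esub> \<zero>\<^bsub>A\<^esub> = \<zero>\<^bsub>A\<^esub>" for m
    using group.int_pow_one[OF G] by (simp add: add_pow_def)
  show ?thesis
    unfolding is_cdg_algebra_def pr
    apply (intro conjI allI ballI)
    subgoal by unfold_locales
    subgoal by unfold_locales
    subgoal by (rule smult_assoc2)
    subgoal by (rule s2)
    subgoal by (rule sub)
    subgoal by (rule dec)
    subgoal by (rule one)
    subgoal by (rule mul)
    subgoal by simp
    subgoal by simp
    subgoal by (rule z)
    subgoal for i a b using sc[of a i] by (simp add: np)
    subgoal by (rule cu)
    subgoal by simp
    subgoal for a using sc[OF cu] by (simp add: m_comm[of "curv A" a] a_minus_def abelian_group.r_neg[OF ring.is_abelian_group[OF rA]])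
    done
qed

lemma poly_comp_submodule:
  assumes "cring k" shows "submodule (poly_comp k i) k (UP k)"
proof -
  interpret K: cring k by fact
  interpret U: UP_cring k "UP k" by unfold_locales simp
  have M: "module k (UP k)" using U.UP_algebra algebra.axioms by blast
  show ?thesis
    apply (rule module.submoduleI[OF M])
    apply (auto simp: poly_comp_def)
    subgoal by (metis K.add.r_cancel_one' U.coeff_closed K.r_zero K.zero_closed)
    subgoal by (metis K.r_null)
    done
qed

lemma poly_comp_mult:
  assumes "cring k" and a: "a \<in> poly_comp k i" and b: "b \<in> poly_comp k j"
  shows "a \<otimes>\<^bsub>UP k\<^esub> b \<in> poly_comp k (i + j)"
proof -
  interpret K: cring k by fact
  interpret U: UP_cring k "UP k" by unfold_locales simp
  have c: "a \<in> carrier (UP k)" "b \<in> carrier (UP k)" using a b by (auto simp: poly_comp_def)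
  have "2 * int m = i + j" if "coeff (UP k) (a \<otimes>\<^bsub>UP k\<^esub> b) m \<noteq> \<zero>\<^bsub>k\<^esub>" for m
  proof (rule ccontr)
    assume n: "2 * int m \<noteq> i + j"
    have "coeff (UP k) a l \<otimes>\<^bsub>k\<^esub> coeff (UP k) b (m - l) = \<zero>\<^bsub>k\<^esub>" if "l \<le> m" for l
    proof (cases "coeff (UP k) a l = \<zero>\<^bsub>k\<^esub> \<or> coeff (UP k) b (m - l) = \<zero>\<^bsub>k\<^esub>")
      case True thus ?thesis using c by auto
    next
      case False
      hence "2 * int l = i" "2 * int (m - l) = j" using a b by (auto simp: poly_comp_def)
      thus ?thesis using n that by auto
    qed
    hence "(\<Oplus>\<^bsub>k\<^esub>l\<in>{..m}. coeff (UP k) a l \<otimes>\<^bsub>k\<^esub> coeff (UP k) b (m - l)) = (\<Oplus>\<^bsub>k\<^esub>l\<in>{..m}. \<zero>\<^bsub>k\<^esub>)"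
      by (intro K.finsum_cong') auto
    thus False using that c by (simp add: K.finsum_zero)
  qed
  thus ?thesis using c by (simp add: poly_comp_def)
qed

lemma poly_comp_sum_coeff:
  assumes "cring k" and fin: "finite S" and p: "\<And>i. i \<in> S \<Longrightarrow> p i \<in> poly_comp k i"
  shows "coeff (UP k) (\<Oplus>\<^bsub>UP k\<^esub>i\<in>S. p i) m =
     (if 2 * int m \<in> S then coeff (UP k) (p (2 * int m)) m else \<zero>\<^bsub>k\<^esub>)"
proof -
  interpret K: cring k by fact
  interpret U: UP_cring k "UP k" by unfold_locales simp
  have c: "p \<in> S \<rightarrow> carrier (UP k)" using p by (auto simp: poly_comp_def)
  have "coeff (UP k) (finsum (UP k) p S) m = (\<Oplus>\<^bsub>k\<^esub>i\<in>S. coeff (UP k) (p i) m)"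
    using U.coeff_finsum[OF fin c] by simp
  also have "\<dots> = (\<Oplus>\<^bsub>k\<^esub>i\<in>S. if 2 * int m = i then coeff (UP k) (p i) m else \<zero>\<^bsub>k\<^esub>)"
    using p c by (intro K.finsum_cong') (auto simp: poly_comp_def)
  also have "\<dots> = (if 2 * int m \<in> S then coeff (UP k) (p (2 * int m)) m else \<zero>\<^bsub>k\<^esub>)"
  proof (cases "2 * int m \<in> S")
    case True
    thus ?thesis using K.finsum_singleton[OF True fin, of "\<lambda>i. coeff (UP k) (p i) m"] c by (auto simp: Pi_def)
  next
    case False
    hence "(\<Oplus>\<^bsub>k\<^esub>i\<in>S. if 2 * int m = i then coeff (UP k) (p i) m else \<zero>\<^bsub>k\<^esub>) = (\<Oplus>\<^bsub>k\<^esub>i\<in>S. \<zero>\<^bsub>k\<^esub>)"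
      by (intro K.finsum_cong') auto
    thus ?thesis using False by (simp add: K.finsum_zero)
  qed
  finally show ?thesis .
qed

definition homog_part :: "('k, 'e) ring_scheme \<Rightarrow> (nat \<Rightarrow> 'k) \<Rightarrow> int \<Rightarrow> nat \<Rightarrow> 'k" where
  "homog_part k p i = (if even i \<and> i \<ge> 0 then monom (UP k) (coeff (UP k) p (nat (i div 2))) (nat (i div 2))
     else \<zero>\<^bsub>UP k\<^esub>)"

lemma homog_part:
  assumes "cring k" and p: "p \<in> carrier (UP k)"
  shows homog_part_in: "homog_part k p i \<in> poly_comp k i"
    and homog_part_coeff: "coeff (UP k) (homog_part k p i) m = (if 2 * int m = i then coeff (UP k) p m else \<zero>\<^bsub>k\<^esub>)"
    and finite_homog_part: "finite {i. homog_part k p i \<noteq> \<zero>\<^bsub>UP k\<^esub>}"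
    and sum_homog_part: "finite S \<Longrightarrow> {i. homog_part k p i \<noteq> \<zero>\<^bsub>UP k\<^esub>} \<subseteq> S \<Longrightarrow> (\<Oplus>\<^bsub>UP k\<^esub>i\<in>S. homog_part k p i) = p"
proof -
  interpret K: cring k by fact
  interpret U: UP_cring k "UP k" by unfold_locales simp
  show c: "coeff (UP k) (homog_part k p i) m = (if 2 * int m = i then coeff (UP k) p m else \<zero>\<^bsub>k\<^esub>)" for i m
  proof (cases "even i \<and> i \<ge> 0")
    case True
    then obtain l where "i = 2 * int l" by (metis evenE nonneg_int_cases zero_le_mult_iff zero_less_numeral not_less)
    thus ?thesis using p by (auto simp: homog_part_def)
  next
    case False
    hence "2 * int m \<noteq> i" by auto
    thus ?thesis using p False by (auto simp: homog_part_def)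
  qed
  show i: "homog_part k p i \<in> poly_comp k i" for i
    using p c by (auto simp: poly_comp_def homog_part_def)
  have pc: "homog_part k p i \<in> carrier (UP k)" for i using i by (auto simp: poly_comp_def)
  have "{i. homog_part k p i \<noteq> \<zero>\<^bsub>UP k\<^esub>} \<subseteq> (\<lambda>m. 2 * int m) ` {..deg k p}"
  proof
    fix i assume "i \<in> {i. homog_part k p i \<noteq> \<zero>\<^bsub>UP k\<^esub>}"
    hence a: "even i" "i \<ge> 0" "coeff (UP k) p (nat (i div 2)) \<noteq> \<zero>\<^bsub>k\<^esub>"
      by (auto simp: homog_part_def split: if_splits)
    hence "nat (i div 2) \<le> deg k p" using U.deg_aboveD[OF _ p] by (meson not_le)
    moreover have "i = 2 * int (nat (i div 2))" using a by auto
    ultimately show "i \<in> (\<lambda>m. 2 * int m) ` {..deg k p}" by blast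
  qed
  thus "finite {i. homog_part k p i \<noteq> \<zero>\<^bsub>UP k\<^esub>}" by (rule finite_subset) auto
  assume S: "finite S" "{i. homog_part k p i \<noteq> \<zero>\<^bsub>UP k\<^esub>} \<subseteq> S"
  show "(\<Oplus>\<^bsub>UP k\<^esub>i\<in>S. homog_part k p i) = p"
  proof (rule U.up_eqI)
    fix m
    have "coeff (UP k) p m = \<zero>\<^bsub>k\<^esub>" if "2 * int m \<notin> S"
    proof -
      have "homog_part k p (2 * int m) = \<zero>\<^bsub>UP k\<^esub>" using that S by auto
      thus ?thesis using c[of "2 * int m" m] by simp
    qed
    thus "coeff (UP k) (\<Oplus>\<^bsub>UP k\<^esub>i\<in>S. homog_part k p i) m = coeff (UP k) p m"
      using poly_comp_sum_coeff[OF assms(1) S(1) i, of m] c by simp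
  qed (use pc p in \<open>auto intro!: U.P.finsum_closed\<close>)
qed

lemma finsum_poly_cdg: "finsum (poly_cdg k) = finsum (UP k)"
  by (simp add: finsum_def poly_cdg_def finprod_def fun_eq_iff)

lemma is_cdg_algebra_poly_cdg:
  assumes "cring k" shows "is_cdg_algebra k (poly_cdg k)"
proof -
  interpret K: cring k by fact
  interpret U: UP_cring k "UP k" by unfold_locales simp
  have alg: "algebra k (poly_cdg k)"
  proof -
    interpret U: algebra k "UP k" by (rule U.UP_algebra)
    have "cring (poly_cdg k)"
      by (auto intro!: cringI abelian_groupI comm_monoidI simp: poly_cdg_def U.UP_a_assoc U.UP_m_assoc
          U.UP_l_distr U.UP_l_neg_ex intro: U.UP_a_comm U.UP_m_comm)
    thus ?thesis using U.smult_closed U.smult_l_distr U.smult_r_distr U.smult_assoc1 U.smult_one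
       U.smult_assoc2 K.cring_axioms
      by (intro algebraI) (simp_all add: poly_cdg_def)
  qed
  show ?thesis
  proof (rule is_cdg_algebraI[OF alg])
    show "submodule (homog (poly_cdg k) i) k (poly_cdg k)" for i
      using poly_comp_submodule[OF assms, of i]
      by (simp add: submodule_def submodule_axioms_def subgroup_def a_inv_def m_inv_def poly_cdg_def)
    show "\<one>\<^bsub>poly_cdg k\<^esub> \<in> homog (poly_cdg k) 0"
      by (auto simp: poly_cdg_def poly_comp_def split: if_splits)
    show "a \<otimes>\<^bsub>poly_cdg k\<^esub> b \<in> homog (poly_cdg k) (i + j)"
      if "a \<in> homog (poly_cdg k) i" "b \<in> homog (poly_cdg k) j" for a b i j
      using that poly_comp_mult[OF assms] by (auto simp: poly_cdg_def)
    show "pred (poly_cdg k) = (\<lambda>_. \<zero>\<^bsub>poly_cdg k\<^esub>)" by (simp add: poly_cdg_def)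
    show "curv (poly_cdg k) \<in> homog (poly_cdg k) 2"
      by (auto simp: poly_cdg_def poly_comp_def split: if_splits)
    fix p assume "p \<in> carrier (poly_cdg k)"
    hence p: "p \<in> carrier (UP k)" by (simp add: poly_cdg_def)
    have "\<exists>!f. (\<forall>i. f i \<in> poly_comp k i) \<and> finite {i. f i \<noteq> \<zero>\<^bsub>UP k\<^esub>} \<and>
        p = (\<Oplus>\<^bsub>UP k\<^esub>i\<in>{i. f i \<noteq> \<zero>\<^bsub>UP k\<^esub>}. f i)"
    proof (rule ex1I[of _ "homog_part k p"], goal_cases)
      case 1 show ?case using homog_part_in[OF assms p] finite_homog_part[OF assms p]
        sum_homog_part[OF assms p finite_homog_part[OF assms p]] by simp
    next
      case (2 f)
      show ?case
      proof
        fix i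
        have cf: "f i \<in> carrier (UP k)" using 2 by (auto simp: poly_comp_def)
        show "f i = homog_part k p i"
        proof (rule U.up_eqI[OF _ cf])
          fix m
          have "coeff (UP k) p m = (if 2 * int m \<in> {i. f i \<noteq> \<zero>\<^bsub>UP k\<^esub>} then coeff (UP k) (f (2 * int m)) m else \<zero>\<^bsub>k\<^esub>)"
            using poly_comp_sum_coeff[OF assms, of "{i. f i \<noteq> \<zero>\<^bsub>UP k\<^esub>}" f m] 2 by auto
          hence "coeff (UP k) p m = coeff (UP k) (f (2 * int m)) m" by auto
          thus "coeff (UP k) (f i) m = coeff (UP k) (homog_part k p i) m"
            using homog_part_coeff[OF assms p] 2 by (auto simp: poly_comp_def)
        qed (use homog_part_in[OF assms p] in \<open>auto simp: poly_comp_def\<close>)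
      qed
    qed
    thus "\<exists>!f. (\<forall>i. f i \<in> homog (poly_cdg k) i) \<and> finite {i. f i \<noteq> \<zero>\<^bsub>poly_cdg k\<^esub>} \<and>
        p = finsum (poly_cdg k) f {i. f i \<noteq> \<zero>\<^bsub>poly_cdg k\<^esub>}"
      unfolding finsum_poly_cdg by (simp add: poly_cdg_def)
  qed
qed


lemma trunc_ideal:
  assumes "cring k"
  shows ideal_trunc_ideal: "ideal (trunc_ideal k n) (UP k)"
    and mem_trunc_ideal: "p \<in> trunc_ideal k n \<longleftrightarrow> p \<in> carrier (UP k) \<and> (\<forall>m<n. coeff (UP k) p m = \<zero>\<^bsub>k\<^esub>)"
proof -
  interpret K: cring k by fact
  interpret U: UP_cring k "UP k" by unfold_locales simp
  have pw: "cvar k [^]\<^bsub>UP k\<^esub> n = monom (UP k) \<one>\<^bsub>k\<^esub> n"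
    by (induction n) (simp_all del: U.monom_mult One_nat_def add: U.monom_one_Suc)
  let ?c = "monom (UP k) \<one>\<^bsub>k\<^esub> n"
  have cc: "?c \<in> carrier (UP k)" by simp
  show "ideal (trunc_ideal k n) (UP k)"
    unfolding trunc_ideal_def pw using cring.cgenideal_ideal[OF U.UP_cring cc] .
  have mem: "p \<in> trunc_ideal k n \<longleftrightarrow> (\<exists>q\<in>carrier (UP k). p = q \<otimes>\<^bsub>UP k\<^esub> ?c)"
    unfolding trunc_ideal_def pw cgenideal_def by blast
  show "p \<in> trunc_ideal k n \<longleftrightarrow> p \<in> carrier (UP k) \<and> (\<forall>m<n. coeff (UP k) p m = \<zero>\<^bsub>k\<^esub>)"
  proof
    assume "p \<in> trunc_ideal k n"
    then obtain q where q: "q \<in> carrier (UP k)" "p = q \<otimes>\<^bsub>UP k\<^esub> ?c" using mem by blast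
    have "coeff (UP k) p m = \<zero>\<^bsub>k\<^esub>" if "m < n" for m
    proof -
      have "coeff (UP k) p m = (\<Oplus>\<^bsub>k\<^esub>i\<in>{..m}. coeff (UP k) q i \<otimes>\<^bsub>k\<^esub> coeff (UP k) ?c (m - i))"
        using q by simp
      also have "\<dots> = (\<Oplus>\<^bsub>k\<^esub>i\<in>{..m}. \<zero>\<^bsub>k\<^esub>)"
        using that q by (intro K.finsum_cong') auto
      finally show ?thesis by (simp add: K.finsum_zero)
    qed
    thus "p \<in> carrier (UP k) \<and> (\<forall>m<n. coeff (UP k) p m = \<zero>\<^bsub>k\<^esub>)" using q by simp
  next
    assume p: "p \<in> carrier (UP k) \<and> (\<forall>m<n. coeff (UP k) p m = \<zero>\<^bsub>k\<^esub>)"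
    let ?S = "{..deg k p}"
    define q where "q = (\<Oplus>\<^bsub>UP k\<^esub>i\<in>?S. monom (UP k) (coeff (UP k) p i) (i - n))"
    have q: "q \<in> carrier (UP k)" unfolding q_def using p by (intro U.P.finsum_closed) auto
    have "q \<otimes>\<^bsub>UP k\<^esub> ?c = (\<Oplus>\<^bsub>UP k\<^esub>i\<in>?S. monom (UP k) (coeff (UP k) p i) (i - n) \<otimes>\<^bsub>UP k\<^esub> ?c)"
      unfolding q_def using p by (intro U.P.finsum_ldistr) auto
    also have "\<dots> = (\<Oplus>\<^bsub>UP k\<^esub>i\<in>?S. monom (UP k) (coeff (UP k) p i) i)"
    proof (intro U.P.finsum_cong')
      fix i assume "i \<in> ?S"
      show "monom (UP k) (coeff (UP k) p i) (i - n) \<otimes>\<^bsub>UP k\<^esub> ?c = monom (UP k) (coeff (UP k) p i) i"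
      proof (cases "i < n")
        case True thus ?thesis using p cc by simp
      next
        case False
        thus ?thesis using p U.monom_mult[of "coeff (UP k) p i" "\<one>\<^bsub>k\<^esub>" "i - n" n]
          by (simp del: U.monom_mult)
      qed
    qed (use p in auto)
    also have "\<dots> = p" using p U.up_repr by blast
    finally show "p \<in> trunc_ideal k n" using mem q by metis
  qed
qed

lemma is_cdg_algebra_trunc_cdg:
  assumes "cring k" shows "is_cdg_algebra k (trunc_cdg k n)"
proof -
  interpret K: cring k by fact
  interpret U: UP_cring k "UP k" by unfold_locales simp
  define I where "I = trunc_ideal k n"
  define Q where "Q = UP k Quot I"
  define \<pi> where "\<pi> = (\<lambda>p. I +>\<^bsub>UP k\<^esub> p)"
  let ?A = "trunc_cdg k n"
  interpret I: ideal I "UP k" unfolding I_def by (rule ideal_trunc_ideal[OF assms])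
  have cQ: "cring Q" unfolding Q_def by (rule I.quotient_is_cring[OF U.UP_cring])
  interpret Q: cring Q by (rule cQ)
  interpret h: ring_hom_cring "UP k" Q \<pi>
    unfolding Q_def \<pi>_def by (rule I.rcos_ring_hom_cring[OF U.UP_cring])
  have surj: "\<exists>p\<in>carrier (UP k). x = \<pi> p" if "x \<in> carrier Q" for x
    using that by (auto simp: Q_def \<pi>_def FactRing_def A_RCOSETS_def')
  have ker: "\<pi> p = \<pi> q \<longleftrightarrow> (\<forall>m<n. coeff (UP k) p m = coeff (UP k) q m)"
    if "p \<in> carrier (UP k)" "q \<in> carrier (UP k)" for p q
  proof -
    have "\<pi> p = \<pi> q \<longleftrightarrow> p \<ominus>\<^bsub>UP k\<^esub> q \<in> I"
      unfolding \<pi>_def using that I.a_rcos_module_minus[OF U.UP_ring that(2,1)] I.a_rcos_self[of p]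
        I.a_repr_independence'[of p q] by auto
    also have "\<dots> \<longleftrightarrow> (\<forall>m<n. coeff (UP k) p m \<ominus>\<^bsub>k\<^esub> coeff (UP k) q m = \<zero>\<^bsub>k\<^esub>)"
      unfolding I_def mem_trunc_ideal[OF assms] using that
      by (auto simp: a_minus_def)
    also have "\<dots> \<longleftrightarrow> (\<forall>m<n. coeff (UP k) p m = coeff (UP k) q m)"
    proof -
      have "x \<ominus>\<^bsub>k\<^esub> y = \<zero>\<^bsub>k\<^esub> \<longleftrightarrow> x = y" if "x \<in> carrier k" "y \<in> carrier k" for x y
        using that K.minus_equality[of x "\<ominus>\<^bsub>k\<^esub> y"] by (auto simp: a_minus_def K.r_neg)
      thus ?thesis using that by auto
    qed
    finally show ?thesis .
  qed
  have A: "carrier ?A = carrier Q" "monoid.mult ?A = monoid.mult Q" "\<one>\<^bsub>?A\<^esub> = \<one>\<^bsub>Q\<^esub>" "\<zero>\<^bsub>?A\<^esub> = \<zero>\<^bsub>Q\<^esub>"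
    "ring.add ?A = ring.add Q" "smult ?A = (\<lambda>r x. \<pi> (monom (UP k) r 0) \<otimes>\<^bsub>Q\<^esub> x)"
    "homog ?A = (\<lambda>i. \<pi> ` poly_comp k i)" "pred ?A = (\<lambda>_. \<zero>\<^bsub>Q\<^esub>)" "curv ?A = \<pi> (cvar k)"
    by (simp_all add: trunc_cdg_def I_def Q_def \<pi>_def Let_def)
  have pc: "p \<in> carrier (UP k)" if "p \<in> poly_comp k i" for p i using that by (simp add: poly_comp_def)
  have li: "\<exists>y\<in>carrier Q. y \<oplus>\<^bsub>Q\<^esub> x = \<zero>\<^bsub>Q\<^esub>" if "x \<in> carrier Q" for x
    using Q.l_neg[OF that] Q.a_inv_closed[OF that] by blast
  have cA: "cring ?A"
    by (intro cringI abelian_groupI comm_monoidI) (simp_all add: A Q.a_ac Q.m_ac Q.r_distr li)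
  have alg: "algebra k ?A"
    using K.cring_axioms cA
    apply (intro algebraI)
    subgoal by simp
    subgoal by simp
    subgoal by (simp add: A)
    subgoal by (simp add: A Q.l_distr h.hom_add)
    subgoal by (simp add: A Q.r_distr)
    subgoal for a b x using U.monom_mult[of a b 0 0] by (simp add: A Q.m_assoc h.hom_mult del: U.monom_mult)
    subgoal by (simp add: A)
    subgoal by (simp add: A Q.m_assoc)
    done
  have fs: "finsum ?A = finsum Q" by (simp add: finsum_def finprod_def A fun_eq_iff)
  have hs: "\<pi> (\<Oplus>\<^bsub>UP k\<^esub>i\<in>S. p i) = (\<Oplus>\<^bsub>Q\<^esub>i\<in>S. \<pi> (p i))" if "p \<in> S \<rightarrow> carrier (UP k)" for p and S :: "int set"
    using h.hom_finsum[OF that] by (simp add: comp_def)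
  show ?thesis
  proof (rule is_cdg_algebraI[OF alg])
    show "submodule (homog ?A i) k ?A" for i
    proof (rule module.submoduleI)
      show "module k ?A" using alg algebra.axioms by blast
      interpret S: submodule "poly_comp k i" k "UP k" by (rule poly_comp_submodule[OF assms])
      have z: "\<zero>\<^bsub>UP k\<^esub> \<in> poly_comp k i" using S.one_closed by simp
      show "\<zero>\<^bsub>?A\<^esub> \<in> homog ?A i" using z h.hom_zero by (force simp: A)
      show "homog ?A i \<subseteq> carrier ?A" using pc by (auto simp: A)
      show "x \<oplus>\<^bsub>?A\<^esub> y \<in> homog ?A i" if h: "x \<in> homog ?A i" "y \<in> homog ?A i" for x y
      proof -
        obtain p q where "p \<in> poly_comp k i" "q \<in> poly_comp k i" "x = \<pi> p" "y = \<pi> q"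
          using h by (auto simp: A)
        thus ?thesis using pc S.m_closed[of p q] by (simp add: A h.hom_add[symmetric] del: h.hom_add)
      qed
      show sc: "r \<odot>\<^bsub>?A\<^esub> x \<in> homog ?A i" if h: "r \<in> carrier k" "x \<in> homog ?A i" for r x
      proof -
        obtain p where p: "p \<in> poly_comp k i" "x = \<pi> p" using h by (auto simp: A)
        have "r \<odot>\<^bsub>?A\<^esub> x = \<pi> (r \<odot>\<^bsub>UP k\<^esub> p)"
          using p pc that by (simp add: A h.hom_mult[symmetric] U.monom_mult_is_smult del: h.hom_mult)
        thus ?thesis using S.smult_closed[OF that(1) p(1)] by (simp add: A)
      qed
      show "\<ominus>\<^bsub>?A\<^esub> x \<in> homog ?A i" if h: "x \<in> homog ?A i" for x
      proof -
        interpret alg: algebra k ?A by (rule alg)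
        have xc: "x \<in> carrier ?A" using that pc by (auto simp: A)
        have "\<ominus>\<^bsub>?A\<^esub> x = (\<ominus>\<^bsub>k\<^esub> \<one>\<^bsub>k\<^esub>) \<odot>\<^bsub>?A\<^esub> x" using xc alg.smult_l_minus by simp
        thus ?thesis using sc[of "\<ominus>\<^bsub>k\<^esub> \<one>\<^bsub>k\<^esub>"] that by simp
      qed
    qed
    have "\<one>\<^bsub>UP k\<^esub> \<in> poly_comp k 0" by (auto simp: poly_comp_def split: if_splits)
    thus "\<one>\<^bsub>?A\<^esub> \<in> homog ?A 0" using h.hom_one by (force simp: A)
    show "a \<otimes>\<^bsub>?A\<^esub> b \<in> homog ?A (i + j)" if h: "a \<in> homog ?A i" "b \<in> homog ?A j" for a b i j
    proof -
      obtain p q where "p \<in> poly_comp k i" "q \<in> poly_comp k j" "a = \<pi> p" "b = \<pi> q"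
        using h by (auto simp: A)
      thus ?thesis using pc poly_comp_mult[OF assms, of p i q j] by (simp add: A h.hom_mult[symmetric] del: h.hom_mult)
    qed
    show "pred ?A = (\<lambda>_. \<zero>\<^bsub>?A\<^esub>)" by (simp add: A)
    show "curv ?A \<in> homog ?A 2" by (auto simp: A poly_comp_def split: if_splits intro!: imageI)
    fix x assume "x \<in> carrier ?A"
    then obtain p where p: "p \<in> carrier (UP k)" "x = \<pi> p" using surj by (auto simp: A)
    define f where "f = (\<lambda>i. \<pi> (homog_part k p i))"
    have pcc: "homog_part k p i \<in> carrier (UP k)" for i using homog_part_in[OF assms p(1)] pc by blast
    have sub: "{i. f i \<noteq> \<zero>\<^bsub>Q\<^esub>} \<subseteq> {i. homog_part k p i \<noteq> \<zero>\<^bsub>UP k\<^esub>}" by (auto simp: f_def)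
    have fin: "finite {i. f i \<noteq> \<zero>\<^bsub>Q\<^esub>}" using finite_subset[OF sub finite_homog_part[OF assms p(1)]] .
    have "x = \<pi> (\<Oplus>\<^bsub>UP k\<^esub>i\<in>{i. homog_part k p i \<noteq> \<zero>\<^bsub>UP k\<^esub>}. homog_part k p i)"
      using p sum_homog_part[OF assms p(1) finite_homog_part[OF assms p(1)]] by simp
    also have "\<dots> = (\<Oplus>\<^bsub>Q\<^esub>i\<in>{i. homog_part k p i \<noteq> \<zero>\<^bsub>UP k\<^esub>}. f i)"
      unfolding f_def using pcc by (intro hs) auto
    also have "\<dots> = (\<Oplus>\<^bsub>Q\<^esub>i\<in>{i. f i \<noteq> \<zero>\<^bsub>Q\<^esub>}. f i)"
      using sub finite_homog_part[OF assms p(1)] pcc by (intro Q.add.finprod_mono_neutral_cong_right) (auto simp: f_def)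
    finally have xs: "x = (\<Oplus>\<^bsub>Q\<^esub>i\<in>{i. f i \<noteq> \<zero>\<^bsub>Q\<^esub>}. f i)" .
    have "\<exists>!f. (\<forall>i. f i \<in> \<pi> ` poly_comp k i) \<and> finite {i. f i \<noteq> \<zero>\<^bsub>Q\<^esub>} \<and>
        x = (\<Oplus>\<^bsub>Q\<^esub>i\<in>{i. f i \<noteq> \<zero>\<^bsub>Q\<^esub>}. f i)"
    proof (rule ex1I[of _ f], goal_cases)
      case 1 show ?case using homog_part_in[OF assms p(1)] xs fin by (auto simp: f_def)
    next
      case (2 g)
      let ?S = "{i. g i \<noteq> \<zero>\<^bsub>Q\<^esub>}"
      have "\<exists>r. \<forall>i. r i \<in> poly_comp k i \<and> g i = \<pi> (r i)" using 2 by (intro choice) blast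
      then obtain r where r: "\<And>i. r i \<in> poly_comp k i" "\<And>i. g i = \<pi> (r i)" by blast
      have "\<pi> p = \<pi> (\<Oplus>\<^bsub>UP k\<^esub>i\<in>?S. r i)"
      proof -
        have "\<pi> p = (\<Oplus>\<^bsub>Q\<^esub>i\<in>?S. g i)" using 2 p by simp
        also have "\<dots> = (\<Oplus>\<^bsub>Q\<^esub>i\<in>?S. \<pi> (r i))" by (simp only: r(2))
        also have "\<dots> = \<pi> (\<Oplus>\<^bsub>UP k\<^esub>i\<in>?S. r i)" using pc[OF r(1)] by (intro hs[symmetric]) (rule Pi_I)
        finally show ?thesis .
      qed
      hence eq: "coeff (UP k) p m = coeff (UP k) (\<Oplus>\<^bsub>UP k\<^esub>i\<in>?S. r i) m" if "m < n" for m
        using ker[OF p(1), of "\<Oplus>\<^bsub>UP k\<^esub>i\<in>?S. r i"] that U.P.finsum_closed[of r ?S] pc[OF r(1)] by blast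
      have z: "coeff (UP k) (r i) m = \<zero>\<^bsub>k\<^esub>" if "m < n" "i \<notin> ?S" for m i
      proof -
        have "\<pi> (r i) = \<pi> \<zero>\<^bsub>UP k\<^esub>" using that r by simp
        thus ?thesis using ker[OF pc[OF r(1)], of "\<zero>\<^bsub>UP k\<^esub>"] that by simp
      qed
      show ?case
      proof
        fix i
        have "coeff (UP k) (r i) m = coeff (UP k) (homog_part k p i) m" if "m < n" for m
        proof (cases "2 * int m = i")
          case True
          have "coeff (UP k) p m = (if i \<in> ?S then coeff (UP k) (r i) m else \<zero>\<^bsub>k\<^esub>)"
            using eq[OF that] poly_comp_sum_coeff[OF assms, of ?S r m] 2 r(1) True by simp
          thus ?thesis using z[OF that, of i] homog_part_coeff[OF assms p(1)] True by metis
        next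
          case False
          hence "coeff (UP k) (r i) m = \<zero>\<^bsub>k\<^esub>" using r(1)[of i] by (auto simp: poly_comp_def)
          thus ?thesis using homog_part_coeff[OF assms p(1)] False by simp
        qed
        thus "g i = f i" unfolding r(2) f_def using ker[OF pc[OF r(1)] pcc] by blast
      qed
    qed
    thus "\<exists>!f. (\<forall>i. f i \<in> homog ?A i) \<and> finite {i. f i \<noteq> \<zero>\<^bsub>?A\<^esub>} \<and>
        x = finsum ?A f {i. f i \<noteq> \<zero>\<^bsub>?A\<^esub>}"
      unfolding fs A .
  qed
qed


section \<open>Modules\<close>

text \<open>
  A graded module is an external family \<open>gr M i\<close> of abelian groups, so that degreewise
  constructions (products, cones) are available. As elsewhere in HOL-Algebra, these groups
  are written multiplicatively: \<open>\<otimes>\<close> is the sum and \<open>x [^] ksgn j\<close> is \<open>(-1)^j x\<close>.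
  \<open>act M j i a\<close> is the action of \<open>a\<close>, homogeneous of degree \<open>j\<close>, on degree \<open>i\<close>; the degree \<open>j\<close> is an
  argument because \<open>a = 0\<close> has every degree.
\<close>

record ('a, 'u) cdg_module =
  gr :: "int \<Rightarrow> 'u monoid"
  act :: "int \<Rightarrow> int \<Rightarrow> 'a \<Rightarrow> 'u \<Rightarrow> 'u"
  md :: "int \<Rightarrow> 'u \<Rightarrow> 'u"

abbreviation el :: "('a, 'u) cdg_module \<Rightarrow> int \<Rightarrow> 'u set" where
  "el M i \<equiv> carrier (gr M i)"

definition Mods :: "('k, 'a) cdg_algebra \<Rightarrow> ('a, 'u) cdg_module set" where
  "Mods A = {M.
     (\<forall>i. comm_group (gr M i)) \<and>
     (\<forall>j i. \<forall>a\<in>homog A j. act M j i a \<in> hom (gr M i) (gr M (j + i))) \<and>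
     (\<forall>j i. \<forall>a\<in>homog A j. \<forall>b\<in>homog A j. \<forall>x\<in>el M i.
        act M j i (a \<oplus>\<^bsub>A\<^esub> b) x = act M j i a x \<otimes>\<^bsub>gr M (j + i)\<^esub> act M j i b x) \<and>
     (\<forall>j l i. \<forall>a\<in>homog A j. \<forall>b\<in>homog A l. \<forall>x\<in>el M i.
        act M (j + l) i (a \<otimes>\<^bsub>A\<^esub> b) x = act M j (l + i) a (act M l i b x)) \<and>
     (\<forall>i. \<forall>x\<in>el M i. act M 0 i \<one>\<^bsub>A\<^esub> x = x) \<and>
     (\<forall>i. md M i \<in> hom (gr M i) (gr M (i + 1))) \<and>
     (\<forall>j i. \<forall>a\<in>homog A j. \<forall>x\<in>el M i.
        md M (j + i) (act M j i a x) =
          act M (j + 1) i (pred A a) x \<otimes>\<^bsub>gr M (j + i + 1)\<^esub>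
          (act M j (i + 1) a (md M i x) [^]\<^bsub>gr M (j + i + 1)\<^esub> ksgn j)) \<and>
     (\<forall>i. \<forall>x\<in>el M i. md M (i + 1) (md M i x) = act M 2 i (curv A) x)}"

text \<open>Graded \<open>A\<close>-linear maps of degree \<open>p\<close>, with \<open>f (a x) = (-1)^(p |a|) a (f x)\<close>.\<close>

definition lin :: "('k, 'a) cdg_algebra \<Rightarrow> int \<Rightarrow> ('a, 'u) cdg_module \<Rightarrow> ('a, 'v) cdg_module
    \<Rightarrow> (int \<Rightarrow> 'u \<Rightarrow> 'v) set" where
  "lin A p M N = {f.
     (\<forall>i. f i \<in> hom (gr M i) (gr N (i + p))) \<and>
     (\<forall>j i. \<forall>a\<in>homog A j. \<forall>x\<in>el M i.
        f (j + i) (act M j i a x) =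
          act N j (i + p) a (f i x) [^]\<^bsub>gr N (j + i + p)\<^esub> ksgn (p * j))}"

definition mor :: "('k, 'a) cdg_algebra \<Rightarrow> ('a, 'u) cdg_module \<Rightarrow> ('a, 'v) cdg_module
    \<Rightarrow> (int \<Rightarrow> 'u \<Rightarrow> 'v) set" where
  "mor A M N = {f \<in> lin A 0 M N. \<forall>i. \<forall>x\<in>el M i. f (i + 1) (md M i x) = md N i (f i x)}"

definition mcomp :: "(int \<Rightarrow> 'v \<Rightarrow> 'w) \<Rightarrow> (int \<Rightarrow> 'u \<Rightarrow> 'v) \<Rightarrow> int \<Rightarrow> 'u \<Rightarrow> 'w" (infixr "\<bullet>" 75) where
  "g \<bullet> f = (\<lambda>i. g i \<circ> f i)"

definition mid :: "int \<Rightarrow> 'u \<Rightarrow> 'u" where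
  "mid = (\<lambda>i x. x)"

definition mzero :: "('a, 'v) cdg_module \<Rightarrow> int \<Rightarrow> 'u \<Rightarrow> 'v" where
  "mzero N = (\<lambda>i x. \<one>\<^bsub>gr N i\<^esub>)"

definition madd :: "('a, 'v) cdg_module \<Rightarrow> (int \<Rightarrow> 'u \<Rightarrow> 'v) \<Rightarrow> (int \<Rightarrow> 'u \<Rightarrow> 'v) \<Rightarrow> int \<Rightarrow> 'u \<Rightarrow> 'v" where
  "madd N f g = (\<lambda>i x. f i x \<otimes>\<^bsub>gr N i\<^esub> g i x)"

text \<open>Isomorphism in \<open>Mods A\<close>. The two modules may have different element types; this is how
  the constructions below, which change the type, are brought back to a fixed type.\<close>

definition iso_mod :: "('k, 'a) cdg_algebra \<Rightarrow> ('a, 'u) cdg_module \<Rightarrow> ('a, 'v) cdg_module \<Rightarrow> bool" where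
  "iso_mod A M N \<longleftrightarrow> (\<exists>f\<in>mor A M N. \<forall>i. bij_betw (f i) (el M i) (el N i))"

definition short_exact :: "('k, 'a) cdg_algebra \<Rightarrow> ('a, 'u) cdg_module \<Rightarrow> (int \<Rightarrow> 'u \<Rightarrow> 'u)
    \<Rightarrow> ('a, 'u) cdg_module \<Rightarrow> (int \<Rightarrow> 'u \<Rightarrow> 'u) \<Rightarrow> ('a, 'u) cdg_module \<Rightarrow> bool" where
  "short_exact A M' f M g M'' \<longleftrightarrow> f \<in> mor A M' M \<and> g \<in> mor A M M'' \<and>
     (\<forall>i. short_exact_sequence (gr M'' i) (gr M i) (gr M' i) (g i) (f i))"


subsection \<open>Shift, cone, totalization, products and coproducts\<close>

definition shift :: "('a, 'u) cdg_module \<Rightarrow> ('a, 'u) cdg_module" where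
  "shift M =
     \<lparr>gr = (\<lambda>i. gr M (i + 1)),
      act = (\<lambda>j i a x. act M j (i + 1) a x [^]\<^bsub>gr M (j + i + 1)\<^esub> ksgn j),
      md = (\<lambda>i x. inv\<^bsub>gr M (i + 2)\<^esub> (md M (i + 1) x))\<rparr>"

text \<open>The cone of \<open>f : M \<rightarrow> N\<close> is \<open>N \<oplus> M[1]\<close> with \<open>d (y, x) = (d y + f x, - d x)\<close>.\<close>

definition cone :: "('a, 'u) cdg_module \<Rightarrow> ('a, 'v) cdg_module \<Rightarrow> (int \<Rightarrow> 'u \<Rightarrow> 'v)
    \<Rightarrow> ('a, 'v \<times> 'u) cdg_module" where
  "cone M N f =
     \<lparr>gr = (\<lambda>i. gr N i \<times>\<times> gr (shift M) i),
      act = (\<lambda>j i a (y, x). (act N j i a y, act (shift M) j i a x)),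
      md = (\<lambda>i (y, x). (md N i y \<otimes>\<^bsub>gr N (i + 1)\<^esub> f (i + 1) x, md (shift M) i x))\<rparr>"

definition totalization :: "('a, 'u) cdg_module \<Rightarrow> (int \<Rightarrow> 'u \<Rightarrow> 'v) \<Rightarrow> ('a, 'v) cdg_module
    \<Rightarrow> (int \<Rightarrow> 'v \<Rightarrow> 'w) \<Rightarrow> ('a, 'w) cdg_module \<Rightarrow> ('a, 'w \<times> 'v \<times> 'u) cdg_module" where
  "totalization M' f M g M'' = cone (cone M' M f) M'' (\<lambda>i (y, x). g i y)"

definition prod_mod :: "'i set \<Rightarrow> ('i \<Rightarrow> ('a, 'u) cdg_module) \<Rightarrow> ('a, 'i \<Rightarrow> 'u) cdg_module" where
  "prod_mod I F =
     \<lparr>gr = (\<lambda>i. product_group I (\<lambda>s. gr (F s) i)),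
      act = (\<lambda>j i a x. \<lambda>s\<in>I. act (F s) j i a (x s)),
      md = (\<lambda>i x. \<lambda>s\<in>I. md (F s) i (x s))\<rparr>"

definition coprod_mod :: "'i set \<Rightarrow> ('i \<Rightarrow> ('a, 'u) cdg_module) \<Rightarrow> ('a, 'i \<Rightarrow> 'u) cdg_module" where
  "coprod_mod I F = (prod_mod I F)\<lparr>gr := (\<lambda>i. sum_group I (\<lambda>s. gr (F s) i))\<rparr>"


section \<open>The homotopy category and its quotients\<close>

text \<open>Homotopic morphisms agree in the homotopy category; values outside the carriers are ignored.\<close>

definition homotopic :: "('k, 'a) cdg_algebra \<Rightarrow> ('a, 'u) cdg_module \<Rightarrow> ('a, 'v) cdg_module
    \<Rightarrow> (int \<Rightarrow> 'u \<Rightarrow> 'v) \<Rightarrow> (int \<Rightarrow> 'u \<Rightarrow> 'v) \<Rightarrow> bool" where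
  "homotopic A M N f g \<longleftrightarrow> (\<exists>h\<in>lin A (- 1) M N. \<forall>i. \<forall>x\<in>el M i.
     f i x = g i x \<otimes>\<^bsub>gr N i\<^esub> (md N (i - 1) (h i x) \<otimes>\<^bsub>gr N i\<^esub> h (i + 1) (md M i x)))"

text \<open>\<open>M\<close> is a biproduct of \<open>X\<close> and \<open>Y\<close> in the homotopy category.\<close>

definition homotopy_biproduct :: "('k, 'a) cdg_algebra \<Rightarrow> ('a, 'u) cdg_module
    \<Rightarrow> ('a, 'u) cdg_module \<Rightarrow> ('a, 'u) cdg_module \<Rightarrow> bool" where
  "homotopy_biproduct A M X Y \<longleftrightarrow>
     (\<exists>i\<in>mor A X M. \<exists>p\<in>mor A M X. \<exists>j\<in>mor A Y M. \<exists>q\<in>mor A M Y.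
        homotopic A X X (p \<bullet> i) mid \<and> homotopic A Y Y (q \<bullet> j) mid \<and>
        homotopic A X Y (q \<bullet> i) (mzero Y) \<and> homotopic A Y X (p \<bullet> j) (mzero X) \<and>
        homotopic A M M (madd M (i \<bullet> p) (j \<bullet> q)) mid)"

text \<open>
  Modules have their elements in a type \<open>'u\<close>, playing the role of the universe. A full subcategory is
  a set \<open>\<A>\<close> of modules. Closure of \<open>\<A>\<close> under one of the constructions means
  that every module over \<open>'u\<close> that is isomorphic to the result of the construction lies in \<open>\<A>\<close>.

  Closure under isomorphism in the homotopy category is the case \<open>Y = 0\<close> of the last condition.
\<close>

definition thick :: "('k, 'a) cdg_algebra \<Rightarrow> ('a, 'u) cdg_module set \<Rightarrow> bool" where
  "thick A \<A> \<longleftrightarrow>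
     \<A> \<subseteq> Mods A \<and>
     (\<forall>Z\<in>Mods A. (\<forall>i. el Z i = {\<one>\<^bsub>gr Z i\<^esub>}) \<longrightarrow> Z \<in> \<A>) \<and>
     (\<forall>M\<in>Mods A. shift M \<in> \<A> \<longleftrightarrow> M \<in> \<A>) \<and>
     (\<forall>M\<in>\<A>. \<forall>N\<in>\<A>. \<forall>f\<in>mor A M N. \<forall>C\<in>Mods A. iso_mod A C (cone M N f) \<longrightarrow> C \<in> \<A>) \<and>
     (\<forall>M\<in>\<A>. \<forall>X\<in>Mods A. \<forall>Y\<in>Mods A. homotopy_biproduct A M X Y \<longrightarrow> X \<in> \<A>)"

text \<open>
  Morphisms \<open>X \<rightarrow> Y\<close> in the Verdier quotient by \<open>\<A>\<close>: classes of roofs \<open>X \<leftarrow> Z \<rightarrow> Y\<close> whose left leg has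
  its cone in \<open>\<A>\<close>, two roofs being identified if a third one dominates both of them in the
  homotopy category.
\<close>

definition quasi_iso :: "('k, 'a) cdg_algebra \<Rightarrow> ('a, 'u) cdg_module set
    \<Rightarrow> ('a, 'u) cdg_module \<Rightarrow> ('a, 'u) cdg_module \<Rightarrow> (int \<Rightarrow> 'u \<Rightarrow> 'u) set" where
  "quasi_iso A \<A> M N = {s \<in> mor A M N. \<exists>C\<in>\<A>. iso_mod A C (cone M N s)}"

type_synonym ('a, 'u) roof = "('a, 'u) cdg_module \<times> (int \<Rightarrow> 'u \<Rightarrow> 'u) \<times> (int \<Rightarrow> 'u \<Rightarrow> 'u)"

definition roofs :: "('k, 'a) cdg_algebra \<Rightarrow> ('a, 'u) cdg_module set
    \<Rightarrow> ('a, 'u) cdg_module \<Rightarrow> ('a, 'u) cdg_module \<Rightarrow> ('a, 'u) roof set" where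
  "roofs A \<A> X Y = {(Z, s, f). Z \<in> Mods A \<and> s \<in> quasi_iso A \<A> Z X \<and> f \<in> mor A Z Y}"

definition roof_rel :: "('k, 'a) cdg_algebra \<Rightarrow> ('a, 'u) cdg_module set
    \<Rightarrow> ('a, 'u) cdg_module \<Rightarrow> ('a, 'u) cdg_module \<Rightarrow> (('a, 'u) roof \<times> ('a, 'u) roof) set" where
  "roof_rel A \<A> X Y = {((Z1, s1, f1), (Z2, s2, f2)).
     (Z1, s1, f1) \<in> roofs A \<A> X Y \<and> (Z2, s2, f2) \<in> roofs A \<A> X Y \<and>
     (\<exists>Z\<in>Mods A. \<exists>u1\<in>mor A Z Z1. \<exists>u2\<in>mor A Z Z2.
        s1 \<bullet> u1 \<in> quasi_iso A \<A> Z X \<and>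
        homotopic A Z X (s1 \<bullet> u1) (s2 \<bullet> u2) \<and> homotopic A Z Y (f1 \<bullet> u1) (f2 \<bullet> u2))}"

definition derived_hom :: "('k, 'a) cdg_algebra \<Rightarrow> ('a, 'u) cdg_module set
    \<Rightarrow> ('a, 'u) cdg_module \<Rightarrow> ('a, 'u) cdg_module \<Rightarrow> ('a, 'u) roof set set" where
  "derived_hom A \<A> X Y = roofs A \<A> X Y // roof_rel A \<A> X Y"

definition derived_cat_zero :: "('k, 'a) cdg_algebra \<Rightarrow> ('a, 'u) cdg_module set \<Rightarrow> bool" where
  "derived_cat_zero A \<A> \<longleftrightarrow> (\<forall>X\<in>Mods A. \<forall>Y\<in>Mods A. \<exists>\<phi>. derived_hom A \<A> X Y = {\<phi>})"


subsection \<open>Conditions on the acyclic objects\<close>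

definition A1 :: "('k, 'a) cdg_algebra \<Rightarrow> ('a, 'u) cdg_module set \<Rightarrow> bool" where
  "A1 A \<A> \<longleftrightarrow>
     (\<forall>M'\<in>Mods A. \<forall>M\<in>Mods A. \<forall>M''\<in>(Mods A :: ('a, 'u) cdg_module set). \<forall>f g. short_exact A M' f M g M'' \<longrightarrow>
        (\<forall>T\<in>Mods A. iso_mod A T (totalization M' f M g M'') \<longrightarrow> T \<in> \<A>))"

text \<open>
  The index sets are the subsets of the universe \<open>'u\<close>. If \<open>'u\<close> is infinite, the coproducts in question
  all exist over \<open>'u\<close>; products only matter insofar as they fit into \<open>'u\<close>.
  Hence a class of modules (of unbounded size) that is closed under all products, or all
  coproducts, satisfies these conditions after restriction to the modules over any given \<open>'u\<close>.
\<close>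

definition A2 :: "('k, 'a) cdg_algebra \<Rightarrow> ('a, 'u) cdg_module set \<Rightarrow> bool" where
  "A2 A \<A> \<longleftrightarrow>
     (\<forall>(I :: 'u set) F. (\<forall>s\<in>I. F s \<in> \<A>) \<longrightarrow>
        (\<forall>P\<in>Mods A. iso_mod A P (coprod_mod I F) \<longrightarrow> P \<in> \<A>))"

definition A3 :: "('k, 'a) cdg_algebra \<Rightarrow> ('a, 'u) cdg_module set \<Rightarrow> bool" where
  "A3 A \<A> \<longleftrightarrow>
     (\<forall>(I :: 'u set) F. (\<forall>s\<in>I. F s \<in> \<A>) \<longrightarrow>
        (\<forall>P\<in>Mods A. iso_mod A P (prod_mod I F) \<longrightarrow> P \<in> \<A>))"

end

theory Submission
  imports Defs "HOL-Library.Equipollence"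
begin

text \<open>
  The quotient category vanishes if and only if every module is acyclic. One direction is clear. For the
  other, if the identity and the zero endomorphism of \<open>X\<close> agree in the quotient, then some
  \<open>u : Z \<rightarrow> X\<close> with acyclic cone is null-homotopic (\<open>derived_cat_zeroD\<close>); then \<open>X\<close> is a summand of this cone
  (\<open>null_homotopic_cone\<close>), hence acyclic. As the class of all modules has the closure properties,
  it remains to show that every module \<open>M\<close> is acyclic if all totalizations of exact sequences are.

  A \<open>k[c]\<close>-module is a graded \<open>k\<close>-module with an arbitrary endomorphism of degree 1. So
  \<open>M \<oplus> M[1] \<oplus> M[2]\<close> with \<open>d (x, y, z) = (d x + y, - d y + z, d z)\<close> is a module, in which \<open>a\<close> acts
  as \<open>(a x + a' z, \<plusminus> a y, a z)\<close> with \<open>a' = da/dc\<close> (\<open>jets\<close>). It contains the cone of the identity of \<open>M\<close>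
  with quotient \<open>M[2]\<close>, and \<open>M\<close> with quotient the cone of the identity of \<open>M[1]\<close>. These cones are
  contractible. As totalizations are acyclic, exact sequences give triangles in the quotient
  category, and both \<open>M \<rightarrow> jets M\<close> and \<open>jets M \<rightarrow> M[2]\<close> become isomorphisms there. Their composition
  is zero, so \<open>M\<close> is zero (\<open>acyc_if_derivation\<close>).

  Over \<open>k[c]/c^n\<close> the power \<open>c^n\<close> acts on \<open>jets M\<close> through \<open>n c^(n-1) z\<close>, so the construction
  yields a module when \<open>c^(n-1)\<close> kills \<open>M\<close>. This is the case for \<open>c M\<close>, and, as \<open>n > 1\<close>, for the kernel of
  \<open>c\<close>; and \<open>M\<close> is an extension of the former by the latter (\<open>acyc_if_nilpotent\<close>).
\<close>

section \<open>Calculations in graded modules\<close>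

lemma pow_ksgn:
  assumes "group G" "x \<in> carrier G"
  shows "x [^]\<^bsub>G\<^esub> ksgn j = (if even j then x else inv\<^bsub>G\<^esub> x)"
proof -
  interpret group G by fact
  show ?thesis using assms int_pow_neg[of x 1] by (simp add: ksgn_def)
qed

definition zero_module :: "('a, 'v) cdg_module" where
  "zero_module = \<lparr>gr = (\<lambda>i. singleton_group undefined), act = (\<lambda>j i a x. undefined), md = (\<lambda>i x. undefined)\<rparr>"

text \<open>
  What calculations in modules need of a cdg algebra: the algebra elements that occur in the
  module axioms are homogeneous of the expected degrees.
\<close>

locale curved_algebra =
  fixes A :: "('k, 'a) cdg_algebra"
  assumes pred_in: "a \<in> homog A j \<Longrightarrow> pred A a \<in> homog A (j + 1)"
    and curv_in: "curv A \<in> homog A 2"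
    and one_in: "\<one>\<^bsub>A\<^esub> \<in> homog A 0"
    and add_in: "a \<in> homog A j \<Longrightarrow> b \<in> homog A j \<Longrightarrow> a \<oplus>\<^bsub>A\<^esub> b \<in> homog A j"
    and mult_in: "a \<in> homog A j \<Longrightarrow> b \<in> homog A l \<Longrightarrow> a \<otimes>\<^bsub>A\<^esub> b \<in> homog A (j + l)"
begin

lemmas alg_in = pred_in curv_in one_in add_in mult_in

lemma Mods_comm_group: "M \<in> Mods A \<Longrightarrow> comm_group (gr M i)"
  by (simp add: Mods_def)

lemma Mods_group: "M \<in> Mods A \<Longrightarrow> group (gr M i)"
  by (simp add: Mods_comm_group comm_group.axioms)

lemma Mods_monoid: "M \<in> Mods A \<Longrightarrow> monoid (gr M i)"
  by (simp add: Mods_group group.is_monoid)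

lemma group_cancel:
  assumes "M \<in> Mods A" "x \<in> el M i" "y \<in> el M i"
  shows "x \<otimes>\<^bsub>gr M i\<^esub> (inv\<^bsub>gr M i\<^esub> x \<otimes>\<^bsub>gr M i\<^esub> y) = y"
    and "inv\<^bsub>gr M i\<^esub> x \<otimes>\<^bsub>gr M i\<^esub> (x \<otimes>\<^bsub>gr M i\<^esub> y) = y"
    and "x \<otimes>\<^bsub>gr M i\<^esub> (y \<otimes>\<^bsub>gr M i\<^esub> inv\<^bsub>gr M i\<^esub> x) = y"
    and "inv\<^bsub>gr M i\<^esub> x \<otimes>\<^bsub>gr M i\<^esub> (y \<otimes>\<^bsub>gr M i\<^esub> x) = y"
    and "z \<in> el M i \<Longrightarrow> x \<otimes>\<^bsub>gr M i\<^esub> (y \<otimes>\<^bsub>gr M i\<^esub> (inv\<^bsub>gr M i\<^esub> x \<otimes>\<^bsub>gr M i\<^esub> z)) = y \<otimes>\<^bsub>gr M i\<^esub> z"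
    and "z \<in> el M i \<Longrightarrow> inv\<^bsub>gr M i\<^esub> x \<otimes>\<^bsub>gr M i\<^esub> (y \<otimes>\<^bsub>gr M i\<^esub> (x \<otimes>\<^bsub>gr M i\<^esub> z)) = y \<otimes>\<^bsub>gr M i\<^esub> z"
proof -
  interpret comm_group "gr M i" using assms(1) by (rule Mods_comm_group)
  have c: "x \<otimes>\<^bsub>gr M i\<^esub> (inv\<^bsub>gr M i\<^esub> x \<otimes>\<^bsub>gr M i\<^esub> y) = y"
    "inv\<^bsub>gr M i\<^esub> x \<otimes>\<^bsub>gr M i\<^esub> (x \<otimes>\<^bsub>gr M i\<^esub> y) = y" if "y \<in> el M i" for y
    using assms that by (simp_all add: m_assoc[symmetric])
  show "x \<otimes>\<^bsub>gr M i\<^esub> (inv\<^bsub>gr M i\<^esub> x \<otimes>\<^bsub>gr M i\<^esub> y) = y"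
    and "inv\<^bsub>gr M i\<^esub> x \<otimes>\<^bsub>gr M i\<^esub> (x \<otimes>\<^bsub>gr M i\<^esub> y) = y"
    using assms c by simp_all
  show "x \<otimes>\<^bsub>gr M i\<^esub> (y \<otimes>\<^bsub>gr M i\<^esub> inv\<^bsub>gr M i\<^esub> x) = y"
    and "inv\<^bsub>gr M i\<^esub> x \<otimes>\<^bsub>gr M i\<^esub> (y \<otimes>\<^bsub>gr M i\<^esub> x) = y"
    using assms by (simp_all add: m_lcomm[of _ y])
  show "x \<otimes>\<^bsub>gr M i\<^esub> (y \<otimes>\<^bsub>gr M i\<^esub> (inv\<^bsub>gr M i\<^esub> x \<otimes>\<^bsub>gr M i\<^esub> z)) = y \<otimes>\<^bsub>gr M i\<^esub> z"
    and "inv\<^bsub>gr M i\<^esub> x \<otimes>\<^bsub>gr M i\<^esub> (y \<otimes>\<^bsub>gr M i\<^esub> (x \<otimes>\<^bsub>gr M i\<^esub> z)) = y \<otimes>\<^bsub>gr M i\<^esub> z" if "z \<in> el M i"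
    using assms that c by (simp_all add: m_lcomm[of _ y])
qed

lemmas group_rules =
  monoid.one_closed[OF Mods_monoid] group.inv_closed[OF Mods_group] monoid.m_closed[OF Mods_monoid]
  monoid.l_one[OF Mods_monoid] monoid.r_one[OF Mods_monoid] group.inv_inv[OF Mods_group]
  monoid.inv_one[OF Mods_monoid] comm_group.inv_mult[OF Mods_comm_group]
  group.r_inv[OF Mods_group] group.l_inv[OF Mods_group] group_cancel

lemma group_ac:
  assumes "M \<in> Mods A" "x \<in> el M i" "y \<in> el M i"
  shows "x \<otimes>\<^bsub>gr M i\<^esub> y = y \<otimes>\<^bsub>gr M i\<^esub> x"
    and "z \<in> el M i \<Longrightarrow> x \<otimes>\<^bsub>gr M i\<^esub> y \<otimes>\<^bsub>gr M i\<^esub> z = x \<otimes>\<^bsub>gr M i\<^esub> (y \<otimes>\<^bsub>gr M i\<^esub> z)"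
    and "z \<in> el M i \<Longrightarrow> x \<otimes>\<^bsub>gr M i\<^esub> (y \<otimes>\<^bsub>gr M i\<^esub> z) = y \<otimes>\<^bsub>gr M i\<^esub> (x \<otimes>\<^bsub>gr M i\<^esub> z)"
proof -
  interpret comm_group "gr M i" using assms(1) by (rule Mods_comm_group)
  show "x \<otimes>\<^bsub>gr M i\<^esub> y = y \<otimes>\<^bsub>gr M i\<^esub> x"
    and "z \<in> el M i \<Longrightarrow> x \<otimes>\<^bsub>gr M i\<^esub> y \<otimes>\<^bsub>gr M i\<^esub> z = x \<otimes>\<^bsub>gr M i\<^esub> (y \<otimes>\<^bsub>gr M i\<^esub> z)"
    and "z \<in> el M i \<Longrightarrow> x \<otimes>\<^bsub>gr M i\<^esub> (y \<otimes>\<^bsub>gr M i\<^esub> z) = y \<otimes>\<^bsub>gr M i\<^esub> (x \<otimes>\<^bsub>gr M i\<^esub> z)"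
    using assms m_ac by auto
qed

lemma hom_rules:
  assumes "f \<in> hom G H" "group G" "group H"
  shows "x \<in> carrier G \<Longrightarrow> f x \<in> carrier H"
    and "x \<in> carrier G \<Longrightarrow> y \<in> carrier G \<Longrightarrow> f (x \<otimes>\<^bsub>G\<^esub> y) = f x \<otimes>\<^bsub>H\<^esub> f y"
    and "x \<in> carrier G \<Longrightarrow> f (inv\<^bsub>G\<^esub> x) = inv\<^bsub>H\<^esub> f x"
    and "f \<one>\<^bsub>G\<^esub> = \<one>\<^bsub>H\<^esub>"
proof -
  interpret group_hom G H f using assms by (simp add: group_hom_def group_hom_axioms_def)
  show "x \<in> carrier G \<Longrightarrow> f x \<in> carrier H"
    and "x \<in> carrier G \<Longrightarrow> y \<in> carrier G \<Longrightarrow> f (x \<otimes>\<^bsub>G\<^esub> y) = f x \<otimes>\<^bsub>H\<^esub> f y"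
    and "x \<in> carrier G \<Longrightarrow> f (inv\<^bsub>G\<^esub> x) = inv\<^bsub>H\<^esub> f x"
    and "f \<one>\<^bsub>G\<^esub> = \<one>\<^bsub>H\<^esub>" by simp_all
qed

lemma act_hom: "M \<in> Mods A \<Longrightarrow> a \<in> homog A j \<Longrightarrow> act M j i a \<in> hom (gr M i) (gr M (j + i))"
  by (simp add: Mods_def)

lemma md_hom: "M \<in> Mods A \<Longrightarrow> md M i \<in> hom (gr M i) (gr M (i + 1))"
  by (simp add: Mods_def)

text \<open>
  The same degree occurs in many forms, such as \<open>i + 1 + 1\<close> and \<open>2 + i\<close>. Degrees that a rule would
  fix by its pattern are therefore variables, constrained by equations that arithmetic can solve.
\<close>

lemma mod_rules:
  assumes M: "M \<in> Mods A"
  shows "a \<in> homog A j \<Longrightarrow> x \<in> el M i \<Longrightarrow> l = j + i \<Longrightarrow> act M j i a x \<in> el M l"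
    and "a \<in> homog A j \<Longrightarrow> x \<in> el M i \<Longrightarrow> y \<in> el M i \<Longrightarrow>
      act M j i a (x \<otimes>\<^bsub>gr M i\<^esub> y) = act M j i a x \<otimes>\<^bsub>gr M (j + i)\<^esub> act M j i a y"
    and "a \<in> homog A j \<Longrightarrow> x \<in> el M i \<Longrightarrow> act M j i a (inv\<^bsub>gr M i\<^esub> x) = inv\<^bsub>gr M (j + i)\<^esub> act M j i a x"
    and "a \<in> homog A j \<Longrightarrow> act M j i a \<one>\<^bsub>gr M i\<^esub> = \<one>\<^bsub>gr M (j + i)\<^esub>"
    and "x \<in> el M i \<Longrightarrow> l = i + 1 \<Longrightarrow> md M i x \<in> el M l"
    and "x \<in> el M i \<Longrightarrow> y \<in> el M i \<Longrightarrow> md M i (x \<otimes>\<^bsub>gr M i\<^esub> y) = md M i x \<otimes>\<^bsub>gr M (i + 1)\<^esub> md M i y"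
    and "x \<in> el M i \<Longrightarrow> md M i (inv\<^bsub>gr M i\<^esub> x) = inv\<^bsub>gr M (i + 1)\<^esub> md M i x"
    and "md M i \<one>\<^bsub>gr M i\<^esub> = \<one>\<^bsub>gr M (i + 1)\<^esub>"
    and "x \<in> el M i \<Longrightarrow> act M 0 i \<one>\<^bsub>A\<^esub> x = x"
    and "a \<in> homog A j \<Longrightarrow> b \<in> homog A j \<Longrightarrow> x \<in> el M i \<Longrightarrow>
      act M j i (a \<oplus>\<^bsub>A\<^esub> b) x = act M j i a x \<otimes>\<^bsub>gr M (j + i)\<^esub> act M j i b x"
    and "a \<in> homog A j \<Longrightarrow> b \<in> homog A l \<Longrightarrow> x \<in> el M i \<Longrightarrow>
      act M (j + l) i (a \<otimes>\<^bsub>A\<^esub> b) x = act M j (l + i) a (act M l i b x)"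
    and "a \<in> homog A j \<Longrightarrow> x \<in> el M i \<Longrightarrow> m = j + i \<Longrightarrow>
      md M m (act M j i a x) = act M (j + 1) i (pred A a) x \<otimes>\<^bsub>gr M (j + i + 1)\<^esub>
        (if even j then act M j (i + 1) a (md M i x)
         else inv\<^bsub>gr M (j + i + 1)\<^esub> act M j (i + 1) a (md M i x))"
    and "x \<in> el M i \<Longrightarrow> m = i + 1 \<Longrightarrow> md M m (md M i x) = act M 2 i (curv A) x"
proof -
  note hom = hom_rules[OF act_hom[OF M] Mods_group[OF M] Mods_group[OF M]]
  note mhom = hom_rules[OF md_hom[OF M] Mods_group[OF M] Mods_group[OF M]]
  show ac: "a \<in> homog A j \<Longrightarrow> x \<in> el M i \<Longrightarrow> l = j + i \<Longrightarrow> act M j i a x \<in> el M l" for a j x i l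
    using hom(1) by blast
  show mc: "x \<in> el M i \<Longrightarrow> l = i + 1 \<Longrightarrow> md M i x \<in> el M l" for x i l
    using mhom(1) by blast
  show "a \<in> homog A j \<Longrightarrow> x \<in> el M i \<Longrightarrow> m = j + i \<Longrightarrow>
      md M m (act M j i a x) = act M (j + 1) i (pred A a) x \<otimes>\<^bsub>gr M (j + i + 1)\<^esub>
        (if even j then act M j (i + 1) a (md M i x)
         else inv\<^bsub>gr M (j + i + 1)\<^esub> act M j (i + 1) a (md M i x))"
    using M ac[of a j "md M i x" "i + 1" "j + i + 1"] mc[of x i "i + 1"]
    by (simp add: Mods_def pow_ksgn[OF Mods_group[OF M]] add.assoc)
qed (use M in \<open>auto simp: Mods_def hom_rules[OF act_hom[OF M] Mods_group[OF M] Mods_group[OF M]]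
    hom_rules[OF md_hom[OF M] Mods_group[OF M] Mods_group[OF M]]\<close>)

lemma ModsI:
  assumes "\<And>i. comm_group (gr M i)"
    and "\<And>j i a x. a \<in> homog A j \<Longrightarrow> x \<in> el M i \<Longrightarrow> act M j i a x \<in> el M (j + i)"
    and "\<And>j i a x y. a \<in> homog A j \<Longrightarrow> x \<in> el M i \<Longrightarrow> y \<in> el M i \<Longrightarrow>
      act M j i a (x \<otimes>\<^bsub>gr M i\<^esub> y) = act M j i a x \<otimes>\<^bsub>gr M (j + i)\<^esub> act M j i a y"
    and "\<And>j i a b x. a \<in> homog A j \<Longrightarrow> b \<in> homog A j \<Longrightarrow> x \<in> el M i \<Longrightarrow>
      act M j i (a \<oplus>\<^bsub>A\<^esub> b) x = act M j i a x \<otimes>\<^bsub>gr M (j + i)\<^esub> act M j i b x"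
    and "\<And>j l i a b x. a \<in> homog A j \<Longrightarrow> b \<in> homog A l \<Longrightarrow> x \<in> el M i \<Longrightarrow>
      act M (j + l) i (a \<otimes>\<^bsub>A\<^esub> b) x = act M j (l + i) a (act M l i b x)"
    and "\<And>i x. x \<in> el M i \<Longrightarrow> act M 0 i \<one>\<^bsub>A\<^esub> x = x"
    and "\<And>i x. x \<in> el M i \<Longrightarrow> md M i x \<in> el M (i + 1)"
    and "\<And>i x y. x \<in> el M i \<Longrightarrow> y \<in> el M i \<Longrightarrow>
      md M i (x \<otimes>\<^bsub>gr M i\<^esub> y) = md M i x \<otimes>\<^bsub>gr M (i + 1)\<^esub> md M i y"
    and "\<And>j i a x. a \<in> homog A j \<Longrightarrow> x \<in> el M i \<Longrightarrow>
      md M (j + i) (act M j i a x) = act M (j + 1) i (pred A a) x \<otimes>\<^bsub>gr M (j + i + 1)\<^esub>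
        (if even j then act M j (i + 1) a (md M i x)
         else inv\<^bsub>gr M (j + i + 1)\<^esub> act M j (i + 1) a (md M i x))"
    and "\<And>i x. x \<in> el M i \<Longrightarrow> md M (i + 1) (md M i x) = act M 2 i (curv A) x"
  shows "M \<in> Mods A"
proof -
  have "act M j (i + 1) a (md M i x) [^]\<^bsub>gr M (j + i + 1)\<^esub> ksgn j =
      (if even j then act M j (i + 1) a (md M i x)
         else inv\<^bsub>gr M (j + i + 1)\<^esub> act M j (i + 1) a (md M i x))"
    if "a \<in> homog A j" "x \<in> el M i" for j i a x
    using assms(2)[OF that(1) assms(7)[OF that(2)]] assms(1) 
    by (intro pow_ksgn) (auto simp: add.assoc comm_group.axioms)
  thus ?thesis using assms unfolding Mods_def hom_def by simp
qed

section \<open>Morphisms, shifts and cones\<close>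

lemma mor_rules:
  assumes f: "f \<in> mor A M N" and M: "M \<in> Mods A" and N: "N \<in> Mods A"
  shows "x \<in> el M i \<Longrightarrow> f i x \<in> el N i"
    and "x \<in> el M i \<Longrightarrow> y \<in> el M i \<Longrightarrow> f i (x \<otimes>\<^bsub>gr M i\<^esub> y) = f i x \<otimes>\<^bsub>gr N i\<^esub> f i y"
    and "x \<in> el M i \<Longrightarrow> f i (inv\<^bsub>gr M i\<^esub> x) = inv\<^bsub>gr N i\<^esub> f i x"
    and "f i \<one>\<^bsub>gr M i\<^esub> = \<one>\<^bsub>gr N i\<^esub>"
    and "a \<in> homog A j \<Longrightarrow> x \<in> el M i \<Longrightarrow> l = j + i \<Longrightarrow> f l (act M j i a x) = act N j i a (f i x)"
    and "x \<in> el M i \<Longrightarrow> l = i + 1 \<Longrightarrow> f l (md M i x) = md N i (f i x)"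
proof -
  have h: "f i \<in> hom (gr M i) (gr N i)" for i
    using f by (auto simp: mor_def lin_def dest: spec[of _ i])
  note r = hom_rules[OF h Mods_group[OF M] Mods_group[OF N]]
  show "x \<in> el M i \<Longrightarrow> f i x \<in> el N i"
    and "x \<in> el M i \<Longrightarrow> y \<in> el M i \<Longrightarrow> f i (x \<otimes>\<^bsub>gr M i\<^esub> y) = f i x \<otimes>\<^bsub>gr N i\<^esub> f i y"
    and "x \<in> el M i \<Longrightarrow> f i (inv\<^bsub>gr M i\<^esub> x) = inv\<^bsub>gr N i\<^esub> f i x"
    and "f i \<one>\<^bsub>gr M i\<^esub> = \<one>\<^bsub>gr N i\<^esub>"
    by (simp_all add: r)
  show "a \<in> homog A j \<Longrightarrow> x \<in> el M i \<Longrightarrow> l = j + i \<Longrightarrow> f l (act M j i a x) = act N j i a (f i x)"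
    using f r(1)[of x i] by (simp add: mor_def lin_def pow_ksgn Mods_group[OF N] mod_rules[OF N])
  show "x \<in> el M i \<Longrightarrow> l = i + 1 \<Longrightarrow> f l (md M i x) = md N i (f i x)"
    using f by (simp add: mor_def)
qed

lemma morI:
  assumes "N \<in> Mods A"
    and "\<And>i x. x \<in> el M i \<Longrightarrow> f i x \<in> el N i"
    and "\<And>i x y. x \<in> el M i \<Longrightarrow> y \<in> el M i \<Longrightarrow> f i (x \<otimes>\<^bsub>gr M i\<^esub> y) = f i x \<otimes>\<^bsub>gr N i\<^esub> f i y"
    and "\<And>j i a x. a \<in> homog A j \<Longrightarrow> x \<in> el M i \<Longrightarrow> f (j + i) (act M j i a x) = act N j i a (f i x)"
    and "\<And>i x. x \<in> el M i \<Longrightarrow> f (i + 1) (md M i x) = md N i (f i x)"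
  shows "f \<in> mor A M N"
  using assms unfolding mor_def lin_def hom_def
  by (simp add: pow_ksgn Mods_group mod_rules)

lemma comm_group_DirProd: "comm_group G \<Longrightarrow> comm_group H \<Longrightarrow> comm_group (G \<times>\<times> H)"
  by (rule group.group_comm_groupI)
    (auto simp: DirProd_group comm_group.axioms comm_groupE(4))

lemma shift_gr: "gr (shift M) i = gr M (i + 1)"
  and shift_md: "md (shift M) i x = inv\<^bsub>gr M (i + 2)\<^esub> md M (i + 1) x"
  by (simp_all add: shift_def)

lemma shift_act:
  assumes "M \<in> Mods A" "a \<in> homog A j" "x \<in> el M (i + 1)"
  shows "act (shift M) j i a x =
    (if even j then act M j (i + 1) a x else inv\<^bsub>gr M (j + i + 1)\<^esub> act M j (i + 1) a x)"
  using assms by (simp add: shift_def pow_ksgn Mods_group mod_rules)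

lemma shift_in_Mods:
  assumes M: "M \<in> Mods A" shows "shift M \<in> Mods A"
  using M
  by (intro ModsI)
    (simp_all add: shift_gr shift_md shift_act Mods_comm_group group_rules mod_rules alg_in add.commute add.left_commute add.assoc)

lemma cone_gr: "gr (cone M N f) i = gr N i \<times>\<times> gr (shift M) i"
  and cone_act: "act (cone M N f) j i a p = (act N j i a (fst p), act (shift M) j i a (snd p))"
  and cone_md: "md (cone M N f) i p = (md N i (fst p) \<otimes>\<^bsub>gr N (i + 1)\<^esub> f (i + 1) (snd p), md (shift M) i (snd p))"
  by (simp_all add: cone_def case_prod_beta)

lemma cone_in_Mods:
  assumes M: "M \<in> Mods A" and N: "N \<in> Mods A" and f: "f \<in> mor A M N"
  shows "cone M N f \<in> Mods A"
  using M N
  by (intro ModsI)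
    (auto simp: cone_gr shift_gr shift_md cone_act cone_md shift_act Mods_comm_group Mods_group comm_group_DirProd
      group_rules group_ac mod_rules mor_rules[OF f] alg_in inv_DirProd add.commute add.left_commute add.assoc)

lemmas mod_simps = group_rules group_ac mod_rules alg_in algebra_simps

section \<open>Homotopies\<close>

lemma lin_rules:
  assumes h: "h \<in> lin A (- 1) M N" and M: "M \<in> Mods A" and N: "N \<in> Mods A"
  shows "x \<in> el M i \<Longrightarrow> l = i - 1 \<Longrightarrow> h i x \<in> el N l"
    and "x \<in> el M i \<Longrightarrow> y \<in> el M i \<Longrightarrow> h i (x \<otimes>\<^bsub>gr M i\<^esub> y) = h i x \<otimes>\<^bsub>gr N (i - 1)\<^esub> h i y"
    and "x \<in> el M i \<Longrightarrow> h i (inv\<^bsub>gr M i\<^esub> x) = inv\<^bsub>gr N (i - 1)\<^esub> h i x"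
    and "h i \<one>\<^bsub>gr M i\<^esub> = \<one>\<^bsub>gr N (i - 1)\<^esub>"
    and "a \<in> homog A j \<Longrightarrow> x \<in> el M i \<Longrightarrow> l = j + i \<Longrightarrow> h l (act M j i a x) =
      (if even j then act N j (i - 1) a (h i x) else inv\<^bsub>gr N (j + i - 1)\<^esub> act N j (i - 1) a (h i x))"
proof -
  have hh: "h i \<in> hom (gr M i) (gr N (i - 1))" for i
    using h by (auto simp: lin_def dest: spec[of _ i])
  note r = hom_rules[OF hh Mods_group[OF M] Mods_group[OF N]]
  show "x \<in> el M i \<Longrightarrow> l = i - 1 \<Longrightarrow> h i x \<in> el N l"
    and "x \<in> el M i \<Longrightarrow> y \<in> el M i \<Longrightarrow> h i (x \<otimes>\<^bsub>gr M i\<^esub> y) = h i x \<otimes>\<^bsub>gr N (i - 1)\<^esub> h i y"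
    and "x \<in> el M i \<Longrightarrow> h i (inv\<^bsub>gr M i\<^esub> x) = inv\<^bsub>gr N (i - 1)\<^esub> h i x"
    and "h i \<one>\<^bsub>gr M i\<^esub> = \<one>\<^bsub>gr N (i - 1)\<^esub>"
    by (simp_all add: r)
  show "a \<in> homog A j \<Longrightarrow> x \<in> el M i \<Longrightarrow> l = j + i \<Longrightarrow> h l (act M j i a x) =
      (if even j then act N j (i - 1) a (h i x) else inv\<^bsub>gr N (j + i - 1)\<^esub> act N j (i - 1) a (h i x))"
    using h r(1)[of x i] by (simp add: lin_def pow_ksgn Mods_group[OF N] mod_rules[OF N])
qed

lemma linI:
  assumes "N \<in> Mods A"
    and "\<And>i x. x \<in> el M i \<Longrightarrow> h i x \<in> el N (i - 1)"
    and "\<And>i x y. x \<in> el M i \<Longrightarrow> y \<in> el M i \<Longrightarrow> h i (x \<otimes>\<^bsub>gr M i\<^esub> y) = h i x \<otimes>\<^bsub>gr N (i - 1)\<^esub> h i y"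
    and "\<And>j i a x. a \<in> homog A j \<Longrightarrow> x \<in> el M i \<Longrightarrow> h (j + i) (act M j i a x) =
      (if even j then act N j (i - 1) a (h i x) else inv\<^bsub>gr N (j + i - 1)\<^esub> act N j (i - 1) a (h i x))"
  shows "h \<in> lin A (- 1) M N"
  using assms unfolding lin_def hom_def
  by (simp add: pow_ksgn Mods_group mod_rules)

lemma homotopicI:
  assumes "h \<in> lin A (- 1) M N"
    and "\<And>i x. x \<in> el M i \<Longrightarrow> f i x = g i x \<otimes>\<^bsub>gr N i\<^esub> (md N (i - 1) (h i x) \<otimes>\<^bsub>gr N i\<^esub> h (i + 1) (md M i x))"
  shows "homotopic A M N f g"
  using assms unfolding homotopic_def by blast

lemma homotopic_eqI:
  assumes M: "M \<in> Mods A" and N: "N \<in> Mods A"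
    and "\<And>i x. x \<in> el M i \<Longrightarrow> f i x = g i x" "\<And>i x. x \<in> el M i \<Longrightarrow> g i x \<in> el N i"
  shows "homotopic A M N f g"
proof (rule homotopicI)
  show "(\<lambda>i x. \<one>\<^bsub>gr N (i - 1)\<^esub>) \<in> lin A (- 1) M N"
    by (rule linI) (simp_all add: N mod_simps)
  show "f i x = g i x \<otimes>\<^bsub>gr N i\<^esub> (md N (i - 1) \<one>\<^bsub>gr N (i - 1)\<^esub> \<otimes>\<^bsub>gr N i\<^esub> \<one>\<^bsub>gr N (i + 1 - 1)\<^esub>)"
    if "x \<in> el M i" for i x
    using assms(3,4)[OF that] mod_rules(8)[OF N, of "i - 1"] by (simp add: N group_rules)
qed

lemma homotopic_comp:
  assumes M: "M \<in> Mods A" and N: "N \<in> Mods A" and M': "M' \<in> Mods A" and N': "N' \<in> Mods A"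
    and fg: "homotopic A M N f g" and a: "a \<in> mor A N N'" and b: "b \<in> mor A M' M"
    and f: "\<And>i x. x \<in> el M' i \<Longrightarrow> f' i x = a i (f i (b i x))"
    and g: "\<And>i x. x \<in> el M' i \<Longrightarrow> g' i x = a i (g i (b i x))"
    and gN: "\<And>i x. x \<in> el M i \<Longrightarrow> g i x \<in> el N i"
  shows "homotopic A M' N' f' g'"
proof -
  obtain h where h: "h \<in> lin A (- 1) M N"
    and fh: "\<And>i x. x \<in> el M i \<Longrightarrow> f i x = g i x \<otimes>\<^bsub>gr N i\<^esub> (md N (i - 1) (h i x) \<otimes>\<^bsub>gr N i\<^esub> h (i + 1) (md M i x))"
    using fg unfolding homotopic_def by blast
  note ar = mor_rules[OF a N N'] and br = mor_rules[OF b M' M] and hr = lin_rules[OF h M N]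
  show ?thesis
  proof (rule homotopicI)
    show "(\<lambda>i x. a (i - 1) (h i (b i x))) \<in> lin A (- 1) M' N'"
      by (rule linI) (simp_all add: M N M' N' ar br hr mod_simps)
    show "f' i x = g' i x \<otimes>\<^bsub>gr N' i\<^esub> (md N' (i - 1) (a (i - 1) (h i (b i x))) \<otimes>\<^bsub>gr N' i\<^esub>
      a (i + 1 - 1) (h (i + 1) (b (i + 1) (md M' i x))))" if "x \<in> el M' i" for i x
      using that gN[of "b i x" i] ar(6)[of "h i (b i x)" "i - 1" i, symmetric]
      by (simp add: M N M' N' f g fh ar br hr group_rules mod_rules)
  qed
qed

section \<open>Isomorphisms and transport of structure\<close>

definition iso_mor :: "('a, 'v) cdg_module \<Rightarrow> ('a, 'w) cdg_module \<Rightarrow> (int \<Rightarrow> 'v \<Rightarrow> 'w) \<Rightarrow> bool" where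
  "iso_mor M N f \<longleftrightarrow> f \<in> mor A M N \<and> (\<forall>i. bij_betw (f i) (el M i) (el N i))"

lemma iso_mod_iff: "iso_mod A M N \<longleftrightarrow> (\<exists>f. iso_mor M N f)"
  by (auto simp: iso_mod_def iso_mor_def)

lemma mor_id: "M \<in> Mods A \<Longrightarrow> (\<lambda>i x. x) \<in> mor A M M"
  by (rule morI) auto

lemma mid_mor: "M \<in> Mods A \<Longrightarrow> mid \<in> mor A M M"
  using mor_id by (simp add: mid_def)

lemma mor_comp:
  assumes "f \<in> mor A L M" "g \<in> mor A M N" "L \<in> Mods A" "M \<in> Mods A" "N \<in> Mods A"
  shows "(\<lambda>i x. g i (f i x)) \<in> mor A L N"
  by (rule morI) (simp_all add: assms mor_rules[OF assms(1,3,4)] mor_rules[OF assms(2,4,5)])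

lemma iso_mor_comp:
  assumes "iso_mor L M f" "iso_mor M N g" "L \<in> Mods A" "M \<in> Mods A" "N \<in> Mods A"
  shows "iso_mor L N (\<lambda>i x. g i (f i x))"
  using assms mor_comp bij_betw_trans unfolding iso_mor_def comp_def by blast

lemma iso_mod_trans:
  assumes "iso_mod A L M" "iso_mod A M N" "L \<in> Mods A" "M \<in> Mods A" "N \<in> Mods A"
  shows "iso_mod A L N"
  using assms iso_mor_comp unfolding iso_mod_iff by blast

lemma iso_mod_refl: "M \<in> Mods A \<Longrightarrow> iso_mod A M M"
  using mor_id[of M] bij_betw_id by (auto simp: iso_mod_def id_def)

definition inverse_mor :: "('a, 'v) cdg_module \<Rightarrow> (int \<Rightarrow> 'v \<Rightarrow> 'w) \<Rightarrow> int \<Rightarrow> 'w \<Rightarrow> 'v" where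
  "inverse_mor M f = (\<lambda>i. inv_into (el M i) (f i))"

lemma inverse_mor:
  assumes f: "iso_mor M N f" and M: "M \<in> Mods A" and N: "N \<in> Mods A"
  shows "iso_mor N M (inverse_mor M f)"
    and "x \<in> el M i \<Longrightarrow> inverse_mor M f i (f i x) = x"
    and "y \<in> el N i \<Longrightarrow> f i (inverse_mor M f i y) = y"
proof -
  have b: "bij_betw (f i) (el M i) (el N i)" for i using f by (simp add: iso_mor_def)
  have fm: "f \<in> mor A M N" using f by (simp add: iso_mor_def)
  note fr = mor_rules[OF fm M N]
  let ?g = "inverse_mor M f"
  show gf: "?g i (f i x) = x" if "x \<in> el M i" for x i
    using bij_betw_inv_into_left[OF b that] by (simp add: inverse_mor_def)
  show fg: "f i (?g i y) = y" if "y \<in> el N i" for y i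
    using bij_betw_inv_into_right[OF b that] by (simp add: inverse_mor_def)
  have gc: "bij_betw (?g i) (el N i) (el M i)" for i
    using b by (simp add: inverse_mor_def bij_betw_inv_into)
  have gM: "?g i y \<in> el M i" if "y \<in> el N i" for y i
    using gc that by (auto simp: bij_betw_def)
  have "?g \<in> mor A N M"
  proof (rule morI[OF M])
    fix i x y assume x: "x \<in> el N i" and y: "y \<in> el N i"
    show "?g i (x \<otimes>\<^bsub>gr N i\<^esub> y) = ?g i x \<otimes>\<^bsub>gr M i\<^esub> ?g i y"
      using gf[of "?g i x \<otimes>\<^bsub>gr M i\<^esub> ?g i y" i] x y by (simp add: fr gM fg M group_rules)
  next
    fix j i a x assume a: "a \<in> homog A j" and x: "x \<in> el N i"
    show "?g (j + i) (act N j i a x) = act M j i a (?g i x)"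
      using gf[of "act M j i a (?g i x)" "j + i"] a x by (simp add: fr gM fg M mod_rules)
  next
    fix i x assume x: "x \<in> el N i"
    show "?g (i + 1) (md N i x) = md M i (?g i x)"
      using gf[of "md M i (?g i x)" "i + 1"] x by (simp add: fr gM fg M mod_rules)
  qed (rule gM)
  thus "iso_mor N M ?g" using gc by (simp add: iso_mor_def)
qed

lemma iso_mod_sym: "iso_mod A M N \<Longrightarrow> M \<in> Mods A \<Longrightarrow> N \<in> Mods A \<Longrightarrow> iso_mod A N M"
  using inverse_mor(1) unfolding iso_mod_iff by blast

lemma iso_shift:
  assumes f: "iso_mor M N f" and M: "M \<in> Mods A" and N: "N \<in> Mods A"
  shows "iso_mor (shift M) (shift N) (\<lambda>i. f (i + 1))"
proof -
  have fm: "f \<in> mor A M N" using f by (simp add: iso_mor_def)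
  have "(\<lambda>i. f (i + 1)) \<in> mor A (shift M) (shift N)"
    by (rule morI) (simp_all add: M N shift_in_Mods shift_gr shift_md shift_act mor_rules[OF fm M N] mod_simps)
  thus ?thesis using f by (simp add: iso_mor_def shift_gr)
qed

lemma iso_cone:
  assumes \<alpha>: "iso_mor M M' \<alpha>" and \<beta>: "iso_mor N N' \<beta>"
    and M: "M \<in> Mods A" and N: "N \<in> Mods A" and M': "M' \<in> Mods A" and N': "N' \<in> Mods A"
    and f: "f \<in> mor A M N" and g: "g \<in> mor A M' N'"
    and comm: "\<And>i x. x \<in> el M i \<Longrightarrow> g i (\<alpha> i x) = \<beta> i (f i x)"
  shows "iso_mor (cone M N f) (cone M' N' g) (\<lambda>i p. (\<beta> i (fst p), \<alpha> (i + 1) (snd p)))"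
proof -
  have am: "\<alpha> \<in> mor A M M'" and bm: "\<beta> \<in> mor A N N'" using \<alpha> \<beta> by (simp_all add: iso_mor_def)
  have "bij_betw (map_prod (\<beta> i) (\<alpha> (i + 1))) (el N i \<times> el M (i + 1)) (el N' i \<times> el M' (i + 1))" for i
    using \<alpha> \<beta> unfolding iso_mor_def by (intro bij_betw_map_prod) auto
  moreover have "(\<lambda>i p. (\<beta> i (fst p), \<alpha> (i + 1) (snd p))) \<in> mor A (cone M N f) (cone M' N' g)"
    by (rule morI) (auto simp: assms cone_in_Mods cone_gr cone_act cone_md shift_gr shift_md shift_act
      mor_rules[OF am M M'] mor_rules[OF bm N N'] mor_rules[OF f M N] mod_simps)
  ultimately show ?thesis by (simp add: iso_mor_def cone_gr shift_gr map_prod_def case_prod_unfold)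
qed

text \<open>
  A module carried along injections \<open>e i\<close> of its components into another type. This brings modules
  built over larger element types back to the universe.
\<close>

definition transport :: "('a, 'v) cdg_module \<Rightarrow> (int \<Rightarrow> 'v \<Rightarrow> 'w) \<Rightarrow> ('a, 'w) cdg_module" where
  "transport M e = (let r = inverse_mor M e in
    \<lparr>gr = (\<lambda>i. \<lparr>carrier = e i ` el M i, mult = (\<lambda>x y. e i (r i x \<otimes>\<^bsub>gr M i\<^esub> r i y)), one = e i \<one>\<^bsub>gr M i\<^esub>\<rparr>),
     act = (\<lambda>j i a x. e (j + i) (act M j i a (r i x))),
     md = (\<lambda>i x. e (i + 1) (md M i (r i x)))\<rparr>)"

lemma transport:
  assumes M: "M \<in> Mods A" and e: "\<And>i. inj_on (e i) (el M i)"
  shows transport_in_Mods: "transport M e \<in> Mods A"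
    and transport_iso: "iso_mor M (transport M e) e"
proof -
  have r: "inverse_mor M e i (e i x) = x" if "x \<in> el M i" for i x
    using e that by (simp add: inverse_mor_def)
  have el: "el (transport M e) i = e i ` el M i" for i
    by (simp add: transport_def Let_def)
  have one: "\<one>\<^bsub>gr (transport M e) i\<^esub> = e i \<one>\<^bsub>gr M i\<^esub>" for i
    by (simp add: transport_def Let_def)
  have mult: "e i x \<otimes>\<^bsub>gr (transport M e) i\<^esub> e i y = e i (x \<otimes>\<^bsub>gr M i\<^esub> y)" if "x \<in> el M i" "y \<in> el M i" for i x y
    using that by (simp add: transport_def Let_def r)
  have act: "act (transport M e) j i a (e i x) = e (j + i) (act M j i a x)" if "x \<in> el M i" for j i a x
    using that by (simp add: transport_def Let_def r)
  have md: "md (transport M e) i (e i x) = e (i + 1) (md M i x)" if "x \<in> el M i" for i x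
    using that by (simp add: transport_def Let_def r)
  have gr: "comm_group (gr (transport M e) i)" for i
  proof (rule comm_groupI)
    fix x assume "x \<in> el (transport M e) i"
    then obtain u where u: "x = e i u" "u \<in> el M i" by (auto simp: el)
    show "\<exists>y\<in>el (transport M e) i. y \<otimes>\<^bsub>gr (transport M e) i\<^esub> x = \<one>\<^bsub>gr (transport M e) i\<^esub>"
      using u by (intro bexI[of _ "e i (inv\<^bsub>gr M i\<^esub> u)"]) (simp_all add: M el one mult group_rules)
  qed (auto simp: M el one mult group_rules group_ac)
  have inv: "inv\<^bsub>gr (transport M e) i\<^esub> (e i x) = e i (inv\<^bsub>gr M i\<^esub> x)" if "x \<in> el M i" for i x
    by (rule group.inv_equality[OF comm_group.axioms(2)[OF gr]])
      (auto simp: that M el mult one group_rules)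
  show T: "transport M e \<in> Mods A"
    by (rule ModsI) (auto simp: M gr el mult act md inv mod_simps)
  show "iso_mor M (transport M e) e"
    unfolding iso_mor_def
    using e by (auto intro!: morI T simp: M el mult act md mod_simps bij_betw_def)
qed

section \<open>The zero module, submodules and exact sequences\<close>

lemma zero_module_gr: "gr zero_module i = singleton_group undefined"
  by (simp add: zero_module_def)

lemma zero_module_in_Mods: "zero_module \<in> Mods A"
proof (rule ModsI)
  show "comm_group (gr zero_module i)" for i
    by (rule comm_groupI) (auto simp: zero_module_def singleton_group_def)
qed (auto simp: zero_module_def singleton_group_def)

lemma mzero_mor: "M \<in> Mods A \<Longrightarrow> N \<in> Mods A \<Longrightarrow> mzero N \<in> mor A M N"
  by (rule morI) (simp_all add: mzero_def mod_simps)

definition restrict_module :: "('a, 'v) cdg_module \<Rightarrow> (int \<Rightarrow> 'v set) \<Rightarrow> ('a, 'v) cdg_module" where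
  "restrict_module M S = M\<lparr>gr := (\<lambda>i. (gr M i)\<lparr>carrier := S i\<rparr>)\<rparr>"

lemma restrict_simps:
  "el (restrict_module M S) i = S i" "act (restrict_module M S) = act M" "md (restrict_module M S) = md M"
  "x \<otimes>\<^bsub>gr (restrict_module M S) i\<^esub> y = x \<otimes>\<^bsub>gr M i\<^esub> y" "\<one>\<^bsub>gr (restrict_module M S) i\<^esub> = \<one>\<^bsub>gr M i\<^esub>"
  by (simp_all add: restrict_module_def)

lemma restrict_module_in_Mods:
  assumes M: "M \<in> Mods A" and S: "\<And>i. subgroup (S i) (gr M i)"
    and act: "\<And>j i a x. a \<in> homog A j \<Longrightarrow> x \<in> S i \<Longrightarrow> act M j i a x \<in> S (j + i)"
    and md: "\<And>i x. x \<in> S i \<Longrightarrow> md M i x \<in> S (i + 1)"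
  shows "restrict_module M S \<in> Mods A"
proof -
  have el: "x \<in> el M i" if "x \<in> S i" for x i using S[of i] that by (auto dest: subgroup.subset)
  have inv: "inv\<^bsub>gr (restrict_module M S) i\<^esub> x = inv\<^bsub>gr M i\<^esub> x" if "x \<in> S i" for x i
    using group.m_inv_consistent[OF Mods_group[OF M] S that] by (simp add: restrict_module_def)
  have gr: "comm_group (gr (restrict_module M S) i)" for i
  proof (rule group.group_comm_groupI)
    show "group (gr (restrict_module M S) i)"
      using subgroup.subgroup_is_group[OF S Mods_group[OF M]] by (simp add: restrict_module_def)
  qed (simp add: restrict_simps el group_ac[OF M])
  have ai: "act M j (i + 1) a (md M i x) \<in> S (j + i + 1)" if "a \<in> homog A j" "x \<in> S i" for j i a x
    using act[OF that(1) md[OF that(2)]] by (simp add: add.assoc)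
  show ?thesis
    by (rule ModsI) (simp_all add: gr restrict_simps act md inv[OF ai] mod_rules[OF M] el)
qed

text \<open>
  Exactness in each degree, like \<^const>\<open>short_exact\<close>, but for three modules that need not have the
  same element type.
\<close>

definition exact_modules :: "('a, 'v) cdg_module \<Rightarrow> (int \<Rightarrow> 'v \<Rightarrow> 'w) \<Rightarrow> ('a, 'w) cdg_module \<Rightarrow>
    (int \<Rightarrow> 'w \<Rightarrow> 'x) \<Rightarrow> ('a, 'x) cdg_module \<Rightarrow> bool" where
  "exact_modules M' f M g M'' \<longleftrightarrow> f \<in> mor A M' M \<and> g \<in> mor A M M'' \<and>
     (\<forall>i. inj_on (f i) (el M' i) \<and> g i ` el M i = el M'' i \<and>
          f i ` el M' i = {x \<in> el M i. g i x = \<one>\<^bsub>gr M'' i\<^esub>})"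

lemma exact_modules_imp_short_exact:
  assumes ex: "exact_modules M' f M g M''" and M': "M' \<in> Mods A" and M: "M \<in> Mods A" and M'': "M'' \<in> Mods A"
  shows "short_exact A M' f M g M''"
proof -
  have f: "f \<in> mor A M' M" and g: "g \<in> mor A M M''"
    using ex by (auto simp: exact_modules_def)
  have fh: "f i \<in> hom (gr M' i) (gr M i)" and gh: "g i \<in> hom (gr M i) (gr M'' i)" for i
    using f g by (auto simp: hom_def M M' M'' mor_rules[OF f M' M] mor_rules[OF g M M''])
  have "short_exact_sequence (gr M'' i) (gr M i) (gr M' i) (g i) (f i)" for i
    unfolding short_exact_sequence_iff
    using ex fh[of i] gh[of i]
    by (auto simp: exact_modules_def epi_def mon_def kernel_def group_hom_def group_hom_axioms_def
        Mods_group[OF M] Mods_group[OF M'] Mods_group[OF M''])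
  thus ?thesis using f g by (simp add: short_exact_def)
qed

lemma totalization_mor:
  assumes ex: "exact_modules M' f M g M''" and M': "M' \<in> Mods A" and M: "M \<in> Mods A" and M'': "M'' \<in> Mods A"
  shows "(\<lambda>i p. g i (fst p)) \<in> mor A (cone M' M f) M''"
proof -
  have f: "f \<in> mor A M' M" and g: "g \<in> mor A M M''"
    using ex by (auto simp: exact_modules_def)
  have z: "g i (f i x) = \<one>\<^bsub>gr M'' i\<^esub>" if "x \<in> el M' i" for i x
  proof -
    have "f i x \<in> f i ` el M' i" using that by (rule imageI)
    thus ?thesis using ex unfolding exact_modules_def by blast
  qed
  show ?thesis
    by (rule morI) (auto simp: M M' M'' mor_rules[OF f M' M] mor_rules[OF g M M''] z
        cone_gr cone_act cone_md shift_gr mod_simps)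
qed

lemma totalization_eq: "totalization M' f M g M'' = cone (cone M' M f) M'' (\<lambda>i p. g i (fst p))"
  by (simp add: totalization_def case_prod_unfold)

section \<open>Modules of jets\<close>

text \<open>
  \<open>D j i a\<close>, for \<open>a\<close> of degree \<open>j\<close>, plays the role of the derivative \<open>da/dc\<close>, an operator of degree
  \<open>j - 2\<close>; it is indexed by the degree \<open>i\<close> for which it maps degree \<open>i + 2\<close> to degree \<open>j + i\<close>. The
  conditions are additivity, the Leibniz rule, compatibility with the predifferentials, and
  \<open>dc/dc = 1\<close>.
\<close>

definition curvature_derivation :: "('a, 'v) cdg_module \<Rightarrow> (int \<Rightarrow> int \<Rightarrow> 'a \<Rightarrow> 'v \<Rightarrow> 'v) \<Rightarrow> bool" where
  "curvature_derivation M D \<longleftrightarrow>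
     (\<forall>j i. \<forall>a\<in>homog A j. D j i a \<in> hom (gr M (i + 2)) (gr M (j + i))) \<and>
     (\<forall>j i. \<forall>a\<in>homog A j. \<forall>b\<in>homog A j. \<forall>z\<in>el M (i + 2).
        D j i (a \<oplus>\<^bsub>A\<^esub> b) z = D j i a z \<otimes>\<^bsub>gr M (j + i)\<^esub> D j i b z) \<and>
     (\<forall>j l i. \<forall>a\<in>homog A j. \<forall>b\<in>homog A l. \<forall>z\<in>el M (i + 2).
        D (j + l) i (a \<otimes>\<^bsub>A\<^esub> b) z =
          D j (l + i) a (act M l (i + 2) b z) \<otimes>\<^bsub>gr M (j + l + i)\<^esub> act M j (l + i) a (D l i b z)) \<and>
     (\<forall>i. \<forall>z\<in>el M (i + 2). D 0 i \<one>\<^bsub>A\<^esub> z = \<one>\<^bsub>gr M i\<^esub>) \<and>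
     (\<forall>j i. \<forall>a\<in>homog A j. \<forall>z\<in>el M (i + 2).
        md M (j + i) (D j i a z) = D (j + 1) i (pred A a) z \<otimes>\<^bsub>gr M (j + i + 1)\<^esub>
          (if even j then D j (i + 1) a (md M (i + 2) z)
           else inv\<^bsub>gr M (j + i + 1)\<^esub> D j (i + 1) a (md M (i + 2) z))) \<and>
     (\<forall>i. \<forall>z\<in>el M (i + 2). D 2 i (curv A) z = z)"

text \<open>
  \<open>M \<oplus> M[1] \<oplus> M[2]\<close> with predifferential \<open>d (x, y, z) = (d x + y, - d y + z, d z)\<close>. Its square is
  \<open>(c x + z, c y, c z)\<close>, so the curvature does not act diagonally. This forces the corner entry
  \<open>D a z\<close> in the action of \<open>a\<close>, as for the first-order jets of a function of \<open>c\<close>. The last two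
  summands are written as the cone of the identity of \<open>M[1]\<close>, which is the quotient by \<open>M\<close>.
\<close>

definition jets :: "('a, 'v) cdg_module \<Rightarrow> (int \<Rightarrow> int \<Rightarrow> 'a \<Rightarrow> 'v \<Rightarrow> 'v) \<Rightarrow> ('a, 'v \<times> 'v \<times> 'v) cdg_module" where
  "jets M D = (let B = cone (shift M) (shift M) mid in
     \<lparr>gr = (\<lambda>i. gr M i \<times>\<times> gr B i),
      act = (\<lambda>j i a v. (act M j i a (fst v) \<otimes>\<^bsub>gr M (j + i)\<^esub> D j i a (snd (snd v)), act B j i a (snd v))),
      md = (\<lambda>i v. (md M i (fst v) \<otimes>\<^bsub>gr M (i + 1)\<^esub> fst (snd v), md B i (snd v)))\<rparr>)"

lemma jets_gr: "gr (jets M D) i = gr M i \<times>\<times> gr (cone (shift M) (shift M) mid) i"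
  and jets_act: "act (jets M D) j i a v = (act M j i a (fst v) \<otimes>\<^bsub>gr M (j + i)\<^esub> D j i a (snd (snd v)),
      act (cone (shift M) (shift M) mid) j i a (snd v))"
  and jets_md: "md (jets M D) i v = (md M i (fst v) \<otimes>\<^bsub>gr M (i + 1)\<^esub> fst (snd v),
      md (cone (shift M) (shift M) mid) i (snd v))"
  by (simp_all add: jets_def Let_def)

lemma derivation_rules:
  assumes D: "curvature_derivation M D" and M: "M \<in> Mods A"
  shows "a \<in> homog A j \<Longrightarrow> z \<in> el M (i + 2) \<Longrightarrow> m = j + i \<Longrightarrow> D j i a z \<in> el M m"
    and "a \<in> homog A j \<Longrightarrow> z \<in> el M l \<Longrightarrow> z' \<in> el M l \<Longrightarrow> l = i + 2 \<Longrightarrow>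
      D j i a (z \<otimes>\<^bsub>gr M l\<^esub> z') = D j i a z \<otimes>\<^bsub>gr M (j + i)\<^esub> D j i a z'"
    and "a \<in> homog A j \<Longrightarrow> l = i + 2 \<Longrightarrow> D j i a \<one>\<^bsub>gr M l\<^esub> = \<one>\<^bsub>gr M (j + i)\<^esub>"
    and "a \<in> homog A j \<Longrightarrow> z \<in> el M l \<Longrightarrow> l = i + 2 \<Longrightarrow>
      D j i a (inv\<^bsub>gr M l\<^esub> z) = inv\<^bsub>gr M (j + i)\<^esub> D j i a z"
    and "a \<in> homog A j \<Longrightarrow> b \<in> homog A j \<Longrightarrow> z \<in> el M (i + 2) \<Longrightarrow>
      D j i (a \<oplus>\<^bsub>A\<^esub> b) z = D j i a z \<otimes>\<^bsub>gr M (j + i)\<^esub> D j i b z"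
    and "a \<in> homog A j \<Longrightarrow> b \<in> homog A l \<Longrightarrow> z \<in> el M (i + 2) \<Longrightarrow> m = j + l \<Longrightarrow>
      D m i (a \<otimes>\<^bsub>A\<^esub> b) z =
          D j (l + i) a (act M l (i + 2) b z) \<otimes>\<^bsub>gr M (j + l + i)\<^esub> act M j (l + i) a (D l i b z)"
    and "z \<in> el M (i + 2) \<Longrightarrow> D 0 i \<one>\<^bsub>A\<^esub> z = \<one>\<^bsub>gr M i\<^esub>"
    and "a \<in> homog A j \<Longrightarrow> z \<in> el M (i + 2) \<Longrightarrow> m = j + i \<Longrightarrow>
        md M m (D j i a z) = D (j + 1) i (pred A a) z \<otimes>\<^bsub>gr M (j + i + 1)\<^esub>
          (if even j then D j (i + 1) a (md M (i + 2) z)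
           else inv\<^bsub>gr M (j + i + 1)\<^esub> D j (i + 1) a (md M (i + 2) z))"
    and "z \<in> el M (i + 2) \<Longrightarrow> D 2 i (curv A) z = z"
proof -
  have h: "a \<in> homog A j \<Longrightarrow> D j i a \<in> hom (gr M (i + 2)) (gr M (j + i))" for a j i
    using D by (simp add: curvature_derivation_def)
  note r = hom_rules[OF h Mods_group[OF M] Mods_group[OF M]]
  show "a \<in> homog A j \<Longrightarrow> z \<in> el M (i + 2) \<Longrightarrow> m = j + i \<Longrightarrow> D j i a z \<in> el M m"
    and "a \<in> homog A j \<Longrightarrow> z \<in> el M l \<Longrightarrow> z' \<in> el M l \<Longrightarrow> l = i + 2 \<Longrightarrow>
      D j i a (z \<otimes>\<^bsub>gr M l\<^esub> z') = D j i a z \<otimes>\<^bsub>gr M (j + i)\<^esub> D j i a z'"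
    and "a \<in> homog A j \<Longrightarrow> l = i + 2 \<Longrightarrow> D j i a \<one>\<^bsub>gr M l\<^esub> = \<one>\<^bsub>gr M (j + i)\<^esub>"
    and "a \<in> homog A j \<Longrightarrow> z \<in> el M l \<Longrightarrow> l = i + 2 \<Longrightarrow>
      D j i a (inv\<^bsub>gr M l\<^esub> z) = inv\<^bsub>gr M (j + i)\<^esub> D j i a z"
    by (simp_all add: r)
qed (use D in \<open>simp_all add: curvature_derivation_def\<close>)

lemma jets_in_Mods:
  assumes M: "M \<in> Mods A" and D: "curvature_derivation M D"
  shows "jets M D \<in> Mods A"
proof -
  let ?B = "cone (shift M) (shift M) mid"
  note S = shift_in_Mods[OF M]
  note SS = shift_in_Mods[OF S]
  note B = cone_in_Mods[OF S S mid_mor[OF S]]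
  show ?thesis
    by (rule ModsI) (auto simp: M S SS jets_gr jets_act jets_md comm_group_DirProd Mods_comm_group
        cone_gr cone_act cone_md shift_gr shift_md shift_act Mods_group DirProd_group mod_simps derivation_rules[OF D M] mid_def)
qed

end

section \<open>Acyclic modules over any element type\<close>

text \<open>
  Cones and totalizations change the element type, whereas the subcategory \<open>\<A>\<close> consists of modules
  over \<open>'u\<close>. So acyclicity is extended to modules over every element type, up to isomorphism. The
  closure properties of \<open>\<A>\<close> then hold for \<open>acyc\<close>, once all modules involved are small enough to
  be realised over \<open>'u\<close>; since \<open>'u\<close> is infinite, cones of small modules are small.
\<close>

locale thick_subcategory = curved_algebra A for A :: "('k, 'a) cdg_algebra" +
  fixes \<A> :: "('a, 'u) cdg_module set"
  assumes thick: "thick A \<A>" and infinite: "infinite (UNIV :: 'u set)"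
begin

definition small :: "('a, 'v) cdg_module \<Rightarrow> bool" where
  "small M \<longleftrightarrow> (\<forall>i. el M i \<lesssim> (UNIV :: 'u set))"

definition acyc :: "('a, 'v) cdg_module \<Rightarrow> bool" where
  "acyc M \<longleftrightarrow> M \<in> Mods A \<and> (\<exists>N\<in>\<A>. iso_mod A N M)"

lemma subset_Mods: "N \<in> \<A> \<Longrightarrow> N \<in> Mods A"
  using thick unfolding thick_def by blast

lemma zero_closed: "Z \<in> Mods A \<Longrightarrow> (\<And>i. el Z i = {\<one>\<^bsub>gr Z i\<^esub>}) \<Longrightarrow> Z \<in> \<A>"
  using thick unfolding thick_def by blast

lemma cone_closed: "M \<in> \<A> \<Longrightarrow> N \<in> \<A> \<Longrightarrow> f \<in> mor A M N \<Longrightarrow> C \<in> Mods A \<Longrightarrow> iso_mod A C (cone M N f) \<Longrightarrow> C \<in> \<A>"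
  using thick unfolding thick_def by blast

lemma zero_in: "zero_module \<in> \<A>"
  by (rule zero_closed) (auto simp: zero_module_in_Mods zero_module_gr singleton_group_def)

lemma iso_cone_zero:
  assumes M: "M \<in> Mods A" and Z: "Z \<in> Mods A" and z: "\<And>i. el Z i = {\<one>\<^bsub>gr Z i\<^esub>}" and f: "f \<in> mor A Z M"
  shows "iso_mor M (cone Z M f) (\<lambda>i x. (x, \<one>\<^bsub>gr Z (i + 1)\<^esub>))"
proof -
  have "(\<lambda>i x. (x, \<one>\<^bsub>gr Z (i + 1)\<^esub>)) \<in> mor A M (cone Z M f)"
    by (rule morI) (auto simp: M Z f cone_in_Mods cone_gr cone_act cone_md shift_gr shift_act shift_md
        mor_rules[OF f Z M] mod_simps)
  moreover have "bij_betw (\<lambda>x. (x, \<one>\<^bsub>gr Z (i + 1)\<^esub>)) (el M i) (el M i \<times> el Z (i + 1))" for i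
    by (rule bij_betwI[where g = fst]) (use z[of "i + 1"] in auto)
  ultimately show ?thesis by (simp add: iso_mor_def cone_gr shift_gr)
qed

text \<open>
  An isomorphic copy of \<open>N\<close> is a copy of the cone of \<open>0 \<rightarrow> N\<close>.
\<close>

lemma iso_closed:
  assumes N: "N \<in> \<A>" and N': "N' \<in> Mods A" and "iso_mod A N' N"
  shows "N' \<in> \<A>"
proof (rule cone_closed[OF zero_in N])
  show z: "mzero N \<in> mor A zero_module N"
    by (rule mzero_mor) (simp_all add: zero_module_in_Mods subset_Mods N)
  show "iso_mod A N' (cone zero_module N (mzero N))"
  proof (rule iso_mod_trans[OF assms(3)])
    show "iso_mod A N (cone zero_module N (mzero N))"
      unfolding iso_mod_iff using iso_cone_zero[OF subset_Mods[OF N] zero_module_in_Mods _ z]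
      by (auto simp: zero_module_gr singleton_group_def)
  qed (simp_all add: N' subset_Mods N cone_in_Mods z zero_module_in_Mods)
qed (rule N')

lemma realization:
  assumes "M \<in> Mods A" "small M"
  obtains N :: "('a, 'u) cdg_module" and \<phi> where "N \<in> Mods A" "iso_mor N M \<phi>"
proof -
  have "\<exists>e. \<forall>i. inj_on (e i :: 'b \<Rightarrow> 'u) (el M i)"
    using assms(2) by (intro choice) (auto simp: small_def lepoll_def)
  then obtain e where e: "\<And>i. inj_on (e i :: 'b \<Rightarrow> 'u) (el M i)" by blast
  show thesis
    using that[OF transport_in_Mods[OF assms(1) e] inverse_mor(1)[OF transport_iso[OF assms(1) e] assms(1) transport_in_Mods[OF assms(1) e]]] .
qed

lemma small_iso: "iso_mod A N M \<Longrightarrow> small N \<Longrightarrow> small M"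
  unfolding iso_mod_def small_def by (metis bij_betw_def image_lepoll lepoll_trans)

lemma small_universe: "small (M :: ('a, 'u) cdg_module)"
  by (simp add: small_def subset_imp_lepoll)

lemma small_shift: "small M \<Longrightarrow> small (shift M)"
  by (simp add: small_def shift_gr)

lemma lepoll_Times_universe:
  assumes "S \<lesssim> (UNIV :: 'u set)" "T \<lesssim> (UNIV :: 'u set)"
  shows "S \<times> T \<lesssim> (UNIV :: 'u set)"
proof -
  have "S \<times> T \<lesssim> (UNIV :: 'u set) \<times> (UNIV :: 'u set)"
    using assms by (rule times_lepoll_mono)
  also have "\<dots> \<approx> (UNIV :: 'u set)"
    using card_of_Times_same_infinite[OF infinite] by (simp add: eqpoll_iff_card_of_ordIso)
  finally show ?thesis .
qed

lemma small_cone: "small M \<Longrightarrow> small N \<Longrightarrow> small (cone M N f)"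
  by (simp add: small_def cone_gr shift_gr lepoll_Times_universe)

lemma acyc_in_Mods: "acyc M \<Longrightarrow> M \<in> Mods A"
  by (simp add: acyc_def)

lemma acyc_small: "acyc M \<Longrightarrow> small M"
  by (auto simp: acyc_def intro: small_iso[OF _ small_universe])

lemma acyc_rep:
  assumes "acyc M" "N \<in> Mods A" "iso_mod A N M"
  shows "N \<in> \<A>"
proof -
  obtain N' where N': "N' \<in> \<A>" "iso_mod A N' M" and M: "M \<in> Mods A" using assms(1) by (auto simp: acyc_def)
  have "iso_mod A N N'"
    using iso_mod_trans[OF assms(3) iso_mod_sym[OF N'(2)]] M N'(1) assms(2) subset_Mods by simp
  thus ?thesis by (rule iso_closed[OF N'(1) assms(2)])
qed

lemma acyc_iff: "acyc (M :: ('a, 'u) cdg_module) \<longleftrightarrow> M \<in> \<A>"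
proof
  assume a: "acyc M"
  show "M \<in> \<A>" by (rule acyc_rep[OF a acyc_in_Mods[OF a] iso_mod_refl[OF acyc_in_Mods[OF a]]])
next
  assume "M \<in> \<A>"
  thus "acyc M" using iso_mod_refl subset_Mods unfolding acyc_def by auto
qed

lemma acyc_iff_rep:
  "M \<in> Mods A \<Longrightarrow> N \<in> Mods A \<Longrightarrow> iso_mod A N M \<Longrightarrow> acyc M \<longleftrightarrow> N \<in> \<A>"
  using acyc_rep[of M N] by (auto simp: acyc_def)

lemma acyc_shift:
  assumes M: "M \<in> Mods A" and s: "small M"
  shows "acyc (shift M) \<longleftrightarrow> acyc M"
proof -
  obtain N :: "('a, 'u) cdg_module" and \<phi> where N: "N \<in> Mods A" "iso_mor N M \<phi>"
    using realization[OF M s] by blast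
  have 1: "iso_mod A N M" "iso_mod A (shift N) (shift M)"
    using N iso_shift[OF N(2,1) M] by (auto simp: iso_mod_iff)
  have "acyc (shift M) \<longleftrightarrow> shift N \<in> \<A>" "acyc M \<longleftrightarrow> N \<in> \<A>"
    using acyc_iff_rep[OF M N(1) 1(1)] acyc_iff_rep[OF shift_in_Mods[OF M] shift_in_Mods[OF N(1)] 1(2)] by simp_all
  moreover have "shift N \<in> \<A> \<longleftrightarrow> N \<in> \<A>" using thick N(1) unfolding thick_def by blast
  ultimately show ?thesis by simp
qed

lemma conj_mor:
  assumes f': "f' = (\<lambda>i x. inverse_mor N' \<beta> i (f i (\<alpha> i x)))"
    and "f \<in> mor A M N" "iso_mor M' M \<alpha>" "iso_mor N' N \<beta>" "M \<in> Mods A" "N \<in> Mods A" "M' \<in> Mods A" "N' \<in> Mods A"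
  shows "f' \<in> mor A M' N'"
    and "x \<in> el M' i \<Longrightarrow> \<beta> i (f' i x) = f i (\<alpha> i x)"
proof -
  have a: "\<alpha> \<in> mor A M' M" and b: "inverse_mor N' \<beta> \<in> mor A N N'"
    using inverse_mor(1)[OF assms(4,8,6)] assms(3) by (simp_all add: iso_mor_def)
  show "f' \<in> mor A M' N'"
    using mor_comp[OF mor_comp[OF a assms(2)] b] assms by simp
  show "x \<in> el M' i \<Longrightarrow> \<beta> i (f' i x) = f i (\<alpha> i x)"
    using inverse_mor(3)[OF assms(4,8,6)] mor_rules[OF assms(2,5,6)] mor_rules[OF a assms(7,5)] by (simp add: f')
qed

lemma acyc_cone:
  assumes aM: "acyc M" and aN: "acyc N" and f: "f \<in> mor A M N"
  shows "acyc (cone M N f)"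
proof -
  note MN = acyc_in_Mods[OF aM] acyc_in_Mods[OF aN]
  obtain M' \<alpha> where M': "M' \<in> \<A>" "iso_mor M' M \<alpha>" using aM by (auto simp: acyc_def iso_mod_iff)
  obtain N' \<beta> where N': "N' \<in> \<A>" "iso_mor N' N \<beta>" using aN by (auto simp: acyc_def iso_mod_iff)
  note MN' = subset_Mods[OF M'(1)] subset_Mods[OF N'(1)]
  define f' where "f' = (\<lambda>i x. inverse_mor N' \<beta> i (f i (\<alpha> i x)))"
  note f' = conj_mor[OF f'_def f M'(2) N'(2) MN MN']
  have C: "cone M N f \<in> Mods A" "cone M' N' f' \<in> Mods A" using MN MN' f f'(1) by (simp_all add: cone_in_Mods)
  have i: "iso_mod A (cone M' N' f') (cone M N f)"
    unfolding iso_mod_iff using iso_cone[OF M'(2) N'(2) MN' MN f'(1) f] f'(2) by auto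
  obtain D :: "('a, 'u) cdg_module" and \<phi> where D: "D \<in> Mods A" "iso_mor D (cone M' N' f') \<phi>"
    using realization[OF C(2)] small_cone small_universe by blast
  have "D \<in> \<A>" using cone_closed[OF M'(1) N'(1) f'(1) D(1)] D(2) iso_mod_iff by blast
  thus ?thesis unfolding acyc_def using iso_mod_trans[OF _ i D(1)] C D(2) iso_mod_iff by blast
qed

text \<open>
  \<^const>\<open>homotopy_biproduct\<close> for three modules that need not have the same element type.
\<close>

definition biproduct :: "('a, 'x) cdg_module \<Rightarrow> ('a, 'v) cdg_module \<Rightarrow> ('a, 'w) cdg_module \<Rightarrow> bool" where
  "biproduct M X Y \<longleftrightarrow>
     (\<exists>i\<in>mor A X M. \<exists>p\<in>mor A M X. \<exists>j\<in>mor A Y M. \<exists>q\<in>mor A M Y.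
        homotopic A X X (p \<bullet> i) mid \<and> homotopic A Y Y (q \<bullet> j) mid \<and>
        homotopic A X Y (q \<bullet> i) (mzero Y) \<and> homotopic A Y X (p \<bullet> j) (mzero X) \<and>
        homotopic A M M (madd M (i \<bullet> p) (j \<bullet> q)) mid)"

text \<open>
  Conjugating the four structure maps by isomorphisms with modules over \<open>'u\<close> yields a biproduct
  there, because conjugation respects homotopies.
\<close>

lemma acyc_biproduct:
  assumes aM: "acyc M" and X: "X \<in> Mods A" "small X" and Y: "Y \<in> Mods A" "small Y" and "biproduct M X Y"
  shows "acyc X"
proof -
  note M = acyc_in_Mods[OF aM]
  obtain i p j q where i: "i \<in> mor A X M" and p: "p \<in> mor A M X" and j: "j \<in> mor A Y M" and q: "q \<in> mor A M Y"
    and h: "homotopic A X X (p \<bullet> i) mid" "homotopic A Y Y (q \<bullet> j) mid"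
      "homotopic A X Y (q \<bullet> i) (mzero Y)" "homotopic A Y X (p \<bullet> j) (mzero X)"
      "homotopic A M M (madd M (i \<bullet> p) (j \<bullet> q)) mid"
    using assms(6) unfolding biproduct_def by blast
  obtain M' \<mu> where M': "M' \<in> \<A>" "iso_mor M' M \<mu>" using aM by (auto simp: acyc_def iso_mod_iff)
  obtain X' :: "('a, 'u) cdg_module" and \<alpha> where X': "X' \<in> Mods A" "iso_mor X' X \<alpha>" using realization[OF X] by blast
  obtain Y' :: "('a, 'u) cdg_module" and \<beta> where Y': "Y' \<in> Mods A" "iso_mor Y' Y \<beta>" using realization[OF Y] by blast
  note M'm = subset_Mods[OF M'(1)]
  define i' where "i' = (\<lambda>l x. inverse_mor M' \<mu> l (i l (\<alpha> l x)))"
  define p' where "p' = (\<lambda>l x. inverse_mor X' \<alpha> l (p l (\<mu> l x)))"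
  define j' where "j' = (\<lambda>l x. inverse_mor M' \<mu> l (j l (\<beta> l x)))"
  define q' where "q' = (\<lambda>l x. inverse_mor Y' \<beta> l (q l (\<mu> l x)))"
  note i' = conj_mor[OF i'_def i X'(2) M'(2) X(1) M X'(1) M'm]
  note p' = conj_mor[OF p'_def p M'(2) X'(2) M X(1) M'm X'(1)]
  note j' = conj_mor[OF j'_def j Y'(2) M'(2) Y(1) M Y'(1) M'm]
  note q' = conj_mor[OF q'_def q M'(2) Y'(2) M Y(1) M'm Y'(1)]
  have am: "\<alpha> \<in> mor A X' X" "inverse_mor X' \<alpha> \<in> mor A X X'"
    using X'(2) inverse_mor(1)[OF X'(2,1) X(1)] by (simp_all add: iso_mor_def)
  have bm: "\<beta> \<in> mor A Y' Y" "inverse_mor Y' \<beta> \<in> mor A Y Y'"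
    using Y'(2) inverse_mor(1)[OF Y'(2,1) Y(1)] by (simp_all add: iso_mor_def)
  have mm: "\<mu> \<in> mor A M' M" "inverse_mor M' \<mu> \<in> mor A M M'"
    using M'(2) inverse_mor(1)[OF M'(2) M'm M] by (simp_all add: iso_mor_def)
  note inv = inverse_mor(2)[OF X'(2,1) X(1)] inverse_mor(2)[OF Y'(2,1) Y(1)] inverse_mor(2)[OF M'(2) M'm M]
  note rules = mor_rules[OF am(1) X'(1) X(1)] mor_rules[OF am(2) X(1) X'(1)]
    mor_rules[OF bm(1) Y'(1) Y(1)] mor_rules[OF bm(2) Y(1) Y'(1)]
    mor_rules[OF mm(1) M'm M] mor_rules[OF mm(2) M M'm]
    mor_rules[OF i X(1) M] mor_rules[OF p M X(1)] mor_rules[OF j Y(1) M] mor_rules[OF q M Y(1)]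
  have "homotopic A X' X' (p' \<bullet> i') mid"
    by (rule homotopic_comp[OF X(1) X(1) X'(1) X'(1) h(1) am(2,1)])
      (simp_all add: mcomp_def mid_def i'(2) p'_def inv)
  moreover have "homotopic A Y' Y' (q' \<bullet> j') mid"
    by (rule homotopic_comp[OF Y(1) Y(1) Y'(1) Y'(1) h(2) bm(2,1)])
      (simp_all add: mcomp_def mid_def j'(2) q'_def inv)
  moreover have "homotopic A X' Y' (q' \<bullet> i') (mzero Y')"
    by (rule homotopic_comp[OF X(1) Y(1) X'(1) Y'(1) h(3) bm(2) am(1)])
      (simp_all add: mcomp_def mzero_def i'(2) q'_def rules group_rules Y)
  moreover have "homotopic A Y' X' (p' \<bullet> j') (mzero X')"
    by (rule homotopic_comp[OF Y(1) X(1) Y'(1) X'(1) h(4) am(2) bm(1)])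
      (simp_all add: mcomp_def mzero_def j'(2) p'_def rules group_rules X)
  moreover have "homotopic A M' M' (madd M' (i' \<bullet> p') (j' \<bullet> q')) mid"
    by (rule homotopic_comp[OF M M M'm M'm h(5) mm(2,1)])
      (simp_all add: mcomp_def madd_def mid_def p'(2) q'(2) i'_def j'_def rules inv)
  ultimately have "homotopy_biproduct A M' X' Y'"
    unfolding homotopy_biproduct_def using i'(1) p'(1) j'(1) q'(1) by blast
  hence "X' \<in> \<A>" using thick M'(1) X'(1) Y'(1) unfolding thick_def by blast
  thus ?thesis unfolding acyc_def using X(1) X'(2) iso_mod_iff by blast
qed

section \<open>Contractible cones and triangles\<close>

lemmas cone_simps = cone_gr cone_act cone_md shift_gr shift_md shift_act

text \<open>
  A homotopy equivalence exhibits \<open>M\<close> as the biproduct of \<open>X\<close> and \<open>0\<close>.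
\<close>

lemma acyc_equivalence:
  assumes aM: "acyc M" and X: "X \<in> Mods A" "small X" and i: "i \<in> mor A X M" and p: "p \<in> mor A M X"
    and pi: "homotopic A X X (p \<bullet> i) mid" and ip: "homotopic A M M (i \<bullet> p) mid"
  shows "acyc X"
proof (rule acyc_biproduct[OF aM X])
  note M = acyc_in_Mods[OF aM]
  let ?Z = "zero_module :: ('a, 'u) cdg_module"
  have ZM: "?Z \<in> Mods A" by (rule zero_module_in_Mods)
  show "?Z \<in> Mods A" "small ?Z" by (simp_all add: ZM small_universe)
  have mid: "homotopic A M M (madd M (i \<bullet> p) (mzero M \<bullet> mzero ?Z)) mid"
  proof (rule homotopic_comp[OF M M M M ip mor_id[OF M] mor_id[OF M]])
    show "madd M (i \<bullet> p) (mzero M \<bullet> mzero ?Z) l x = (i \<bullet> p) l x" if "x \<in> el M l" for l x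
      using that by (simp add: madd_def mcomp_def mzero_def group_rules[OF M] mor_rules[OF i X(1) M] mor_rules[OF p M X(1)])
  qed (simp_all add: mid_def)
  have 1: "homotopic A ?Z ?Z (mzero ?Z \<bullet> mzero M) mid"
    by (rule homotopic_eqI) (simp_all add: ZM mcomp_def mzero_def mid_def zero_module_gr singleton_group_def)
  have 2: "homotopic A X ?Z (mzero ?Z \<bullet> i) (mzero ?Z)"
    by (rule homotopic_eqI) (simp_all add: ZM X mcomp_def mzero_def group_rules[OF ZM])
  have 3: "homotopic A ?Z X (p \<bullet> mzero M) (mzero X)"
    by (rule homotopic_eqI) (simp_all add: ZM X mcomp_def mzero_def group_rules[OF X(1)] mor_rules[OF p M X(1)])
  show "biproduct M X ?Z"
    unfolding biproduct_def
    by (intro bexI[of _ i] bexI[of _ p] bexI[of _ "mzero M"] bexI[of _ "mzero ?Z"] conjI pi mid 1 2 3 i p mzero_mor M ZM)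
qed

text \<open>
  The cone of an identity is contractible by \<open>(y, x) \<mapsto> (0, y)\<close>, hence homotopy equivalent to \<open>0\<close>.
\<close>

lemma acyc_cone_id:
  assumes M: "M \<in> Mods A" and s: "small M"
  shows "acyc (cone M M mid)"
proof -
  let ?C = "cone M M mid" and ?Z = "zero_module :: ('a, 'u) cdg_module"
  have ZM: "?Z \<in> Mods A" by (rule zero_module_in_Mods)
  have id: "mid \<in> mor A M M" using mor_id[OF M] by (simp add: mid_def)
  have C: "?C \<in> Mods A" by (rule cone_in_Mods[OF M M id])
  have "acyc ?Z" using zero_in by (simp add: acyc_iff)
  thus ?thesis
  proof (rule acyc_equivalence[OF _ C small_cone[OF s s] mzero_mor[OF C ZM] mzero_mor[OF ZM C]])
    show "homotopic A ?Z ?Z (mzero ?Z \<bullet> mzero ?C) mid"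
      by (rule homotopic_eqI) (simp_all add: ZM mcomp_def mzero_def mid_def zero_module_gr singleton_group_def)
    show "homotopic A ?C ?C (mzero ?C \<bullet> mzero ?Z) mid"
    proof (rule homotopicI)
      \<comment> \<open>The contraction with the opposite sign, because the homotopy leads from the identity to zero.\<close>
      show "(\<lambda>i p. (\<one>\<^bsub>gr M (i - 1)\<^esub>, inv\<^bsub>gr M i\<^esub> fst p)) \<in> lin A (- 1) ?C ?C"
        by (rule linI[OF C]) (auto simp: M cone_simps mod_simps Mods_group)
    qed (auto simp: M mcomp_def mzero_def mid_def cone_simps mod_simps Mods_group)
  qed
qed

text \<open>
  If \<open>u = d h + h d\<close> then the cone \<open>X \<oplus> Z[1]\<close> of \<open>u\<close> splits even though its predifferential
  involves \<open>u\<close>: \<open>z \<mapsto> (- h z, z)\<close> is a morphism from \<open>Z[1]\<close>, and \<open>(x, z) \<mapsto> x + h z\<close> is the projection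
  to \<open>X\<close> that annihilates its image.
\<close>

lemma null_homotopic_cone:
  fixes X :: "('a, 'x) cdg_module" and Z :: "('a, 'z) cdg_module"
  assumes u: "u \<in> mor A Z X" and Z: "Z \<in> Mods A" "small Z" and X: "X \<in> Mods A" "small X"
    and null: "homotopic A Z X u (mzero X)" and C: "acyc (cone Z X u)"
  shows "acyc X"
proof (rule acyc_biproduct[OF C X])
  let ?C = "cone Z X u" and ?Y = "shift Z"
  note CM = cone_in_Mods[OF Z(1) X(1) u] and Y = shift_in_Mods[OF Z(1)]
  show "shift Z \<in> Mods A" "small (shift Z)" using Z by (simp_all add: shift_in_Mods small_shift)
  obtain h where h: "h \<in> lin A (- 1) Z X" and
    uh: "\<And>i x. x \<in> el Z i \<Longrightarrow> u i x = mzero X i x \<otimes>\<^bsub>gr X i\<^esub> (md X (i - 1) (h i x) \<otimes>\<^bsub>gr X i\<^esub> h (i + 1) (md Z i x))"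
    using null unfolding homotopic_def by blast
  note hr = lin_rules[OF h Z(1) X(1)]
  have uh: "u i x = md X (i - 1) (h i x) \<otimes>\<^bsub>gr X i\<^esub> h (i + 1) (md Z i x)" if "x \<in> el Z i" for i x
    using uh[OF that] that by (simp add: mzero_def X Z hr mod_rules group_rules)
  note rules = X(1) Z(1) CM Y cone_simps hr mor_rules[OF u Z(1) X(1)] Mods_group[OF X(1)] Mods_group[OF Z(1)]
  define i :: "int \<Rightarrow> 'x \<Rightarrow> 'x \<times> 'z" where "i = (\<lambda>l x. (x, \<one>\<^bsub>gr Z (l + 1)\<^esub>))"
  define p where "p = (\<lambda>l v. fst v \<otimes>\<^bsub>gr X l\<^esub> h (l + 1) (snd v))"
  define j where "j = (\<lambda>l z. (inv\<^bsub>gr X l\<^esub> h (l + 1) z, z))"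
  define q :: "int \<Rightarrow> 'x \<times> 'z \<Rightarrow> 'z" where "q = (\<lambda>l v. snd v)"
  have "i \<in> mor A X ?C" unfolding i_def
    by (rule morI[OF CM]) (auto simp: rules mod_simps)
  moreover have "p \<in> mor A ?C X" unfolding p_def
    by (rule morI[OF X(1)]) (auto simp: rules uh mod_simps)
  moreover have "j \<in> mor A ?Y ?C" unfolding j_def
    by (rule morI[OF CM]) (auto simp: rules uh mod_simps)
  moreover have "q \<in> mor A ?C ?Y" unfolding q_def
    by (rule morI[OF Y]) (auto simp: rules mod_simps)
  moreover have "homotopic A X X (p \<bullet> i) mid"
    by (rule homotopic_eqI) (auto simp: rules mod_simps mcomp_def mid_def p_def i_def)
  moreover have "homotopic A ?Y ?Y (q \<bullet> j) mid"
    by (rule homotopic_eqI) (auto simp: rules mod_simps mcomp_def mid_def q_def j_def)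
  moreover have "homotopic A X ?Y (q \<bullet> i) (mzero ?Y)"
    by (rule homotopic_eqI) (auto simp: rules mod_simps mcomp_def mzero_def q_def i_def)
  moreover have "homotopic A ?Y X (p \<bullet> j) (mzero X)"
    by (rule homotopic_eqI) (auto simp: rules mod_simps mcomp_def mzero_def p_def j_def)
  moreover have "homotopic A ?C ?C (madd ?C (i \<bullet> p) (j \<bullet> q)) mid"
    by (rule homotopic_eqI) (auto simp: rules mod_simps madd_def mcomp_def mid_def i_def p_def q_def j_def)
  ultimately show "biproduct ?C X ?Y" unfolding biproduct_def by blast
qed

definition cone_inclusion :: "('a, 'v) cdg_module \<Rightarrow> int \<Rightarrow> 'w \<Rightarrow> 'w \<times> 'v" where
  "cone_inclusion M = (\<lambda>i y. (y, \<one>\<^bsub>gr M (i + 1)\<^esub>))"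

lemma cone_inclusion_mor:
  assumes f: "f \<in> mor A M N" and M: "M \<in> Mods A" and N: "N \<in> Mods A"
  shows "cone_inclusion M \<in> mor A N (cone M N f)"
  unfolding cone_inclusion_def
  by (rule morI[OF cone_in_Mods[OF M N f]]) (auto simp: M N cone_simps mor_rules[OF f M N] mod_simps)

text \<open>
  Rotation of triangles: the cone of \<open>N \<rightarrow> cone f\<close> is \<open>N \<oplus> M[1] \<oplus> N[1]\<close>, where the two copies of \<open>N\<close>
  cancel up to homotopy, so it is homotopy equivalent to \<open>M[1]\<close>.
\<close>

lemma cone_of_inclusion:
  fixes M :: "('a, 'v) cdg_module" and N :: "('a, 'w) cdg_module"
  assumes f: "f \<in> mor A M N" and M: "M \<in> Mods A" "small M" and N: "N \<in> Mods A" "small N"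
  shows "acyc (cone N (cone M N f) (cone_inclusion M)) \<longleftrightarrow> acyc M"
proof -
  let ?C = "cone M N f" and ?X = "shift M"
  let ?D = "cone N ?C (cone_inclusion M)"
  note CM = cone_in_Mods[OF M(1) N(1) f] and X = shift_in_Mods[OF M(1)]
  note inc = cone_inclusion_mor[OF f M(1) N(1)]
  note DM = cone_in_Mods[OF N(1) CM inc]
  note rules = M(1) N(1) CM DM X cone_simps cone_inclusion_def mor_rules[OF f M(1) N(1)] Mods_group[OF M(1)] Mods_group[OF N(1)]
    DirProd_group[OF Mods_group[OF M(1)] Mods_group[OF N(1)]]  DirProd_group[OF Mods_group[OF N(1)] Mods_group[OF M(1)]]
  \<comment> \<open>The last component \<open>- f x\<close> makes \<open>i\<close> commute with the predifferentials.\<close>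
  define i where "i = (\<lambda>l x. ((\<one>\<^bsub>gr N l\<^esub>, x), inv\<^bsub>gr N (l + 1)\<^esub> f (l + 1) x))"
  define p :: "int \<Rightarrow> ('w \<times> 'v) \<times> 'w \<Rightarrow> 'v" where "p = (\<lambda>l v. snd (fst v))"
  have i: "i \<in> mor A ?X ?D" unfolding i_def
    by (rule morI[OF DM]) (auto simp: rules mod_simps)
  have p: "p \<in> mor A ?D ?X" unfolding p_def
    by (rule morI[OF X]) (auto simp: rules mod_simps)
  have pi: "homotopic A ?X ?X (p \<bullet> i) mid"
    by (rule homotopic_eqI) (auto simp: rules mod_simps mcomp_def mid_def i_def p_def)
  have ip: "homotopic A ?D ?D (i \<bullet> p) mid"
  proof (rule homotopicI)
    \<comment> \<open>The homotopy moves the component in \<open>N\<close> to \<open>N[1]\<close>.\<close>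
    show "(\<lambda>l v. ((\<one>\<^bsub>gr N (l - 1)\<^esub>, \<one>\<^bsub>gr M l\<^esub>), inv\<^bsub>gr N l\<^esub> fst (fst v))) \<in> lin A (- 1) ?D ?D"
      by (rule linI[OF DM]) (auto simp: rules mod_simps)
  qed (auto simp: rules mod_simps mcomp_def mid_def i_def p_def)
  have "acyc ?D \<longleftrightarrow> acyc ?X"
  proof
    assume "acyc ?D"
    thus "acyc ?X" using X small_shift[OF M(2)] i p pi ip by (rule acyc_equivalence)
  next
    assume "acyc ?X"
    thus "acyc ?D" using DM _ p i ip pi by (rule acyc_equivalence) (simp add: small_cone M N)
  qed
  thus ?thesis by (simp add: acyc_shift M)
qed

text \<open>
  Two out of three for triangles. The triangle of \<open>f\<close> is rotated once for the source, and twice for the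
  target by applying the statement for the source to \<open>N \<rightarrow> cone f\<close>.
\<close>

lemma acyc_source:
  assumes f: "f \<in> mor A M N" and M: "M \<in> Mods A" "small M" and N: "acyc N" and C: "acyc (cone M N f)"
  shows "acyc M"
  using acyc_cone[OF N C cone_inclusion_mor[OF f M(1) acyc_in_Mods[OF N]]]
    cone_of_inclusion[OF f M acyc_in_Mods[OF N] acyc_small[OF N]] by simp

lemma acyc_target:
  assumes f: "f \<in> mor A M N" and N: "N \<in> Mods A" "small N" and M: "acyc M" and C: "acyc (cone M N f)"
  shows "acyc N"
  using cone_inclusion_mor[OF f acyc_in_Mods[OF M] N(1)] N C
proof (rule acyc_source)
  show "acyc (cone N (cone M N f) (cone_inclusion M))"
    using cone_of_inclusion[OF f acyc_in_Mods[OF M] acyc_small[OF M] N] M by simp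
qed

end

section \<open>Exact sequences of acyclic modules\<close>

locale totalization_closed = thick_subcategory A \<A>
  for A :: "('k, 'a) cdg_algebra" and \<A> :: "('a, 'u) cdg_module set" +
  assumes A1: "A1 A \<A>"
begin

text \<open>
  The exact sequence is replaced by an isomorphic one over \<open>'u\<close>, to which (A1) applies.
\<close>

lemma acyc_totalization:
  assumes ex: "exact_modules M' f M g M''"
    and M': "M' \<in> Mods A" "small M'" and M: "M \<in> Mods A" "small M" and M'': "M'' \<in> Mods A" "small M''"
  shows "acyc (totalization M' f M g M'')"
proof -
  have f: "f \<in> mor A M' M" and g: "g \<in> mor A M M''"
    and inj: "inj_on (f i) (el M' i)" and surj: "g i ` el M i = el M'' i"
    and ker: "f i ` el M' i = {x \<in> el M i. g i x = \<one>\<^bsub>gr M'' i\<^esub>}" for i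
    using ex by (auto simp: exact_modules_def)
  obtain N' :: "('a, 'u) cdg_module" and \<alpha>' where N': "N' \<in> Mods A" "iso_mor N' M' \<alpha>'" using realization[OF M'] by blast
  obtain N :: "('a, 'u) cdg_module" and \<alpha> where N: "N \<in> Mods A" "iso_mor N M \<alpha>" using realization[OF M] by blast
  obtain N'' :: "('a, 'u) cdg_module" and \<alpha>'' where N'': "N'' \<in> Mods A" "iso_mor N'' M'' \<alpha>''" using realization[OF M''] by blast
  define f0 where "f0 = (\<lambda>i x. inverse_mor N \<alpha> i (f i (\<alpha>' i x)))"
  define g0 where "g0 = (\<lambda>i x. inverse_mor N'' \<alpha>'' i (g i (\<alpha> i x)))"
  note f0 = conj_mor[OF f0_def f N'(2) N(2) M'(1) M(1) N'(1) N(1)]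
  note g0 = conj_mor[OF g0_def g N(2) N''(2) M(1) M''(1) N(1) N''(1)]
  have a': "bij_betw (\<alpha>' i) (el N' i) (el M' i)" "bij_betw (\<alpha> i) (el N i) (el M i)"
    "bij_betw (\<alpha>'' i) (el N'' i) (el M'' i)" for i
    using N' N N'' by (simp_all add: iso_mor_def)
  have am: "\<alpha> \<in> mor A N M" "\<alpha>' \<in> mor A N' M'" "\<alpha>'' \<in> mor A N'' M''"
    using N N' N'' by (simp_all add: iso_mor_def)
  note inv = inverse_mor(2,3)[OF N(2,1) M(1)] inverse_mor(2,3)[OF N'(2,1) M'(1)] inverse_mor(2,3)[OF N''(2,1) M''(1)]
  have bij: "bij_betw (inverse_mor N \<alpha> i) (el M i) (el N i)" "bij_betw (inverse_mor N'' \<alpha>'' i) (el M'' i) (el N'' i)" for i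
    using a' by (simp_all add: inverse_mor_def bij_betw_inv_into)
  have ex0: "exact_modules N' f0 N g0 N''"
    unfolding exact_modules_def
  proof (intro conjI allI)
    fix i
    have fi: "f0 i = inverse_mor N \<alpha> i \<circ> (f i \<circ> \<alpha>' i)" and gi: "g0 i = inverse_mor N'' \<alpha>'' i \<circ> (g i \<circ> \<alpha> i)"
      by (auto simp: f0_def g0_def)
    have fc: "f i ` el M' i \<subseteq> el M i" by (simp add: ker)
    show "inj_on (f0 i) (el N' i)"
      unfolding fi
    proof (intro comp_inj_on)
      show "inj_on (inverse_mor N \<alpha> i) ((f i \<circ> \<alpha>' i) ` el N' i)"
        by (rule inj_on_subset[of _ "el M i"]) (use bij(1)[of i] in \<open>auto simp: bij_betw_def
            mor_rules[OF f M'(1) M(1)] mor_rules[OF am(2) N'(1) M'(1)]\<close>)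
    qed (use a'(1)[of i] inj[of i] in \<open>simp_all add: bij_betw_def\<close>)
    show "g0 i ` el N i = el N'' i"
      unfolding gi image_comp[symmetric] using a'(2)[of i] bij(2)[of i] surj[of i] by (simp add: bij_betw_def)
    have "f0 i ` el N' i = inverse_mor N \<alpha> i ` {x \<in> el M i. g i x = \<one>\<^bsub>gr M'' i\<^esub>}"
      unfolding fi image_comp[symmetric] using a'(1)[of i] by (simp add: bij_betw_def ker)
    also have "\<dots> = {x \<in> el N i. g0 i x = \<one>\<^bsub>gr N'' i\<^esub>}"
    proof (intro equalityI subsetI)
      fix x assume "x \<in> inverse_mor N \<alpha> i ` {x \<in> el M i. g i x = \<one>\<^bsub>gr M'' i\<^esub>}"
      then obtain y where y: "y \<in> el M i" "g i y = \<one>\<^bsub>gr M'' i\<^esub>" "x = inverse_mor N \<alpha> i y" by blast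
      have "x \<in> el N i" using y bij(1)[of i] by (auto simp: bij_betw_def)
      moreover have "inverse_mor N'' \<alpha>'' i \<one>\<^bsub>gr M'' i\<^esub> = \<one>\<^bsub>gr N'' i\<^esub>"
        using inv(5)[of "\<one>\<^bsub>gr N'' i\<^esub>" i] by (simp add: mor_rules[OF am(3) N''(1) M''(1)] N'' group_rules)
      ultimately show "x \<in> {x \<in> el N i. g0 i x = \<one>\<^bsub>gr N'' i\<^esub>}" using y by (simp add: g0_def inv)
    next
      fix x assume x: "x \<in> {x \<in> el N i. g0 i x = \<one>\<^bsub>gr N'' i\<^esub>}"
      hence "g i (\<alpha> i x) = \<alpha>'' i \<one>\<^bsub>gr N'' i\<^esub>" using g0(2)[of x i] by simp
      hence "g i (\<alpha> i x) = \<one>\<^bsub>gr M'' i\<^esub>" by (simp add: mor_rules[OF am(3) N''(1) M''(1)])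
      moreover have "\<alpha> i x \<in> el M i" using x by (simp add: mor_rules[OF am(1) N(1) M(1)])
      moreover have "x = inverse_mor N \<alpha> i (\<alpha> i x)" using x by (simp add: inv)
      ultimately show "x \<in> inverse_mor N \<alpha> i ` {x \<in> el M i. g i x = \<one>\<^bsub>gr M'' i\<^esub>}" by blast
    qed
    finally show "f0 i ` el N' i = {x \<in> el N i. g0 i x = \<one>\<^bsub>gr N'' i\<^esub>}" .
  qed (use f0 g0 in simp_all)
  note CN = cone_in_Mods[OF N'(1) N(1) f0(1)] and CM = cone_in_Mods[OF M'(1) M(1) f]
  note tN = totalization_mor[OF ex0 N'(1) N(1) N''(1)] and tM = totalization_mor[OF ex M'(1) M(1) M''(1)]
  have T: "totalization N' f0 N g0 N'' \<in> Mods A" "totalization M' f M g M'' \<in> Mods A"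
    unfolding totalization_eq by (simp_all add: cone_in_Mods CN CM tN tM N'' M'')
  have i1: "iso_mor (cone N' N f0) (cone M' M f) (\<lambda>i p. (\<alpha> i (fst p), \<alpha>' (i + 1) (snd p)))"
    using iso_cone[OF N'(2) N(2) N'(1) N(1) M'(1) M(1) f0(1) f] f0(2) by auto
  have "iso_mor (totalization N' f0 N g0 N'') (totalization M' f M g M'')
      (\<lambda>i p. (\<alpha>'' i (fst p), (\<lambda>i p. (\<alpha> i (fst p), \<alpha>' (i + 1) (snd p))) (i + 1) (snd p)))"
    unfolding totalization_eq
    by (rule iso_cone[OF i1 N''(2) CN N''(1) CM M''(1) tN tM]) (auto simp: cone_gr g0)
  hence i: "iso_mod A (totalization N' f0 N g0 N'') (totalization M' f M g M'')" by (auto simp: iso_mod_iff)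
  have "small (totalization N' f0 N g0 N'')"
    unfolding totalization_eq by (intro small_cone small_universe)
  then obtain D :: "('a, 'u) cdg_module" and \<phi> where D: "D \<in> Mods A" "iso_mor D (totalization N' f0 N g0 N'') \<phi>"
    using realization[OF T(1)] by blast
  have iD: "iso_mod A D (totalization N' f0 N g0 N'')" using D(2) by (auto simp: iso_mod_iff)
  have "D \<in> \<A>"
    using A1 N'(1) N(1) N''(1) D(1) iD exact_modules_imp_short_exact[OF ex0 N'(1) N(1) N''(1)]
    unfolding A1_def by blast
  thus ?thesis
    using iso_mod_trans[OF iD i D(1) T] T(2) by (auto simp: acyc_def)
qed

text \<open>
  The totalization of an exact sequence is an iterated cone. If it is acyclic, two out of three for
  triangles gives the corresponding statements for exact sequences.
\<close>

lemma exact_acyc_cone: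
  assumes ex: "exact_modules M' f M g M''"
    and M': "M' \<in> Mods A" "small M'" and M: "M \<in> Mods A" "small M" and M'': "acyc M''"
  shows "acyc (cone M' M f)"
proof (rule acyc_source)
  note Mm'' = acyc_in_Mods[OF M''] acyc_small[OF M'']
  have f: "f \<in> mor A M' M" using ex by (simp add: exact_modules_def)
  show "(\<lambda>i p. g i (fst p)) \<in> mor A (cone M' M f) M''" by (rule totalization_mor[OF ex M'(1) M(1) Mm''(1)])
  show "acyc (cone (cone M' M f) M'' (\<lambda>i p. g i (fst p)))"
    using acyc_totalization[OF ex M' M Mm''] by (simp add: totalization_eq)
qed (use M'' M M' ex in \<open>simp_all add: exact_modules_def cone_in_Mods small_cone\<close>)

lemma exact_acyc_right:
  assumes ex: "exact_modules M' f M g M''" and M': "acyc M'" and M: "acyc M" and M'': "M'' \<in> Mods A" "small M''"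
  shows "acyc M''"
proof (rule acyc_target)
  note Mm' = acyc_in_Mods[OF M'] acyc_small[OF M'] and Mm = acyc_in_Mods[OF M] acyc_small[OF M]
  have f: "f \<in> mor A M' M" using ex by (simp add: exact_modules_def)
  show "(\<lambda>i p. g i (fst p)) \<in> mor A (cone M' M f) M''" by (rule totalization_mor[OF ex Mm'(1) Mm(1) M''(1)])
  show "acyc (cone M' M f)" by (rule acyc_cone[OF M' M f])
  show "acyc (cone (cone M' M f) M'' (\<lambda>i p. g i (fst p)))"
    using acyc_totalization[OF ex Mm' Mm M''] by (simp add: totalization_eq)
qed (use M'' in simp_all)

lemma exact_acyc_middle:
  assumes ex: "exact_modules M' f M g M''" and M': "acyc M'" and M'': "acyc M''" and M: "M \<in> Mods A" "small M"
  shows "acyc M"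
proof (rule acyc_target)
  show "f \<in> mor A M' M" using ex by (simp add: exact_modules_def)
  show "acyc (cone M' M f)" by (rule exact_acyc_cone[OF ex acyc_in_Mods[OF M'] acyc_small[OF M'] M M''])
qed (use M M' in simp_all)

text \<open>
  The inclusion of \<open>M\<close> into its jets and the projection of the jets to \<open>M[2]\<close> have contractible
  cokernel and kernel, so both become invertible in the quotient category; but their composition is
  zero. Hence \<open>M\<close> vanishes there. To avoid the octahedral axiom, the projection is applied to the
  cone of the inclusion instead: it maps this cone onto the cone of \<open>0 : M \<rightarrow> M[2]\<close>, with the same
  contractible kernel, and \<open>M[2]\<close> is a summand of the latter cone.
\<close>

lemma acyc_if_derivation:
  fixes M :: "('a, 'v) cdg_module"
  assumes M: "M \<in> Mods A" "small M" and D: "curvature_derivation M D"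
  shows "acyc M"
proof -
  let ?S = "shift M"
  let ?SS = "shift ?S" and ?B = "cone ?S ?S mid" and ?E = "jets M D"
  note S = shift_in_Mods[OF M(1)]
  note SS = shift_in_Mods[OF S]
  note B = cone_in_Mods[OF S S mid_mor[OF S]] and E = jets_in_Mods[OF M(1) D]
  have s: "small ?S" "small ?SS" "small ?B"
    using M(2) by (simp_all add: small_shift small_cone)
  have "small ?E"
    using M(2) s(3) by (simp add: small_def jets_gr lepoll_Times_universe)
  note s = s this
  note rules = M(1) S SS B E jets_gr jets_act jets_md cone_simps Mods_group DirProd_group mod_simps mid_def
    derivation_rules[OF D M(1)]
  define i :: "int \<Rightarrow> 'v \<Rightarrow> 'v \<times> 'v \<times> 'v" where "i = (\<lambda>l x. (x, \<one>\<^bsub>gr M (l + 1)\<^esub>, \<one>\<^bsub>gr M (l + 2)\<^esub>))"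
  have i: "i \<in> mor A M ?E" unfolding i_def
    by (rule morI[OF E]) (auto simp: rules)
  \<comment> \<open>\<open>0 \<rightarrow> M \<rightarrow> jets M \<rightarrow> cone (id of M[1]) \<rightarrow> 0\<close>\<close>
  have "(\<lambda>l v. snd v) \<in> mor A ?E ?B"
    by (rule morI[OF B]) (auto simp: rules)
  moreover have "el M l \<noteq> {}" for l using group_rules(1)[OF M(1)] by blast
  ultimately have "exact_modules M i ?E (\<lambda>l v. snd v) ?B"
    unfolding exact_modules_def using i by (auto simp: rules i_def inj_on_def image_iff)
  moreover have "acyc ?B" by (rule acyc_cone_id[OF S s(1)])
  ultimately have F: "acyc (cone M ?E i)"
    using M E s by (intro exact_acyc_cone)
  let ?F = "cone M ?E i" and ?C = "cone M M mid" and ?G = "cone M ?SS (mzero ?SS)"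
  note FM = cone_in_Mods[OF M(1) E i] and C = cone_in_Mods[OF M(1) M(1) mid_mor[OF M(1)]]
  note zm = mzero_mor[OF M(1) SS]
  note G = cone_in_Mods[OF M(1) SS zm]
  \<comment> \<open>\<open>0 \<rightarrow> cone (id of M) \<rightarrow> cone i \<rightarrow> cone (0 : M \<rightarrow> M[2]) \<rightarrow> 0\<close>\<close>
  define \<kappa> where "\<kappa> = (\<lambda>l v. ((fst v, snd v, \<one>\<^bsub>gr M (l + 2)\<^esub>), \<one>\<^bsub>gr M (l + 1)\<^esub>) :: ('v \<times> 'v \<times> 'v) \<times> 'v)"
  define \<gamma> :: "int \<Rightarrow> ('v \<times> 'v \<times> 'v) \<times> 'v \<Rightarrow> 'v \<times> 'v" where "\<gamma> = (\<lambda>l v. (snd (snd (fst v)), snd v))"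
  have "\<kappa> \<in> mor A ?C ?F" unfolding \<kappa>_def
    by (rule morI[OF FM]) (auto simp: rules i_def)
  moreover have "\<gamma> \<in> mor A ?F ?G" unfolding \<gamma>_def
    by (rule morI[OF G]) (auto simp: rules i_def mzero_def)
  ultimately have "exact_modules ?C \<kappa> ?F \<gamma> ?G"
    unfolding exact_modules_def
  proof (intro conjI allI)
    fix l
    show "inj_on (\<kappa> l) (el ?C l)" by (auto simp: \<kappa>_def inj_on_def)
    show "\<gamma> l ` el ?F l = el ?G l"
    proof (intro equalityI subsetI)
      fix w assume "w \<in> el ?G l"
      hence "((\<one>\<^bsub>gr M l\<^esub>, \<one>\<^bsub>gr M (l + 1)\<^esub>, fst w), snd w) \<in> el ?F l"
        "w = \<gamma> l ((\<one>\<^bsub>gr M l\<^esub>, \<one>\<^bsub>gr M (l + 1)\<^esub>, fst w), snd w)" by (auto simp: rules \<gamma>_def)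
      thus "w \<in> \<gamma> l ` el ?F l" by blast
    qed (auto simp: rules \<gamma>_def)
    show "\<kappa> l ` el ?C l = {v \<in> el ?F l. \<gamma> l v = \<one>\<^bsub>gr ?G l\<^esub>}"
    proof (intro equalityI subsetI)
      fix v assume "v \<in> {v \<in> el ?F l. \<gamma> l v = \<one>\<^bsub>gr ?G l\<^esub>}"
      hence "(fst (fst v), fst (snd (fst v))) \<in> el ?C l" "v = \<kappa> l (fst (fst v), fst (snd (fst v)))"
        by (auto simp: rules \<gamma>_def \<kappa>_def)
      thus "v \<in> \<kappa> l ` el ?C l" by blast
    qed (auto simp: rules \<gamma>_def \<kappa>_def)
  qed
  hence "acyc ?G"
    by (rule exact_acyc_right) (simp_all add: acyc_cone_id M F G small_cone s)
  moreover have "homotopic A M ?SS (mzero ?SS) (mzero ?SS)"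
    by (rule homotopic_eqI[OF M(1) SS]) (simp_all add: mzero_def SS group_rules)
  ultimately have "acyc ?SS"
    using null_homotopic_cone[OF zm M SS s(2)] by blast
  thus "acyc M" by (simp add: acyc_shift M S s)
qed

end

section \<open>Vanishing of the quotient category\<close>

context thick_subcategory begin

lemma quasi_iso_iff:
  assumes "Z \<in> Mods A" "X \<in> Mods A"
  shows "u \<in> quasi_iso A \<A> Z X \<longleftrightarrow> u \<in> mor A Z X \<and> acyc (cone Z X u)"
  using assms by (auto simp: quasi_iso_def acyc_def cone_in_Mods)

lemma mid_quasi_iso: "X \<in> Mods A \<Longrightarrow> mid \<in> quasi_iso A \<A> X X"
  by (simp add: quasi_iso_iff mid_mor acyc_cone_id small_universe)

lemma homotopic_refl: "M \<in> Mods A \<Longrightarrow> N \<in> Mods A \<Longrightarrow> f \<in> mor A M N \<Longrightarrow> homotopic A M N f f"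
  by (rule homotopic_eqI) (simp_all add: mor_rules)

lemma mcomp_mid [simp]: "mid \<bullet> f = f" "f \<bullet> mid = f"
  by (simp_all add: mcomp_def mid_def fun_eq_iff)

text \<open>
  In a zero category the identity and the zero endomorphism of \<open>X\<close> agree. The roof that witnesses this
  provides a null-homotopic morphism to \<open>X\<close> with acyclic cone.
\<close>

lemma derived_cat_zeroD:
  assumes zero: "derived_cat_zero A \<A>" and X: "X \<in> Mods A"
  shows "X \<in> \<A>"
proof -
  obtain \<phi> where \<phi>: "derived_hom A \<A> X X = {\<phi>}"
    using zero X unfolding derived_cat_zero_def by blast
  let ?r1 = "(X, mid, mid)" and ?r2 = "(X, mid, mzero X)"
  have r: "?r1 \<in> roofs A \<A> X X" "?r2 \<in> roofs A \<A> X X"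
    using X by (simp_all add: roofs_def mid_quasi_iso mid_mor mzero_mor)
  have refl: "(?r2, ?r2) \<in> roof_rel A \<A> X X"
    unfolding roof_rel_def using r X
    by (auto intro!: bexI[of _ X] bexI[of _ mid] homotopic_refl simp: mid_mor mid_quasi_iso mzero_mor)
  have "roof_rel A \<A> X X `` {?r1} \<in> derived_hom A \<A> X X" "roof_rel A \<A> X X `` {?r2} \<in> derived_hom A \<A> X X"
    using r unfolding derived_hom_def by (auto intro: quotientI)
  hence "roof_rel A \<A> X X `` {?r1} = roof_rel A \<A> X X `` {?r2}" unfolding \<phi> by simp
  hence "(?r1, ?r2) \<in> roof_rel A \<A> X X" using refl by blast
  then obtain Z u1 u2 where Z: "Z \<in> Mods A" and u: "u1 \<in> mor A Z X" "u2 \<in> mor A Z X"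
    "u1 \<in> quasi_iso A \<A> Z X" "homotopic A Z X u1 (mzero X \<bullet> u2)"
    unfolding roof_rel_def by auto
  have "mzero X \<bullet> u2 = (mzero X :: int \<Rightarrow> 'u \<Rightarrow> 'u)" by (simp add: mcomp_def mzero_def fun_eq_iff)
  hence "homotopic A Z X u1 (mzero X)" using u(4) by simp
  hence "acyc X"
    using null_homotopic_cone[OF u(1) Z small_universe X small_universe] u(3) by (simp add: quasi_iso_iff Z X)
  thus ?thesis by (simp add: acyc_iff)
qed

text \<open>
  If every module is acyclic, then every roof is dominated by the one that starts at the zero module,
  so any two roofs are equivalent.
\<close>

lemma derived_cat_zeroI:
  assumes all: "Mods A \<subseteq> \<A>"
  shows "derived_cat_zero A \<A>"
  unfolding derived_cat_zero_def
proof (intro ballI)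
  fix X Y :: "('a, 'u) cdg_module" assume X: "X \<in> Mods A" and Y: "Y \<in> Mods A"
  let ?O = "zero_module :: ('a, 'u) cdg_module"
  have O: "?O \<in> Mods A" by (rule zero_module_in_Mods)
  have acyc: "acyc M" if M: "M \<in> Mods A" "small M" for M :: "('a, 'u \<times> 'u) cdg_module"
  proof -
    obtain N :: "('a, 'u) cdg_module" and \<phi> where "N \<in> Mods A" "iso_mor N M \<phi>" using realization[OF M] by blast
    thus ?thesis using all M(1) by (auto simp: acyc_def iso_mod_iff)
  qed
  have rel: "(r1, r2) \<in> roof_rel A \<A> X Y" if r: "r1 \<in> roofs A \<A> X Y" "r2 \<in> roofs A \<A> X Y" for r1 r2
  proof -
    obtain Z1 s1 f1 Z2 s2 f2 where e: "r1 = (Z1, s1, f1)" "r2 = (Z2, s2, f2)" using prod_cases3 by metis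
    have Z: "Z1 \<in> Mods A" "Z2 \<in> Mods A" and m: "s1 \<in> mor A Z1 X" "s2 \<in> mor A Z2 X" "f1 \<in> mor A Z1 Y" "f2 \<in> mor A Z2 Y"
      using r e by (auto simp: roofs_def quasi_iso_def)
    have c: "s1 \<bullet> mzero Z1 \<in> mor A ?O X"
      using mor_comp[OF mzero_mor[OF O Z(1)] m(1) O Z(1) X] by (simp add: mcomp_def comp_def)
    have "s1 \<bullet> mzero Z1 \<in> quasi_iso A \<A> ?O X"
      using c by (simp add: quasi_iso_iff O X acyc cone_in_Mods small_cone small_universe)
    moreover have "homotopic A ?O X (s1 \<bullet> mzero Z1) (s2 \<bullet> mzero Z2)"
      by (rule homotopic_eqI[OF O X]) (simp_all add: mcomp_def mzero_def mor_rules[OF m(1) Z(1) X] mor_rules[OF m(2) Z(2) X] X group_rules)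
    moreover have "homotopic A ?O Y (f1 \<bullet> mzero Z1) (f2 \<bullet> mzero Z2)"
      by (rule homotopic_eqI[OF O Y]) (simp_all add: mcomp_def mzero_def mor_rules[OF m(3) Z(1) Y] mor_rules[OF m(4) Z(2) Y] Y group_rules)
    ultimately show ?thesis
      unfolding roof_rel_def e using r O mzero_mor[OF O Z(1)] mzero_mor[OF O Z(2)] unfolding e by blast
  qed
  have sub: "roof_rel A \<A> X Y \<subseteq> roofs A \<A> X Y \<times> roofs A \<A> X Y"
    unfolding roof_rel_def by auto
  have "(X, mid, mzero Y) \<in> roofs A \<A> X Y"
    using X Y by (simp add: roofs_def mid_quasi_iso mzero_mor)
  hence "derived_hom A \<A> X Y = {roofs A \<A> X Y}"
    unfolding derived_hom_def quotient_def using rel sub by blast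
  thus "\<exists>\<phi>. derived_hom A \<A> X Y = {\<phi>}" by blast
qed

end

section \<open>Derivatives of homogeneous polynomials\<close>

text \<open>
  The derivative of a homogeneous polynomial \<open>p\<close> of degree \<open>j\<close>. As \<open>c\<close> has degree 2, the polynomial
  is zero or \<open>r c^(j/2)\<close>, so a single coefficient determines it.
\<close>

definition formal_deriv :: "('k, 'e) ring_scheme \<Rightarrow> int \<Rightarrow> (nat \<Rightarrow> 'k) \<Rightarrow> nat \<Rightarrow> 'k" where
  "formal_deriv k j p = (if j > 0 then
     monom (UP k) ([nat (j div 2)] \<cdot>\<^bsub>k\<^esub> coeff (UP k) p (nat (j div 2))) (nat (j div 2) - 1) else \<zero>\<^bsub>UP k\<^esub>)"

lemma poly_comp_monom:
  assumes "cring k" "r \<in> carrier k" shows "monom (UP k) r a \<in> poly_comp k (2 * int a)"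
proof -
  interpret K: cring k by fact
  interpret U: UP_cring k "UP k" by unfold_locales simp
  show ?thesis using assms by (auto simp: poly_comp_def)
qed

lemma poly_comp_zero:
  assumes "cring k" shows "\<zero>\<^bsub>UP k\<^esub> \<in> poly_comp k j"
proof -
  interpret K: cring k by fact
  interpret U: UP_cring k "UP k" by unfold_locales simp
  show ?thesis by (simp add: poly_comp_def)
qed

lemma poly_comp_cases:
  assumes "cring k" "p \<in> poly_comp k j"
  obtains "p = \<zero>\<^bsub>UP k\<^esub>" | a r where "r \<in> carrier k" "j = 2 * int a" "p = monom (UP k) r a"
proof -
  interpret K: cring k by fact
  interpret U: UP_cring k "UP k" by unfold_locales simp
  have pc: "p \<in> carrier (UP k)" using assms(2) by (simp add: poly_comp_def)
  show thesis
  proof (cases "p = \<zero>\<^bsub>UP k\<^esub>")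
    case False
    have "\<exists>a. coeff (UP k) p a \<noteq> \<zero>\<^bsub>k\<^esub>"
    proof (rule ccontr)
      assume "\<not> ?thesis"
      hence "p = \<zero>\<^bsub>UP k\<^esub>" by (intro U.up_eqI) (simp_all add: pc)
      thus False using False by contradiction
    qed
    then obtain a where a: "coeff (UP k) p a \<noteq> \<zero>\<^bsub>k\<^esub>" ..
    hence j: "j = 2 * int a" using assms(2) by (auto simp: poly_comp_def)
    have "p = monom (UP k) (coeff (UP k) p a) a"
    proof (rule U.up_eqI)
      fix m
      show "coeff (UP k) p m = coeff (UP k) (monom (UP k) (coeff (UP k) p a) a) m"
      proof (cases "m = a")
        case False
        hence "coeff (UP k) p m = \<zero>\<^bsub>k\<^esub>" using assms(2) j by (auto simp: poly_comp_def)
        thus ?thesis using False pc by simp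
      qed (simp add: pc)
    qed (simp_all add: pc)
    thus thesis using that(2)[OF _ j] pc U.coeff_closed by blast
  qed (rule that(1))
qed

lemma formal_deriv_zero:
  assumes "cring k" shows "formal_deriv k j \<zero>\<^bsub>UP k\<^esub> = \<zero>\<^bsub>UP k\<^esub>"
proof -
  interpret K: cring k by fact
  interpret U: UP_cring k "UP k" by unfold_locales simp
  show ?thesis by (simp add: formal_deriv_def)
qed

lemma formal_deriv_monom:
  assumes "cring k" "r \<in> carrier k"
  shows "formal_deriv k (2 * int a) (monom (UP k) r a) = monom (UP k) ([a] \<cdot>\<^bsub>k\<^esub> r) (a - 1)"
proof -
  interpret K: cring k by fact
  interpret U: UP_cring k "UP k" by unfold_locales simp
  show ?thesis using assms by (auto simp: formal_deriv_def)
qed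

lemma formal_deriv_in:
  assumes "cring k" "p \<in> poly_comp k j"
  shows "formal_deriv k j p \<in> poly_comp k (j - 2)"
  using assms
proof (cases rule: poly_comp_cases)
  case (2 a r)
  interpret K: cring k by fact
  interpret U: UP_cring k "UP k" by unfold_locales simp
  show ?thesis
  proof (cases a)
    case 0
    thus ?thesis using 2 assms(1) by (simp add: formal_deriv_def poly_comp_zero)
  next
    case (Suc b)
    thus ?thesis
      unfolding 2(2,3) formal_deriv_monom[OF assms(1) 2(1)]
      using 2(1) poly_comp_monom[OF assms(1), of "[a] \<cdot>\<^bsub>k\<^esub> r" b] by simp
  qed
qed (simp add: assms(1) formal_deriv_zero poly_comp_zero)

lemma formal_deriv_add:
  assumes "cring k" "p \<in> poly_comp k j" "q \<in> poly_comp k j"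
  shows "formal_deriv k j (p \<oplus>\<^bsub>UP k\<^esub> q) = formal_deriv k j p \<oplus>\<^bsub>UP k\<^esub> formal_deriv k j q"
proof -
  interpret K: cring k by fact
  interpret U: UP_cring k "UP k" by unfold_locales simp
  show ?thesis using assms(2,3)
    by (auto simp: formal_deriv_def poly_comp_def K.add.nat_pow_distrib K.add.nat_pow_closed)
qed

lemma formal_deriv_mult:
  assumes k: "cring k" and p: "p \<in> poly_comp k j" and q: "q \<in> poly_comp k l"
  shows "formal_deriv k (j + l) (p \<otimes>\<^bsub>UP k\<^esub> q) =
    formal_deriv k j p \<otimes>\<^bsub>UP k\<^esub> q \<oplus>\<^bsub>UP k\<^esub> p \<otimes>\<^bsub>UP k\<^esub> formal_deriv k l q"
proof -
  interpret K: cring k by fact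
  interpret U: UP_cring k "UP k" by unfold_locales simp
  have pc: "p \<in> carrier (UP k)" "q \<in> carrier (UP k)"
    "formal_deriv k j p \<in> carrier (UP k)" "formal_deriv k l q \<in> carrier (UP k)"
    using p q formal_deriv_in[OF k p] formal_deriv_in[OF k q] by (auto simp: poly_comp_def)
  show ?thesis using k p
  proof (cases rule: poly_comp_cases)
    case 1
    thus ?thesis using pc by (simp add: formal_deriv_zero k)
  next
    case a: (2 a r)
    show ?thesis using k q
    proof (cases rule: poly_comp_cases)
      case 1
      thus ?thesis using pc by (simp add: formal_deriv_zero k)
    next
      case b: (2 b s)
      note mm = U.monom_mult[symmetric]
      have pq: "p \<otimes>\<^bsub>UP k\<^esub> q = monom (UP k) (r \<otimes>\<^bsub>k\<^esub> s) (a + b)"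
        using a b by (simp del: U.monom_mult add: mm)
      have jl: "j + l = 2 * int (a + b)" using a b by simp
      have L: "formal_deriv k (j + l) (p \<otimes>\<^bsub>UP k\<^esub> q) = monom (UP k) ([(a + b)] \<cdot>\<^bsub>k\<^esub> (r \<otimes>\<^bsub>k\<^esub> s)) (a + b - 1)"
        unfolding pq jl by (rule formal_deriv_monom) (use a b k in simp_all)
      have m0: "monom (UP k) ([a] \<cdot>\<^bsub>k\<^esub> r) (a - 1) \<otimes>\<^bsub>UP k\<^esub> monom (UP k) s b = monom (UP k) ([a] \<cdot>\<^bsub>k\<^esub> (r \<otimes>\<^bsub>k\<^esub> s)) (a + b - 1)"
        if "r \<in> carrier k" "s \<in> carrier k" for a b r s
      proof (cases "a = 0")
        case False
        hence "a - 1 + b = a + b - 1" by simp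
        thus ?thesis using that U.monom_mult[of "[a] \<cdot>\<^bsub>k\<^esub> r" s "a - 1" b] K.add_pow_ldistr[of r s a]
          by (simp del: U.monom_mult)
      qed (use that in simp)
      have "p \<otimes>\<^bsub>UP k\<^esub> formal_deriv k l q = formal_deriv k l q \<otimes>\<^bsub>UP k\<^esub> p" using pc by (simp add: U.UP_m_comm)
      also have "\<dots> = monom (UP k) ([b] \<cdot>\<^bsub>k\<^esub> (r \<otimes>\<^bsub>k\<^esub> s)) (a + b - 1)"
        using a b m0[of s r b a] by (simp del: U.monom_mult add: formal_deriv_monom k K.m_comm add.commute)
      finally have 2: "p \<otimes>\<^bsub>UP k\<^esub> formal_deriv k l q = monom (UP k) ([b] \<cdot>\<^bsub>k\<^esub> (r \<otimes>\<^bsub>k\<^esub> s)) (a + b - 1)" .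
      have 1: "formal_deriv k j p \<otimes>\<^bsub>UP k\<^esub> q = monom (UP k) ([a] \<cdot>\<^bsub>k\<^esub> (r \<otimes>\<^bsub>k\<^esub> s)) (a + b - 1)"
        using a b m0[of r s a b] by (simp del: U.monom_mult add: formal_deriv_monom k)
      show ?thesis unfolding L 1 2 using a b by (simp add: U.monom_add[symmetric] K.add.nat_pow_mult del: U.monom_add U.monom_mult)
    qed
  qed
qed

lemma formal_deriv_one: "formal_deriv k 0 \<one>\<^bsub>UP k\<^esub> = \<zero>\<^bsub>UP k\<^esub>"
  by (simp add: formal_deriv_def)

lemma formal_deriv_cvar:
  assumes "cring k" shows "formal_deriv k 2 (cvar k) = \<one>\<^bsub>UP k\<^esub>"
proof -
  interpret K: cring k by fact
  interpret U: UP_cring k "UP k" by unfold_locales simp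
  show ?thesis by (simp add: formal_deriv_def del: One_nat_def)
qed

section \<open>Quotients of the polynomial algebra\<close>

text \<open>
  \<open>k[c]\<close> and \<open>k[c]/c^n\<close> are treated together, as algebras whose homogeneous elements are images of
  homogeneous polynomials under a map \<open>\<pi>\<close>.
\<close>

locale polynomial_quotient = curved_algebra A for A :: "('k, 'a) cdg_algebra" +
  fixes R :: "('k, 'e) ring_scheme" and \<pi> :: "(nat \<Rightarrow> 'k) \<Rightarrow> 'a"
  assumes R: "cring R" and homog_eq: "homog A j = \<pi> ` poly_comp R j"
    and \<pi>_add: "p \<in> carrier (UP R) \<Longrightarrow> q \<in> carrier (UP R) \<Longrightarrow> \<pi> (p \<oplus>\<^bsub>UP R\<^esub> q) = \<pi> p \<oplus>\<^bsub>A\<^esub> \<pi> q"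
    and \<pi>_mult: "p \<in> carrier (UP R) \<Longrightarrow> q \<in> carrier (UP R) \<Longrightarrow> \<pi> (p \<otimes>\<^bsub>UP R\<^esub> q) = \<pi> p \<otimes>\<^bsub>A\<^esub> \<pi> q"
    and \<pi>_one: "\<pi> \<one>\<^bsub>UP R\<^esub> = \<one>\<^bsub>A\<^esub>" and \<pi>_curv: "\<pi> (cvar R) = curv A"
    and pred_eq: "pred A a = \<pi> \<zero>\<^bsub>UP R\<^esub>"
begin

lemma poly_comp_closed: "p \<in> poly_comp R j \<Longrightarrow> p \<in> carrier (UP R)"
  by (simp add: poly_comp_def)

lemma \<pi>_in: "p \<in> poly_comp R j \<Longrightarrow> \<pi> p \<in> homog A j"
  by (simp add: homog_eq)

lemma act_zero:
  assumes M: "M \<in> Mods A" and x: "x \<in> el M i" and l: "l = j + i"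
  shows "act M j i (\<pi> \<zero>\<^bsub>UP R\<^esub>) x = \<one>\<^bsub>gr M l\<^esub>"
proof -
  interpret K: cring R by (rule R)
  interpret U: UP_cring R "UP R" by unfold_locales simp
  let ?z = "act M j i (\<pi> \<zero>\<^bsub>UP R\<^esub>) x"
  have z: "\<pi> \<zero>\<^bsub>UP R\<^esub> \<in> homog A j" by (rule \<pi>_in[OF poly_comp_zero[OF R]])
  have "?z = act M j i (\<pi> \<zero>\<^bsub>UP R\<^esub> \<oplus>\<^bsub>A\<^esub> \<pi> \<zero>\<^bsub>UP R\<^esub>) x"
    using \<pi>_add[of "\<zero>\<^bsub>UP R\<^esub>" "\<zero>\<^bsub>UP R\<^esub>"] by simp
  also have "\<dots> = ?z \<otimes>\<^bsub>gr M (j + i)\<^esub> ?z" using z x by (simp add: mod_rules[OF M])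
  finally have "?z \<otimes>\<^bsub>gr M (j + i)\<^esub> ?z = ?z" by simp
  moreover have "?z \<in> el M (j + i)" using z x by (simp add: mod_rules[OF M])
  ultimately show ?thesis using group.r_cancel_one[OF Mods_group[OF M]] l by blast
qed

definition derivation :: "('a, 'v) cdg_module \<Rightarrow> int \<Rightarrow> int \<Rightarrow> 'a \<Rightarrow> 'v \<Rightarrow> 'v" where
  "derivation M j i a = act M (j - 2) (i + 2) (\<pi> (formal_deriv R j (SOME p. p \<in> poly_comp R j \<and> \<pi> p = a)))"

text \<open>
  The derivative of \<open>a\<close> is computed from a polynomial \<open>p\<close> that represents \<open>a\<close>. It need not be well defined
  as an element of the algebra (in \<open>k[c]/c^n\<close> the derivative of \<open>c^n = 0\<close> is \<open>n c^(n-1)\<close>), but it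
  suffices that its action on \<open>M\<close> is.
\<close>

lemma curvature_derivation:
  assumes M: "M \<in> Mods A"
    and wd: "\<And>j i p q x. p \<in> poly_comp R j \<Longrightarrow> q \<in> poly_comp R j \<Longrightarrow> \<pi> p = \<pi> q \<Longrightarrow> x \<in> el M i \<Longrightarrow>
      act M (j - 2) i (\<pi> (formal_deriv R j p)) x = act M (j - 2) i (\<pi> (formal_deriv R j q)) x"
  shows "curvature_derivation M (derivation M)"
proof -
  interpret K: cring R by (rule R)
  interpret U: UP_cring R "UP R" by unfold_locales simp
  let ?D = "formal_deriv R"
  have D: "derivation M j i (\<pi> p) z = act M (j - 2) (i + 2) (\<pi> (?D j p)) z"
    if p: "p \<in> poly_comp R j" and z: "z \<in> el M (i + 2)" for j i p z
  proof -
    let ?q = "SOME q. q \<in> poly_comp R j \<and> \<pi> q = \<pi> p"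
    have "?q \<in> poly_comp R j \<and> \<pi> ?q = \<pi> p" by (rule someI[of _ p]) (simp add: p)
    thus ?thesis unfolding derivation_def using wd[OF _ p _ z] by blast
  qed
  have Din: "\<pi> (?D j p) \<in> homog A (j - 2)" if "p \<in> poly_comp R j" for j p
    by (rule \<pi>_in[OF formal_deriv_in[OF R that]])
  have Dc: "?D j p \<in> carrier (UP R)" if "p \<in> poly_comp R j" for j p
    by (rule poly_comp_closed[OF formal_deriv_in[OF R that]])
  have pc: "p \<otimes>\<^bsub>UP R\<^esub> q \<in> poly_comp R (j + l)" if "p \<in> poly_comp R j" "q \<in> poly_comp R l" for p q j l
    using poly_comp_mult[OF R that] .
  have ac: "p \<oplus>\<^bsub>UP R\<^esub> q \<in> poly_comp R j" if "p \<in> poly_comp R j" "q \<in> poly_comp R j" for p q j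
    using subgroup.m_closed[OF submodule.axioms(1)[OF poly_comp_submodule[OF R]] that] by simp
  have one: "\<one>\<^bsub>UP R\<^esub> \<in> poly_comp R 0" by (auto simp: poly_comp_def split: if_splits)
  have cv: "cvar R \<in> poly_comp R 2" using poly_comp_monom[OF R, of "\<one>\<^bsub>R\<^esub>" 1] by simp
  show ?thesis
    unfolding curvature_derivation_def
  proof (intro conjI allI ballI)
    fix j i a assume "a \<in> homog A j"
    then obtain p where p: "p \<in> poly_comp R j" "a = \<pi> p" by (auto simp: homog_eq)
    show "derivation M j i a \<in> hom (gr M (i + 2)) (gr M (j + i))"
      unfolding hom_def using p by (auto simp: D M Din mod_rules group_rules)
  next
    fix j i a b z assume "a \<in> homog A j" "b \<in> homog A j" and z: "z \<in> el M (i + 2)"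
    then obtain p q where p: "p \<in> poly_comp R j" "a = \<pi> p" "q \<in> poly_comp R j" "b = \<pi> q" by (auto simp: homog_eq)
    have "derivation M j i (a \<oplus>\<^bsub>A\<^esub> b) z = derivation M j i (\<pi> (p \<oplus>\<^bsub>UP R\<^esub> q)) z"
      using p by (simp add: \<pi>_add poly_comp_closed)
    thus "derivation M j i (a \<oplus>\<^bsub>A\<^esub> b) z = derivation M j i a z \<otimes>\<^bsub>gr M (j + i)\<^esub> derivation M j i b z"
      using p z Din[OF p(1)] Din[OF p(3)]
      by (simp add: D ac formal_deriv_add[OF R] \<pi>_add Dc mod_rules[OF M])
  next
    fix j l i a b z assume "a \<in> homog A j" "b \<in> homog A l" and z: "z \<in> el M (i + 2)"
    then obtain p q where p: "p \<in> poly_comp R j" "a = \<pi> p" "q \<in> poly_comp R l" "b = \<pi> q" by (auto simp: homog_eq)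
    have b: "b \<in> homog A l" and a: "a \<in> homog A j" using p \<pi>_in by auto
    note Dp = Din[OF p(1)] and Dq = Din[OF p(3)]
    have "derivation M (j + l) i (a \<otimes>\<^bsub>A\<^esub> b) z = derivation M (j + l) i (\<pi> (p \<otimes>\<^bsub>UP R\<^esub> q)) z"
      using p by (simp add: \<pi>_mult poly_comp_closed)
    also have "\<dots> = act M (j + l - 2) (i + 2) (\<pi> (?D j p) \<otimes>\<^bsub>A\<^esub> b \<oplus>\<^bsub>A\<^esub> a \<otimes>\<^bsub>A\<^esub> \<pi> (?D l q)) z"
      unfolding D[OF pc[OF p(1,3)] z] formal_deriv_mult[OF R p(1,3)]
      using p by (simp add: \<pi>_add \<pi>_mult Dc poly_comp_closed)
    also have "\<dots> = act M (j + l - 2) (i + 2) (\<pi> (?D j p) \<otimes>\<^bsub>A\<^esub> b) z \<otimes>\<^bsub>gr M (j + l + i)\<^esub>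
        act M (j + l - 2) (i + 2) (a \<otimes>\<^bsub>A\<^esub> \<pi> (?D l q)) z"
      using mod_rules(10)[OF M, of "\<pi> (?D j p) \<otimes>\<^bsub>A\<^esub> b" "j + l - 2" "a \<otimes>\<^bsub>A\<^esub> \<pi> (?D l q)" z "i + 2"]
        mult_in[OF Dp b] mult_in[OF a Dq] z by (simp add: algebra_simps)
    also have "act M (j + l - 2) (i + 2) (\<pi> (?D j p) \<otimes>\<^bsub>A\<^esub> b) z = derivation M j (l + i) a (act M l (i + 2) b z)"
      using mod_rules(11)[OF M Dp b z] p b z
      by (simp add: D mod_rules[OF M] algebra_simps)
    also have "act M (j + l - 2) (i + 2) (a \<otimes>\<^bsub>A\<^esub> \<pi> (?D l q)) z = act M j (l + i) a (derivation M l i b z)"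
      using mod_rules(11)[OF M a Dq z] p z by (simp add: D algebra_simps)
    finally show "derivation M (j + l) i (a \<otimes>\<^bsub>A\<^esub> b) z =
      derivation M j (l + i) a (act M l (i + 2) b z) \<otimes>\<^bsub>gr M (j + l + i)\<^esub> act M j (l + i) a (derivation M l i b z)" .
  next
    fix i z assume z: "z \<in> el M (i + 2)"
    show "derivation M 0 i \<one>\<^bsub>A\<^esub> z = \<one>\<^bsub>gr M i\<^esub>"
      using D[OF one z] z by (simp add: \<pi>_one formal_deriv_one act_zero[OF M])
    show "derivation M 2 i (curv A) z = z"
      using D[OF cv z] z by (simp add: \<pi>_curv formal_deriv_cvar[OF R] \<pi>_one mod_rules[OF M] del: One_nat_def)
  next
    fix j i a z assume "a \<in> homog A j" and z: "z \<in> el M (i + 2)"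
    then obtain p where p: "p \<in> poly_comp R j" "a = \<pi> p" by (auto simp: homog_eq)
    have 0: "derivation M (j + 1) i (pred A a) z = \<one>\<^bsub>gr M (j + i + 1)\<^esub>"
      using D[OF poly_comp_zero[OF R] z, of "j + 1"] z
      by (simp add: pred_eq formal_deriv_zero[OF R] act_zero[OF M] add_ac)
    have dz: "md M (i + 2) z \<in> el M (i + 3)" using z by (simp add: mod_rules[OF M])
    have Dz: "derivation M j (i + 1) a (md M (i + 2) z) = act M (j - 2) (i + 3) (\<pi> (?D j p)) (md M (i + 2) z)"
      using D[OF p(1), of "md M (i + 2) z" "i + 1"] dz p(2) by (simp add: add.commute)
    have e: "act M (j - 2) (i + 3) (\<pi> (?D j p)) (md M (i + 2) z) \<in> el M (j + i + 1)"
      by (rule mod_rules(1)[OF M Din[OF p(1)] dz]) simp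
    have ix: "i + 2 + 1 = i + 3" "j - 2 + (i + 2) + 1 = j + i + 1" by simp_all
    have p0: "act M (j - 2 + 1) (i + 2) (pred A b) z = \<one>\<^bsub>gr M (j + i + 1)\<^esub>" for b
      unfolding pred_eq by (rule act_zero[OF M z]) simp
    have "md M (j + i) (derivation M j i a z) = (if even j then act M (j - 2) (i + 3) (\<pi> (?D j p)) (md M (i + 2) z)
        else inv\<^bsub>gr M (j + i + 1)\<^esub> act M (j - 2) (i + 3) (\<pi> (?D j p)) (md M (i + 2) z))"
      using mod_rules(12)[OF M Din[OF p(1)] z, of "j + i", unfolded ix p0] e
      by (simp add: p(2) D[OF p(1) z] group_rules[OF M])
    thus "md M (j + i) (derivation M j i a z) = derivation M (j + 1) i (pred A a) z \<otimes>\<^bsub>gr M (j + i + 1)\<^esub>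
          (if even j then derivation M j (i + 1) a (md M (i + 2) z)
           else inv\<^bsub>gr M (j + i + 1)\<^esub> derivation M j (i + 1) a (md M (i + 2) z))"
      unfolding 0 Dz using e by (simp add: group_rules[OF M])
  qed
qed

end

locale polynomial_quotient_class = totalization_closed A \<A> + polynomial_quotient A R \<pi>
  for A :: "('k, 'a) cdg_algebra" and \<A> :: "('a, 'u) cdg_module set" and R :: "('k, 'e) ring_scheme" and \<pi>
begin

lemma acyc_if_injective:
  assumes inj: "\<And>j p q. p \<in> poly_comp R j \<Longrightarrow> q \<in> poly_comp R j \<Longrightarrow> \<pi> p = \<pi> q \<Longrightarrow> p = q"
    and M: "M \<in> Mods A" "small M"
  shows "acyc M"
proof (rule acyc_if_derivation[OF M curvature_derivation[OF M(1)]])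
  fix j i p q x assume "p \<in> poly_comp R j" "q \<in> poly_comp R j" "\<pi> p = \<pi> q"
  hence "p = q" by (rule inj)
  thus "act M (j - 2) i (\<pi> (formal_deriv R j p)) x = act M (j - 2) i (\<pi> (formal_deriv R j q)) x" by simp
qed

abbreviation "cpow m \<equiv> \<pi> (monom (UP R) \<one>\<^bsub>R\<^esub> m)"

text \<open>
  If two different polynomials of degree \<open>2 a\<close> have the same image, then \<open>a > m\<close> and their derivatives
  are multiples of \<open>c^m\<close>. So the derivative has a well-defined action on modules that \<open>c^m\<close> kills.
\<close>

lemma acyc_if_killed:
  assumes inj: "\<And>a p q. p \<in> poly_comp R (2 * int a) \<Longrightarrow> q \<in> poly_comp R (2 * int a) \<Longrightarrow> \<pi> p = \<pi> q \<Longrightarrow> a \<le> m \<Longrightarrow> p = q"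
    and M: "M \<in> Mods A" "small M"
    and kill: "\<And>i x. x \<in> el M i \<Longrightarrow> act M (2 * int m) i (cpow m) x = \<one>\<^bsub>gr M (2 * int m + i)\<^esub>"
  shows "acyc M"
proof (rule acyc_if_derivation[OF M curvature_derivation[OF M(1)]])
  interpret K: cring R by (rule R)
  interpret U: UP_cring R "UP R" by unfold_locales simp
  fix j i p q x
  assume p: "p \<in> poly_comp R j" and q: "q \<in> poly_comp R j" and pq: "\<pi> p = \<pi> q" and x: "x \<in> el M i"
  \<comment> \<open>A polynomial of degree above \<open>2 m\<close> has a derivative divisible by \<open>c^m\<close>.\<close>
  have z: "act M (j - 2) i (\<pi> (formal_deriv R j p)) x = \<one>\<^bsub>gr M (j - 2 + i)\<^esub>"
    if p: "p \<in> poly_comp R j" and j: "j = 2 * int a" "a > m" for p a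
    using R formal_deriv_in[OF R p]
  proof (cases rule: poly_comp_cases)
    case 1
    thus ?thesis using act_zero[OF M(1) x] by simp
  next
    case (2 b r)
    hence b: "b = (b - m) + m" using j by simp
    have m: "cpow m \<in> homog A (2 * int m)" by (rule \<pi>_in[OF poly_comp_monom[OF R]]) simp
    have r: "\<pi> (monom (UP R) r (b - m)) \<in> homog A (2 * int (b - m))" by (rule \<pi>_in[OF poly_comp_monom[OF R 2(1)]])
    have "\<pi> (formal_deriv R j p) = \<pi> (monom (UP R) r (b - m) \<otimes>\<^bsub>UP R\<^esub> monom (UP R) \<one>\<^bsub>R\<^esub> m)"
      using 2 b U.monom_mult[of r "\<one>\<^bsub>R\<^esub>" "b - m" m] by (simp del: U.monom_mult)
    also have "\<dots> = \<pi> (monom (UP R) r (b - m)) \<otimes>\<^bsub>A\<^esub> cpow m"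
      using 2(1) by (intro \<pi>_mult) auto
    finally have e: "\<pi> (formal_deriv R j p) = \<pi> (monom (UP R) r (b - m)) \<otimes>\<^bsub>A\<^esub> cpow m" .
    have j2: "j - 2 = 2 * int (b - m) + 2 * int m" using 2 b by simp
    show ?thesis
      unfolding e j2 mod_rules(11)[OF M(1) r m x] kill[OF x]
      using mod_rules(4)[OF M(1) r, of "2 * int m + i"] by (simp add: add.assoc)
  qed
  have "p = q \<or> (\<exists>a. j = 2 * int a \<and> a > m)"
  proof (rule ccontr)
    assume n: "\<not> (p = q \<or> (\<exists>a. j = 2 * int a \<and> a > m))"
    hence "p = q" if j: "j = 2 * int a" for a
    proof -
      have "a \<le> m"
      proof (rule ccontr)
        assume "\<not> a \<le> m"
        hence "m < a" by simp
        thus False using n j by blast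
      qed
      thus ?thesis using p q pq unfolding j by (intro inj)
    qed
    hence "p = \<zero>\<^bsub>UP R\<^esub>" "q = \<zero>\<^bsub>UP R\<^esub>" using n R p q by (blast elim: poly_comp_cases)+
    thus False using n by simp
  qed
  thus "act M (j - 2) i (\<pi> (formal_deriv R j p)) x = act M (j - 2) i (\<pi> (formal_deriv R j q)) x"
    using z p q by auto
qed

text \<open>
  Every module is an extension of \<open>c M\<close>, which \<open>c^(n-1)\<close> kills because \<open>c^n = 0\<close>, by the kernel of
  \<open>c\<close>, which \<open>c^(n-1)\<close> kills because \<open>n > 1\<close>. Multiplication by \<open>c\<close> is the square of the
  predifferential, so it is a morphism from \<open>M\<close> to \<open>M[2]\<close>, and \<open>c M\<close> is realised inside \<open>M[2]\<close>.
\<close>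

lemma acyc_if_nilpotent:
  assumes n: "n > 1" and nil: "cpow n = \<pi> \<zero>\<^bsub>UP R\<^esub>"
    and inj: "\<And>a p q. p \<in> poly_comp R (2 * int a) \<Longrightarrow> q \<in> poly_comp R (2 * int a) \<Longrightarrow> \<pi> p = \<pi> q \<Longrightarrow> a < n \<Longrightarrow> p = q"
    and M: "M \<in> Mods A" "small M"
  shows "acyc M"
proof -
  interpret K: cring R by (rule R)
  interpret U: UP_cring R "UP R" by unfold_locales simp
  obtain m where m: "n = Suc (Suc m)" 
  proof
    show "n = Suc (Suc (n - 2))" using n by simp
  qed
  let ?S = "shift (shift M)"
  note S = shift_in_Mods[OF shift_in_Mods[OF M(1)]]
  have sS: "small ?S" by (intro small_shift M(2))
  have cp: "cpow l \<in> homog A (2 * int l)" for l by (rule \<pi>_in[OF poly_comp_monom[OF R]]) simp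
  have cS: "cpow (Suc l) = cpow l \<otimes>\<^bsub>A\<^esub> curv A" for l
  proof -
    have "monom (UP R) \<one>\<^bsub>R\<^esub> (Suc l) = monom (UP R) \<one>\<^bsub>R\<^esub> l \<otimes>\<^bsub>UP R\<^esub> cvar R"
      by (rule U.monom_one_Suc)
    thus ?thesis by (simp only: \<pi>_mult[OF U.monom_closed[OF K.one_closed] U.monom_closed[OF K.one_closed]] \<pi>_curv)
  qed
  have actS: "act M (2 * int (Suc l)) i (cpow (Suc l)) x = act M (2 * int l) (2 + i) (cpow l) (act M 2 i (curv A) x)"
    if "x \<in> el M i" for l i x
  proof -
    have "2 * int (Suc l) = 2 * int l + 2" by simp
    thus ?thesis by (simp only: cS mod_rules(11)[OF M(1) cp curv_in that])
  qed
  define c where "c = (\<lambda>i x. md M (i + 1) (md M i x))"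
  have cc: "c i x = act M 2 i (curv A) x" if "x \<in> el M i" for i x
    using that by (simp add: c_def mod_rules[OF M(1)])
  have predact: "act M (j + 1) i (pred A a) x = \<one>\<^bsub>gr M (j + i + 1)\<^esub>" if "x \<in> el M i" for j i a x
    using act_zero[OF M(1) that, of "j + i + 1" "j + 1"] by (simp add: pred_eq)
  have c: "c \<in> mor A M ?S"
    unfolding c_def
    by (rule morI[OF S]) (simp_all add: M(1) S shift_in_Mods shift_gr shift_md shift_act mod_simps predact pred_eq act_zero)
  note cr = mor_rules[OF c M(1) S]
  have ch: "group_hom (gr M i) (gr ?S i) (c i)" for i
    using cr by (auto simp: group_hom_def group_hom_axioms_def hom_def Mods_group[OF M(1)] Mods_group[OF S])
  define K where "K = restrict_module M (\<lambda>i. kernel (gr M i) (gr ?S i) (c i))"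
  define I where "I = restrict_module ?S (\<lambda>i. c i ` el M i)"
  have KM: "K \<in> Mods A"
    unfolding K_def
  proof (rule restrict_module_in_Mods[OF M(1)])
    show "subgroup (kernel (gr M i) (gr ?S i) (c i)) (gr M i)" for i by (rule group_hom.subgroup_kernel[OF ch])
  qed (auto simp: kernel_def cr mod_rules[OF M(1)] mod_rules[OF S])
  have IM: "I \<in> Mods A"
    unfolding I_def
  proof (rule restrict_module_in_Mods[OF S])
    show "subgroup (c i ` el M i) (gr ?S i)" for i
      using group_hom.img_is_subgroup[OF ch] .
    show "act ?S j i a y \<in> c (j + i) ` el M (j + i)" if a: "a \<in> homog A j" and y: "y \<in> c i ` el M i" for j i a y
    proof -
      obtain x where x: "x \<in> el M i" "y = c i x" using y by blast
      have "act ?S j i a y = c (j + i) (act M j i a x)" using a x by (simp add: cr)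
      thus ?thesis using a x by (simp add: mod_rules[OF M(1)])
    qed
    show "md ?S i y \<in> c (i + 1) ` el M (i + 1)" if y: "y \<in> c i ` el M i" for i y
    proof -
      obtain x where x: "x \<in> el M i" "y = c i x" using y by blast
      have "md ?S i y = c (i + 1) (md M i x)" using x by (simp add: cr)
      thus ?thesis using x by (simp add: mod_rules[OF M(1)])
    qed
  qed
  have sub: "el K i \<subseteq> el M i" "el I i \<subseteq> el ?S i" for i
    by (auto simp: K_def I_def restrict_simps kernel_def cr)
  have small: "small K" "small I"
    using M(2) sS sub unfolding small_def by (meson lepoll_trans subset_imp_lepoll)+
  have one: "\<one>\<^bsub>gr M (2 * int (Suc m) + i)\<^esub> = \<one>\<^bsub>gr M (2 * int m + (2 + i))\<^esub>" for i
    by (simp add: algebra_simps)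
  have "acyc K"
  proof (rule acyc_if_killed[of "Suc m", OF inj KM small(1)])
    fix i x assume "x \<in> el K i"
    hence x: "x \<in> el M i" "c i x = \<one>\<^bsub>gr M (2 + i)\<^esub>"
      by (auto simp: K_def restrict_simps kernel_def shift_gr add.commute)
    have "act M (2 * int (Suc m)) i (cpow (Suc m)) x = act M (2 * int m) (2 + i) (cpow m) \<one>\<^bsub>gr M (2 + i)\<^esub>"
      using x cc[of x i] by (simp only: actS)
    also have "\<dots> = \<one>\<^bsub>gr M (2 * int (Suc m) + i)\<^esub>"
      unfolding one by (rule mod_rules(4)[OF M(1) cp])
    finally show "act K (2 * int (Suc m)) i (cpow (Suc m)) x = \<one>\<^bsub>gr K (2 * int (Suc m) + i)\<^esub>"
      by (simp add: K_def restrict_simps)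
  qed (simp_all add: m less_Suc_eq_le)
  moreover have "acyc I"
  proof (rule acyc_if_killed[of "Suc m", OF inj IM small(2)])
    fix i y assume "y \<in> el I i"
    then obtain x where x: "x \<in> el M i" "y = c i x" by (auto simp: I_def restrict_simps)
    have y: "c i x \<in> el M (2 + i)" using cr(1)[OF x(1)] by (simp add: shift_gr)
    have "act ?S (2 * int (Suc m)) i (cpow (Suc m)) y = act M (2 * int (Suc m)) (2 + i) (cpow (Suc m)) (c i x)"
      using cp[of "Suc m"] y by (simp add: x(2) shift_act shift_gr M(1) shift_in_Mods)
    also have "\<dots> = act M (2 * int (Suc (Suc m))) i (cpow (Suc (Suc m))) x"
      using x by (simp only: actS cc)
    also have "\<dots> = \<one>\<^bsub>gr ?S (2 * int (Suc m) + i)\<^esub>"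
      using act_zero[OF M(1) x(1), of _ "2 * int (Suc (Suc m))"] nil by (simp add: m shift_gr algebra_simps)
    finally show "act I (2 * int (Suc m)) i (cpow (Suc m)) y = \<one>\<^bsub>gr I (2 * int (Suc m) + i)\<^esub>"
      by (simp add: I_def restrict_simps)
  qed (simp_all add: m less_Suc_eq_le)
  moreover have "exact_modules K (\<lambda>i x. x) M c I"
    unfolding exact_modules_def
  proof (intro conjI allI)
    show "(\<lambda>i x. x) \<in> mor A K M"
      by (rule morI[OF M(1)]) (use sub in \<open>auto simp: K_def restrict_simps\<close>)
    show "c \<in> mor A M I"
      by (rule morI[OF IM]) (auto simp: I_def restrict_simps cr)
  qed (auto simp: K_def I_def restrict_simps kernel_def)
  ultimately show ?thesis using M exact_acyc_middle by blast
qed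

end

section \<open>The two algebras\<close>

lemma curved_algebraI:
  assumes "is_cdg_algebra k A" shows "curved_algebra A"
proof
  show "pred A a \<in> homog A (j + 1)" if "a \<in> homog A j" for a j
    using assms that unfolding is_cdg_algebra_def by blast
  show "curv A \<in> homog A 2" "\<one>\<^bsub>A\<^esub> \<in> homog A 0"
    using assms unfolding is_cdg_algebra_def by blast+
  have sub: "submodule (homog A j) k A" for j
    using assms unfolding is_cdg_algebra_def by blast
  show "a \<oplus>\<^bsub>A\<^esub> b \<in> homog A j" if "a \<in> homog A j" "b \<in> homog A j" for a b j
    using subgroup.m_closed[OF submodule.axioms(1)[OF sub] that] by simp
  show "a \<otimes>\<^bsub>A\<^esub> b \<in> homog A (j + l)" if "a \<in> homog A j" "b \<in> homog A l" for a b j l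
    using assms that unfolding is_cdg_algebra_def by blast
qed

lemma poly_cdg_quotient:
  assumes k: "cring k"
  shows "polynomial_quotient (poly_cdg k) k (\<lambda>p. p)"
proof -
  interpret curved_algebra "poly_cdg k" by (rule curved_algebraI[OF is_cdg_algebra_poly_cdg[OF k]])
  show ?thesis
    by (intro polynomial_quotient.intro curved_algebra_axioms polynomial_quotient_axioms.intro)
      (simp_all add: k poly_cdg_def)
qed

lemma trunc_cdg_quotient:
  assumes k: "cring k"
  shows "polynomial_quotient (trunc_cdg k n) k (\<lambda>p. trunc_ideal k n +>\<^bsub>UP k\<^esub> p)"
proof -
  interpret curved_algebra "trunc_cdg k n" by (rule curved_algebraI[OF is_cdg_algebra_trunc_cdg[OF k]])
  interpret K: cring k by (rule k)
  interpret U: UP_cring k "UP k" by unfold_locales simp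
  interpret I: ideal "trunc_ideal k n" "UP k" by (rule ideal_trunc_ideal[OF k])
  interpret h: ring_hom_cring "UP k" "UP k Quot trunc_ideal k n" "\<lambda>p. trunc_ideal k n +>\<^bsub>UP k\<^esub> p"
    by (rule I.rcos_ring_hom_cring[OF U.UP_cring])
  show ?thesis
    
    by (intro polynomial_quotient.intro curved_algebra_axioms polynomial_quotient_axioms.intro)
      (simp_all add: k trunc_cdg_def Let_def)
qed

lemma trunc_coset_eq:
  assumes k: "cring k" and p: "p \<in> carrier (UP k)" and q: "q \<in> carrier (UP k)"
  shows "trunc_ideal k n +>\<^bsub>UP k\<^esub> p = trunc_ideal k n +>\<^bsub>UP k\<^esub> q \<longleftrightarrow> (\<forall>m<n. coeff (UP k) p m = coeff (UP k) q m)"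
proof -
  interpret K: cring k by (rule k)
  interpret U: UP_cring k "UP k" by unfold_locales simp
  interpret I: ideal "trunc_ideal k n" "UP k" by (rule ideal_trunc_ideal[OF k])
  have "trunc_ideal k n +>\<^bsub>UP k\<^esub> p = trunc_ideal k n +>\<^bsub>UP k\<^esub> q \<longleftrightarrow> p \<ominus>\<^bsub>UP k\<^esub> q \<in> trunc_ideal k n"
    using p q I.a_rcos_module_minus[OF U.UP_ring q p] I.a_rcos_self[of p] I.a_repr_independence'[of p q] by auto
  also have "\<dots> \<longleftrightarrow> (\<forall>m<n. coeff (UP k) p m \<ominus>\<^bsub>k\<^esub> coeff (UP k) q m = \<zero>\<^bsub>k\<^esub>)"
    unfolding mem_trunc_ideal[OF k] using p q by (auto simp: a_minus_def)
  also have "\<dots> \<longleftrightarrow> (\<forall>m<n. coeff (UP k) p m = coeff (UP k) q m)"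
  proof -
    have "x \<ominus>\<^bsub>k\<^esub> y = \<zero>\<^bsub>k\<^esub> \<longleftrightarrow> x = y" if "x \<in> carrier k" "y \<in> carrier k" for x y
      using that K.minus_equality[of x "\<ominus>\<^bsub>k\<^esub> y"] by (auto simp: a_minus_def K.r_neg)
    thus ?thesis using p q by simp
  qed
  finally show ?thesis .
qed

lemma poly_cdg_all_acyclic:
  fixes \<A> :: "(nat \<Rightarrow> 'k, 'u) cdg_module set"
  assumes k: "cring k" and inf: "infinite (UNIV :: 'u set)"
    and "thick (poly_cdg k) \<A>" "A1 (poly_cdg k) \<A>"
  shows "Mods (poly_cdg k) \<subseteq> \<A>"
proof -
  interpret polynomial_quotient "poly_cdg k" k "\<lambda>p. p" by (rule poly_cdg_quotient[OF k])
  interpret polynomial_quotient_class "poly_cdg k" \<A> k "\<lambda>p. p"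
    using assms by unfold_locales
  show ?thesis
  proof
    fix M :: "(nat \<Rightarrow> 'k, 'u) cdg_module" assume "M \<in> Mods (poly_cdg k)"
    hence "acyc M" using small_universe by (intro acyc_if_injective)
    thus "M \<in> \<A>" by (simp add: acyc_iff)
  qed
qed

lemma trunc_cdg_all_acyclic:
  fixes \<A> :: "((nat \<Rightarrow> 'k) set, 'u) cdg_module set"
  assumes k: "cring k" and inf: "infinite (UNIV :: 'u set)" and n: "n > 1"
    and "thick (trunc_cdg k n) \<A>" "A1 (trunc_cdg k n) \<A>"
  shows "Mods (trunc_cdg k n) \<subseteq> \<A>"
proof -
  let ?\<pi> = "\<lambda>p. trunc_ideal k n +>\<^bsub>UP k\<^esub> p"
  interpret K: cring k by (rule k)
  interpret U: UP_cring k "UP k" by unfold_locales simp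
  interpret polynomial_quotient "trunc_cdg k n" k ?\<pi> by (rule trunc_cdg_quotient[OF k])
  interpret polynomial_quotient_class "trunc_cdg k n" \<A> k ?\<pi>
    using assms by unfold_locales
  show ?thesis
  proof
    fix M :: "((nat \<Rightarrow> 'k) set, 'u) cdg_module" assume M: "M \<in> Mods (trunc_cdg k n)"
    have "acyc M"
    proof (rule acyc_if_nilpotent[OF n _ _ M small_universe])
      show "?\<pi> (monom (UP k) \<one>\<^bsub>k\<^esub> n) = ?\<pi> \<zero>\<^bsub>UP k\<^esub>"
        by (simp add: trunc_coset_eq[OF k])
      fix a p q assume p: "p \<in> poly_comp k (2 * int a)" and q: "q \<in> poly_comp k (2 * int a)"
        and e: "?\<pi> p = ?\<pi> q" and a: "a < n"
      have c: "p \<in> carrier (UP k)" "q \<in> carrier (UP k)" using p q by (simp_all add: poly_comp_closed)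
      show "p = q"
      proof (rule U.up_eqI[OF _ c])
        fix m
        show "coeff (UP k) p m = coeff (UP k) q m"
        proof (cases "m = a")
          case True
          thus ?thesis using e a by (simp add: trunc_coset_eq[OF k c])
        next
          case False
          hence "coeff (UP k) p m = \<zero>\<^bsub>k\<^esub>" "coeff (UP k) q m = \<zero>\<^bsub>k\<^esub>"
            using p q by (auto simp: poly_comp_def)
          thus ?thesis by simp
        qed
      qed
    qed
    thus "M \<in> \<A>" by (simp add: acyc_iff)
  qed
qed

text \<open>
  The quotient category vanishes if and only if every module is acyclic, and the class of all modules
  has all closure properties.
\<close>

lemma closed_iff_derived_cat_zero:
  fixes A :: "('k, 'a) cdg_algebra" and \<A> :: "('a, 'u) cdg_module set"
  assumes A: "is_cdg_algebra k A" and inf: "infinite (UNIV :: 'u set)" and thick: "thick A \<A>"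
    and all: "A1 A \<A> \<Longrightarrow> Mods A \<subseteq> \<A>"
  shows "A1 A \<A> \<and> A2 A \<A> \<and> A3 A \<A> \<longleftrightarrow> derived_cat_zero A \<A>"
    and "A1 A \<A> \<and> A2 A \<A> \<longleftrightarrow> derived_cat_zero A \<A>"
proof -
  interpret curved_algebra A by (rule curved_algebraI[OF A])
  interpret thick_subcategory A \<A> using inf thick by unfold_locales
  have "A1 A \<A> \<Longrightarrow> derived_cat_zero A \<A>" using all derived_cat_zeroI by blast
  moreover have "A1 A \<A>" "A2 A \<A>" "A3 A \<A>" if "derived_cat_zero A \<A>"
    using derived_cat_zeroD[OF that] unfolding A1_def A2_def A3_def by blast+
  ultimately show "A1 A \<A> \<and> A2 A \<A> \<and> A3 A \<A> \<longleftrightarrow> derived_cat_zero A \<A>"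
    and "A1 A \<A> \<and> A2 A \<A> \<longleftrightarrow> derived_cat_zero A \<A>" by blast+
qed

theorem proposition3p2:
  fixes k :: "('k, 'e) ring_scheme"
  assumes "cring k" and "infinite (UNIV :: 'u set)"
  shows "(\<forall>\<A> :: (nat \<Rightarrow> 'k, 'u) cdg_module set. thick (poly_cdg k) \<A> \<longrightarrow>
            (A1 (poly_cdg k) \<A> \<and> A2 (poly_cdg k) \<A> \<and> A3 (poly_cdg k) \<A>
               \<longleftrightarrow> derived_cat_zero (poly_cdg k) \<A>)) \<and>
         (\<forall>n > 1. \<forall>\<A> :: ((nat \<Rightarrow> 'k) set, 'u) cdg_module set. thick (trunc_cdg k n) \<A> \<longrightarrow>
            (A1 (trunc_cdg k n) \<A> \<and> A2 (trunc_cdg k n) \<A> \<and> A3 (trunc_cdg k n) \<A>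
               \<longleftrightarrow> derived_cat_zero (trunc_cdg k n) \<A>)) \<and>
         (field k \<longrightarrow>
            (\<forall>\<A> :: (nat \<Rightarrow> 'k, 'u) cdg_module set. thick (poly_cdg k) \<A> \<longrightarrow>
               (A1 (poly_cdg k) \<A> \<and> A2 (poly_cdg k) \<A>
                  \<longleftrightarrow> derived_cat_zero (poly_cdg k) \<A>)) \<and>
            (\<forall>n > 1. \<forall>\<A> :: ((nat \<Rightarrow> 'k) set, 'u) cdg_module set. thick (trunc_cdg k n) \<A> \<longrightarrow>
               (A1 (trunc_cdg k n) \<A> \<and> A2 (trunc_cdg k n) \<A>
                  \<longleftrightarrow> derived_cat_zero (trunc_cdg k n) \<A>)))"
proof -
  note poly = closed_iff_derived_cat_zero[OF is_cdg_algebra_poly_cdg[OF assms(1)] assms(2) _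
      poly_cdg_all_acyclic[OF assms]]
  note trunc = closed_iff_derived_cat_zero[OF is_cdg_algebra_trunc_cdg[OF assms(1)] assms(2) _
      trunc_cdg_all_acyclic[OF assms]]
  show ?thesis by (intro conjI allI impI poly trunc)
qed

end
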